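(* Let $\mathcal P\subset\mathcal P_0$ and $C,c>0$. Assume $A_fA_g=o_{\mathcal P}(n^{-1})$, $B_f=o_{\mathcal P}(1)$, $B_g=o_{\mathcal P}(1)$, that there exists $\eta>0$ with $\sup_{P\in\mathcal P}\mathbb E_P[|\epsilon_P\xi_P|^{2+\eta}]<\infty$, and that $\mathcal W_{P,C,c}$ is nonempty for all $P\in\mathcal P$. Then $\sup_{P\in\mathcal P}\sup_{w\in\mathcal W_{P,C,c}}\sup_{t\in\mathbb R}|\mathbb P_P(T_w^{(n)}\le t)-\Phi(t)|\to0$.
   Context: Let $X,Y$ be real-valued random variables and $Z$ a random vector in $\mathbb R^{d_Z}$. $\mathcal E_0$ is the set of distributions of $(X,Y,Z)$ absolutely continuous with respect to Lebesgue measure, $\mathcal P_0\subseteq\mathcal E_0$ those under which $X$ and $Y$ are conditionally independent given $Z$. For $P\in\mathcal E_0$: $f_P(z)=\mathbb E_P[X\mid Z=z]$, $g_P(z)=\mathbb E_P[Y\mid Z=z]$, $\epsilon_P=X-f_P(Z)$, $\xi_P=Y-g_P(Z)$, $u_P(z)=\mathbb E_P[\epsilon_P^2\mid Z=z]$, $v_P(z)=\mathbb E_P[\xi_P^2\mid Z=z]$. Data $(x_i,y_i,z_i)$, $i=1,\dots,n$, i.i.d. copies of $(X,Y,Z)$; $\hat f$ obtained by regressing $\mathbf X^{(n)}$ on $\mathbf Z^{(n)}$, $\hat g$ by regressing $\mathbf Y^{(n)}$ on $\mathbf Z^{(n)}$. $A_f=\frac1n\sum_i(f_P(z_i)-\hat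 f(z_i))^2$, $A_g=\frac1n\sum_i(g_P(z_i)-\hat g(z_i))^2$, $B_f=\frac1n\sum_i(f_P(z_i)-\hat f(z_i))^2v_P(z_i)$, $B_g=\frac1n\sum_i(g_P(z_i)-\hat g(z_i))^2u_P(z_i)$. $\mathcal W_{P,C,c}$ is the set of measurable $w:\mathbb R^{d_Z}\to\mathbb R$ with $|w|\le C$ and $\mathbb E_P[\epsilon_P^2\xi_P^2w(Z)^2]\ge c$. For such $w$, $R_{w,i}=(x_i-\hat f(z_i))(y_i-\hat g(z_i))w(z_i)$ and $T_w^{(n)}=\frac{\frac1{\sqrt n}\sum_iR_{w,i}}{(\frac1n\sum_iR_{w,i}^2-(\frac1n\sum_rR_{w,r})^2)^{1/2}}$. $\Phi$ is the standard normal distribution function. $V_n=o_{\mathcal P}(W_n)$ means $\sup_{P\in\mathcal P}\mathbb P_P(|V_n/W_n|>\delta)\to0$ for all $\delta>0$. *)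

theory Defs
  imports "HOL-Probability.Probability"
begin

definition Xv :: "real \<times> real \<times> 'z \<Rightarrow> real" where "Xv \<omega> = fst \<omega>"
definition Yv :: "real \<times> real \<times> 'z \<Rightarrow> real" where "Yv \<omega> = fst (snd \<omega>)"
definition Zv :: "real \<times> real \<times> 'z \<Rightarrow> 'z" where "Zv \<omega> = snd (snd \<omega>)"

definition sigmaZ :: "(real \<times> real \<times> 'z::euclidean_space) measure \<Rightarrow> (real \<times> real \<times> 'z) measure" where
  "sigmaZ P = vimage_algebra (space P) Zv borel"

definition cond_exp_fun :: "(real \<times> real \<times> 'z::euclidean_space) measure \<Rightarrow> (real \<times> real \<times> 'z \<Rightarrow> real) \<Rightarrow> 'z \<Rightarrow> real" where
  "cond_exp_fun P h = (SOME g. g \<in> borel_measurable borel \<and>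
      (AE \<omega> in P. g (Zv \<omega>) = real_cond_exp P (sigmaZ P) h \<omega>))"

definition E0 :: "(real \<times> real \<times> 'z::euclidean_space) measure set" where
  "E0 = {P. prob_space P \<and> sets P = sets borel \<and> absolutely_continuous lborel P}"

definition cond_indep_XY_Z :: "(real \<times> real \<times> 'z::euclidean_space) measure \<Rightarrow> bool" where
  "cond_indep_XY_Z P \<longleftrightarrow> (\<forall>A \<in> sets (borel :: real measure). \<forall>B \<in> sets (borel :: real measure).
     AE \<omega> in P. real_cond_exp P (sigmaZ P) (\<lambda>\<omega>. indicator A (Xv \<omega>) * indicator B (Yv \<omega>)) \<omega>
       = real_cond_exp P (sigmaZ P) (\<lambda>\<omega>. indicator A (Xv \<omega>)) \<omega>
         * real_cond_exp P (sigmaZ P) (\<lambda>\<omega>. indicator B (Yv \<omega>)) \<omega>)"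

definition P0 :: "(real \<times> real \<times> 'z::euclidean_space) measure set" where
  "P0 = {P \<in> E0. cond_indep_XY_Z P}"

definition fP :: "(real \<times> real \<times> 'z::euclidean_space) measure \<Rightarrow> 'z \<Rightarrow> real" where
  "fP P = cond_exp_fun P Xv"
definition gP :: "(real \<times> real \<times> 'z::euclidean_space) measure \<Rightarrow> 'z \<Rightarrow> real" where
  "gP P = cond_exp_fun P Yv"
definition epsP :: "(real \<times> real \<times> 'z::euclidean_space) measure \<Rightarrow> real \<times> real \<times> 'z \<Rightarrow> real" where
  "epsP P \<omega> = Xv \<omega> - fP P (Zv \<omega>)"
definition xiP :: "(real \<times> real \<times> 'z::euclidean_space) measure \<Rightarrow> real \<times> real \<times> 'z \<Rightarrow> real" where
  "xiP P \<omega> = Yv \<omega> - gP P (Zv \<omega>)"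
definition uP :: "(real \<times> real \<times> 'z::euclidean_space) measure \<Rightarrow> 'z \<Rightarrow> real" where
  "uP P = cond_exp_fun P (\<lambda>\<omega>. (epsP P \<omega>)\<^sup>2)"
definition vP :: "(real \<times> real \<times> 'z::euclidean_space) measure \<Rightarrow> 'z \<Rightarrow> real" where
  "vP P = cond_exp_fun P (\<lambda>\<omega>. (xiP P \<omega>)\<^sup>2)"

definition sampleP :: "(real \<times> real \<times> 'z::euclidean_space) measure \<Rightarrow> nat \<Rightarrow> (nat \<Rightarrow> real \<times> real \<times> 'z) measure" where
  "sampleP P n = PiM {..<n} (\<lambda>_. P)"

text \<open>A regression method: given sample size n, responses (r_i) and covariates (z_i),
  returns a fitted function 'z \<Rightarrow> real. It must be measurable in (data, point).\<close>
definition regression_method :: "(nat \<Rightarrow> (nat \<Rightarrow> real) \<Rightarrow> (nat \<Rightarrow> 'z::euclidean_space) \<Rightarrow> 'z \<Rightarrow> real) \<Rightarrow> bool" where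
  "regression_method reg \<longleftrightarrow> (\<forall>n. (\<lambda>(r, zs, z). reg n r zs z) \<in>
      borel_measurable (PiM {..<n} (\<lambda>_. (borel :: real measure)) \<Otimes>\<^sub>M PiM {..<n} (\<lambda>_. (borel :: 'z measure)) \<Otimes>\<^sub>M borel))"

definition fhat :: "(nat \<Rightarrow> (nat \<Rightarrow> real) \<Rightarrow> (nat \<Rightarrow> 'z) \<Rightarrow> 'z \<Rightarrow> real) \<Rightarrow> nat \<Rightarrow> (nat \<Rightarrow> real \<times> real \<times> 'z) \<Rightarrow> 'z \<Rightarrow> real" where
  "fhat reg n \<omega> = reg n (\<lambda>i\<in>{..<n}. Xv (\<omega> i)) (\<lambda>i\<in>{..<n}. Zv (\<omega> i))"
definition ghat :: "(nat \<Rightarrow> (nat \<Rightarrow> real) \<Rightarrow> (nat \<Rightarrow> 'z) \<Rightarrow> 'z \<Rightarrow> real) \<Rightarrow> nat \<Rightarrow> (nat \<Rightarrow> real \<times> real \<times> 'z) \<Rightarrow> 'z \<Rightarrow> real" where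
  "ghat reg n \<omega> = reg n (\<lambda>i\<in>{..<n}. Yv (\<omega> i)) (\<lambda>i\<in>{..<n}. Zv (\<omega> i))"

definition A_f where
  "A_f P regX n \<omega> = (1 / real n) * (\<Sum>i<n. (fP P (Zv (\<omega> i)) - fhat regX n \<omega> (Zv (\<omega> i)))\<^sup>2)"
definition A_g where
  "A_g P regY n \<omega> = (1 / real n) * (\<Sum>i<n. (gP P (Zv (\<omega> i)) - ghat regY n \<omega> (Zv (\<omega> i)))\<^sup>2)"
definition B_f where
  "B_f P regX n \<omega> = (1 / real n) * (\<Sum>i<n. (fP P (Zv (\<omega> i)) - fhat regX n \<omega> (Zv (\<omega> i)))\<^sup>2 * vP P (Zv (\<omega> i)))"
definition B_g where
  "B_g P regY n \<omega> = (1 / real n) * (\<Sum>i<n. (gP P (Zv (\<omega> i)) - ghat regY n \<omega> (Zv (\<omega> i)))\<^sup>2 * uP P (Zv (\<omega> i)))"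

definition Wset :: "(real \<times> real \<times> 'z::euclidean_space) measure \<Rightarrow> real \<Rightarrow> real \<Rightarrow> ('z \<Rightarrow> real) set" where
  "Wset P C c = {w. w \<in> borel_measurable borel \<and> (\<forall>z. \<bar>w z\<bar> \<le> C) \<and>
      (\<integral>\<omega>. (epsP P \<omega>)\<^sup>2 * (xiP P \<omega>)\<^sup>2 * (w (Zv \<omega>))\<^sup>2 \<partial>P) \<ge> c}"

definition R_w where
  "R_w regX regY w n \<omega> i = (Xv (\<omega> i) - fhat regX n \<omega> (Zv (\<omega> i))) * (Yv (\<omega> i) - ghat regY n \<omega> (Zv (\<omega> i))) * w (Zv (\<omega> i))"

definition T_w where
  "T_w regX regY w n \<omega> =
     ((1 / sqrt (real n)) * (\<Sum>i<n. R_w regX regY w n \<omega> i)) /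
     sqrt ((1 / real n) * (\<Sum>i<n. (R_w regX regY w n \<omega> i)\<^sup>2) - ((1 / real n) * (\<Sum>r<n. R_w regX regY w n \<omega> r))\<^sup>2)"

definition Phi :: "real \<Rightarrow> real" where
  "Phi = cdf (density lborel std_normal_density)"

text \<open>V_n = o_{\<P>}(W_n): sup over P in \<P> of P(|V_n/W_n| > \<delta>) tends to 0 for every \<delta> > 0
  (written out: the supremum of these probabilities is eventually \<le> \<epsilon>).\<close>
definition o_unif :: "(real \<times> real \<times> 'z::euclidean_space) measure set \<Rightarrow>
    ((real \<times> real \<times> 'z) measure \<Rightarrow> nat \<Rightarrow> (nat \<Rightarrow> real \<times> real \<times> 'z) \<Rightarrow> real) \<Rightarrow> (nat \<Rightarrow> real) \<Rightarrow> bool" where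
  "o_unif \<P> V W \<longleftrightarrow> (\<forall>\<delta>>0. \<forall>\<epsilon>>0. \<exists>N. \<forall>n\<ge>N. \<forall>P\<in>\<P>.
      measure (sampleP P n) {\<omega> \<in> space (sampleP P n). \<bar>V P n \<omega> / W n\<bar> > \<delta>} \<le> \<epsilon>)"

end

theory Submission
  imports Defs
begin

text \<open>The numerator of the statistic splits, after normalising the weight by the standard deviation of
  \<open>\<epsilon>\<xi>w\<close>, into a standardised i.i.d. sum of \<open>\<epsilon>\<xi>w\<close>, two sums in which a regression error multiplies
  a residual, and a product of regression errors. The last is controlled by \<open>n A\<^sub>f A\<^sub>g\<close> via
  Cauchy-Schwarz. Given the sample of \<open>(X, Z)\<close>, the \<open>\<xi>\<close>-residuals are, by conditional independence,
  independent and centred with variances \<open>v(z\<^sub>i)\<close>, so on the event \<open>B\<^sub>f \<le> \<kappa>\<close> a mixed sum has second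
  moment at most a constant times \<open>\<kappa>\<close>. Uniformity over the class follows by running the argument along
  arbitrary sequences of laws and weights: a Lyapunov central limit theorem for arrays, a weak law with
  uniform moments, Slutsky and Polya.

  \<open>X\<close> and \<open>Y\<close> are not assumed integrable. Conditional independence factorises the moment of \<open>\<epsilon>\<xi>\<close>
  given \<open>Z\<close>, and absolute continuity prevents either factor from vanishing, so both conditional moments
  are almost surely finite.\<close>

section \<open>Conditional independence\<close>

text \<open>The fitted functions depend on the whole sample, so the summands of a mixed term need
  not be independent or square integrable. Conditioning is never carried out with conditional
  distributions on the product space. It is encoded by integral identities for one observation
  against arbitrary functions of (X, Z); freezing all coordinates but one turns a function of the
  sample of (X, Z) into such a test function, and Fubini does the rest. The indicator of
  \<open>B_f \<le> \<kappa>\<close> is itself a function of that sample, and it makes the second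
  moments finite. Both bounds on the weight enter through one constant: after division by the
  standard deviation, which is at least \<open>sqrt c\<close>, a weight is bounded by
  \<open>C / sqrt c\<close>. In the denominator, root mean squares obey the triangle inequality, so
  cross products of the four terms never have to be estimated. If uniformity failed, a violating law
  and weight could be chosen at arbitrarily large sample sizes. Hence the limit theorems let the law
  change with n, with constants that depend on it only through the moment bound.\<close>

lemma measurable_vimage_algebra_factor:
  fixes h :: "'a \<Rightarrow> real" and Z :: "'a \<Rightarrow> 'b"
  assumes Z: "Z \<in> UNIV \<rightarrow> space N" and h: "h \<in> borel_measurable (vimage_algebra UNIV Z N)"
  shows "\<exists>g \<in> borel_measurable N. \<forall>x. h x = g (Z x)"
proof -
  obtain s where s: "\<And>i. simple_function (vimage_algebra UNIV Z N) (s i)"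
    and lim: "\<And>x. (\<lambda>i. s i x) \<longlonglongrightarrow> h x"
    using borel_measurable_implies_sequence_metric[OF h, of 0] by auto
  have "\<exists>A. \<forall>y. A y \<in> sets N \<and> s i -` {y} = Z -` A y" for i
  proof (intro choice allI)
    fix y
    have "s i -` {y} \<inter> UNIV \<in> sets (vimage_algebra UNIV Z N)"
      using simple_functionD(2)[OF s, of i "{y}"] by simp
    then show "\<exists>A. A \<in> sets N \<and> s i -` {y} = Z -` A"
      using sets_vimage_algebra2[OF Z] by auto
  qed
  then obtain A where A: "\<And>i y. A i y \<in> sets N" "\<And>i y. s i -` {y} = Z -` A i y"
    by metis
  define g where "g i z = (\<Sum>y\<in>range (s i). y * indicator (A i y) z)" for i z
  have fin: "finite (range (s i))" for i using simple_functionD(1)[OF s, of i] by simp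
  have g: "g i (Z x) = s i x" for i x
  proof -
    have "indicator (A i y) (Z x) = (if y = s i x then 1 else 0 :: real)" for y
      using A(2)[of i y] by (auto simp: indicator_def set_eq_iff)
    then have "g i (Z x) = (\<Sum>y\<in>range (s i). if y = s i x then y else 0)"
      unfolding g_def by (intro sum.cong) auto
    then show ?thesis using fin[of i] by simp
  qed
  have [measurable]: "g i \<in> borel_measurable N" for i
    unfolding g_def using A(1) by measurable
  \<comment> \<open>Off the range of \<open>Z\<close> the \<open>g i\<close> need not converge;
    \<open>lim\<close> still gives a measurable function there, and only its values at the points
    \<open>Z x\<close> matter.\<close>
  have "(\<lambda>z. lim (\<lambda>i. g i z)) \<in> borel_measurable N"
    by measurable
  moreover have "h x = lim (\<lambda>i. g i (Z x))" for x
    using lim[of x] by (simp add: g limI)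
  ultimately show ?thesis by (intro bexI[where x="\<lambda>z. lim (\<lambda>i. g i z)"]) auto
qed

text \<open>Both integrals are those of \<psi> under the image by \<open>W\<close> of the measure
  with density \<open>a\<close>, respectively \<open>b\<close>. Equality is given on all measurable
  sets, so the two image measures coincide even when they are infinite.\<close>

lemma nn_integral_eq_from_sets:
  assumes [measurable]: "a \<in> borel_measurable M" "b \<in> borel_measurable M" "W \<in> measurable M N"
    and eq: "\<And>S. S \<in> sets N \<Longrightarrow> (\<integral>\<^sup>+x. a x * indicator S (W x) \<partial>M) = (\<integral>\<^sup>+x. b x * indicator S (W x) \<partial>M)"
    and [measurable]: "\<psi> \<in> borel_measurable N"
  shows "(\<integral>\<^sup>+x. a x * \<psi> (W x) \<partial>M) = (\<integral>\<^sup>+x. b x * \<psi> (W x) \<partial>M)"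
proof -
  have e: "emeasure (distr (density M c) N W) S = (\<integral>\<^sup>+x. c x * indicator S (W x) \<partial>M)"
    if [measurable]: "c \<in> borel_measurable M" "S \<in> sets N" for c S
  proof -
    have [simp]: "indicator (W -` S \<inter> space M) x = (indicator S (W x) :: ennreal)" if "x \<in> space M" for x
      using that by (auto simp: indicator_def)
    show ?thesis
      by (subst emeasure_distr) (auto simp: emeasure_density intro!: nn_integral_cong)
  qed
  have "distr (density M a) N W = distr (density M b) N W"
    by (rule measure_eqI) (auto simp: e eq)
  then have "(\<integral>\<^sup>+y. \<psi> y \<partial>distr (density M a) N W) = (\<integral>\<^sup>+y. \<psi> y \<partial>distr (density M b) N W)"
    by simp
  then show ?thesis
    by (simp add: nn_integral_distr nn_integral_density)
qed

text \<open>Here the two image measures are compared only on rectangles, a generator stable under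
  intersections. That uniqueness argument works with finite mass, which \<open>fin\<close> supplies;
  the preceding lemma serves densities of infinite mass.\<close>

lemma nn_integral_eq_from_rectangles:
  fixes V :: "'a \<Rightarrow> 'b::second_countable_topology" and Z :: "'a \<Rightarrow> 'c::second_countable_topology"
  assumes [measurable]: "a \<in> borel_measurable M" "b \<in> borel_measurable M"
    and [measurable]: "V \<in> borel_measurable M" "Z \<in> borel_measurable M"
    and fin: "(\<integral>\<^sup>+x. a x \<partial>M) \<noteq> \<infinity>"
    and eq: "\<And>A D. A \<in> sets borel \<Longrightarrow> D \<in> sets borel \<Longrightarrow>
      (\<integral>\<^sup>+x. a x * (indicator A (V x) * indicator D (Z x)) \<partial>M)
      = (\<integral>\<^sup>+x. b x * (indicator A (V x) * indicator D (Z x)) \<partial>M)"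
    and [measurable]: "\<psi> \<in> borel_measurable borel"
  shows "(\<integral>\<^sup>+x. a x * \<psi> (V x, Z x) \<partial>M) = (\<integral>\<^sup>+x. b x * \<psi> (V x, Z x) \<partial>M)"
proof -
  let ?N = "borel :: ('b \<times> 'c) measure"
  let ?W = "\<lambda>x. (V x, Z x)"
  have e: "emeasure (distr (density M c) ?N ?W) S = (\<integral>\<^sup>+x. c x * indicator S (?W x) \<partial>M)"
    if [measurable]: "c \<in> borel_measurable M" "S \<in> sets ?N" for c S
  proof -
    have [simp]: "indicator (?W -` S \<inter> space M) x = (indicator S (?W x) :: ennreal)" if "x \<in> space M" for x
      using that by (auto simp: indicator_def)
    show ?thesis
      by (subst emeasure_distr) (auto simp: emeasure_density intro!: nn_integral_cong)
  qed
  have "distr (density M a) ?N ?W = distr (density M b) ?N ?W"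
  proof (rule measure_eqI_generator_eq)
    let ?E = "{A \<times> D | A D. A \<in> sets (borel :: 'b measure) \<and> D \<in> sets (borel :: 'c measure)}"
    show "Int_stable ?E" using Int_stable_pair_measure_generator .
    show "?E \<subseteq> Pow UNIV" by auto
    have "sets ?N = sigma_sets UNIV ?E"
      by (simp add: borel_prod[symmetric] sets_pair_measure)
    then show "sets (distr (density M a) ?N ?W) = sigma_sets UNIV ?E"
      "sets (distr (density M b) ?N ?W) = sigma_sets UNIV ?E" by auto
    show "emeasure (distr (density M a) ?N ?W) X = emeasure (distr (density M b) ?N ?W) X"
      if "X \<in> ?E" for X
    proof -
      from that obtain A D where X: "X = A \<times> D" and [measurable]: "A \<in> sets borel" "D \<in> sets borel" by auto
      have "X \<in> sets ?N" unfolding X borel_prod[symmetric] by (intro pair_measureI) auto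
      then show ?thesis using eq[of A D] by (simp add: e X indicator_times)
    qed
    show "range (\<lambda>_::nat. UNIV) \<subseteq> ?E" by (auto intro!: exI[of _ UNIV])
    show "emeasure (distr (density M a) ?N ?W) UNIV \<noteq> \<infinity>" using fin by (simp add: e)
  qed auto
  then show ?thesis
    by (intro nn_integral_eq_from_sets[where N="?N" and W="?W" and \<psi>=\<psi>]) (auto simp: e[symmetric])
qed

section \<open>Conditional expectations given Z and the integral form of conditional
  independence\<close>

locale law = prob_space P for P :: "(real \<times> real \<times> 'z::euclidean_space) measure" +
  assumes sets_P: "sets P = sets borel"
begin

lemma space_P [simp]: "space P = UNIV"
  using sets_eq_imp_space_eq[OF sets_P] by simp

lemma measurable_coordinates [measurable]:
  "Xv \<in> borel_measurable P" "Yv \<in> borel_measurable P" "Zv \<in> borel_measurable P"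
  unfolding Xv_def[abs_def] Yv_def[abs_def] Zv_def[abs_def] measurable_cong_sets[OF sets_P refl]
  by (auto intro!: borel_measurable_continuous_onI continuous_intros)

lemma subalgebra_sigmaZ: "subalgebra P (sigmaZ P)"
  unfolding subalgebra_def sigmaZ_def
  using measurable_sets[OF measurable_coordinates(3)]
  by (auto simp: sets_vimage_algebra2)

sublocale Z: sigma_finite_subalgebra P "sigmaZ P"
  by (intro finite_measure_subalgebra_is_sigma_finite finite_measure_subalgebra.intro
     finite_measure_subalgebra_axioms.intro subalgebra_sigmaZ finite_measure_axioms)

lemma Zv_measurable_sigmaZ [measurable]: "Zv \<in> measurable (sigmaZ P) borel"
  unfolding sigmaZ_def by (rule measurable_vimage_algebra1) auto

abbreviation ce :: "(real \<times> real \<times> 'z \<Rightarrow> ennreal) \<Rightarrow> real \<times> real \<times> 'z \<Rightarrow> ennreal"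
  where "ce \<equiv> nn_cond_exp P (sigmaZ P)"

text \<open>Doob-Dynkin: a function measurable for \<open>sigmaZ P\<close> factors through
  \<open>Zv\<close>, so the choice by \<open>SOME\<close> in \<open>cond_exp_fun\<close> has a
  witness and its properties can be used. The function \<open>h\<close> is arbitrary, which covers X
  and Y that are not integrable.\<close>

lemma cond_exp_fun:
  "cond_exp_fun P h \<in> borel_measurable borel"
  "AE \<omega> in P. cond_exp_fun P h (Zv \<omega>) = real_cond_exp P (sigmaZ P) h \<omega>"
proof -
  have "real_cond_exp P (sigmaZ P) h \<in> borel_measurable (vimage_algebra UNIV Zv borel)"
    using borel_measurable_cond_exp[of P "sigmaZ P" h] unfolding sigmaZ_def by simp
  from measurable_vimage_algebra_factor[OF _ this]
  obtain g where "g \<in> borel_measurable borel" "\<And>\<omega>. real_cond_exp P (sigmaZ P) h \<omega> = g (Zv \<omega>)"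
    by auto
  then have "\<exists>g. g \<in> borel_measurable borel \<and> (AE \<omega> in P. g (Zv \<omega>) = real_cond_exp P (sigmaZ P) h \<omega>)"
    by (intro exI[of _ g]) auto
  from someI_ex[OF this]
  show "cond_exp_fun P h \<in> borel_measurable borel"
    "AE \<omega> in P. cond_exp_fun P h (Zv \<omega>) = real_cond_exp P (sigmaZ P) h \<omega>"
    unfolding cond_exp_fun_def by auto
qed

lemma ce_sigmaZ: "f \<in> borel_measurable (sigmaZ P) \<Longrightarrow> AE \<omega> in P. ce f \<omega> = f \<omega>"
  using Z.nn_cond_exp_F_meas[of f] by (auto elim!: eventually_mono)

lemma ce_const: "AE \<omega> in P. ce (\<lambda>_. k) \<omega> = k"
  by (rule ce_sigmaZ) simp

text \<open>\<open>real_cond_exp\<close> is built with \<open>enn2real\<close>, which loses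
  information only at \<infinity>. The bound by 1 excludes that value, so statements about
  indicators made with \<open>real_cond_exp\<close> carry over to \<open>ce\<close>.\<close>

lemma ce_bounded_eq_real_cond_exp:
  assumes [measurable]: "h \<in> borel_measurable P" and b: "\<And>\<omega>. 0 \<le> h \<omega>" "\<And>\<omega>. h \<omega> \<le> 1"
  shows "AE \<omega> in P. ce (\<lambda>\<omega>. ennreal (h \<omega>)) \<omega> = ennreal (real_cond_exp P (sigmaZ P) h \<omega>)"
proof -
  have "AE \<omega> in P. ce (\<lambda>\<omega>. ennreal (h \<omega>)) \<omega> \<le> ce (\<lambda>_. 1) \<omega>"
    using b by (intro Z.nn_cond_exp_mono) (auto intro!: AE_I2)
  with ce_const[of 1] ce_const[of 0] show ?thesis
  proof eventually_elim
    case (elim \<omega>)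
    have "(\<lambda>\<omega>. ennreal (- h \<omega>)) = (\<lambda>_. 0)" using b by (auto simp: ennreal_neg)
    with elim show ?case unfolding real_cond_exp_def
      by (simp add: less_top[symmetric] top_unique) (metis ennreal_enn2real ennreal_one_less_top order_le_less_trans)
  qed
qed

text \<open>Test functions may depend on \<open>Zv\<close> as well and take values in
  \<open>ennreal\<close>, so unbounded residuals and weights can be inserted without any question of
  integrability.\<close>

definition cond_indep :: "(real \<times> real \<times> 'z \<Rightarrow> real) \<Rightarrow> (real \<times> real \<times> 'z \<Rightarrow> real) \<Rightarrow> bool" where
  "cond_indep U V \<longleftrightarrow> (\<forall>\<phi> \<in> borel_measurable borel. \<forall>\<psi> \<in> borel_measurable borel.
     (\<integral>\<^sup>+\<omega>. \<phi> (U \<omega>, Zv \<omega>) * \<psi> (V \<omega>, Zv \<omega>) \<partial>P)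
     = (\<integral>\<^sup>+\<omega>. ce (\<lambda>\<omega>. \<phi> (U \<omega>, Zv \<omega>)) \<omega> * ce (\<lambda>\<omega>. \<psi> (V \<omega>, Zv \<omega>)) \<omega> \<partial>P))"

lemma cond_indep_sym: "cond_indep U V \<Longrightarrow> cond_indep V U"
  unfolding cond_indep_def by (subst mult.commute, subst (2) mult.commute) blast

lemma nn_integral_ce_swap:
  assumes [measurable]: "a \<in> borel_measurable P" "b \<in> borel_measurable P"
  shows "(\<integral>\<^sup>+\<omega>. ce a \<omega> * b \<omega> \<partial>P) = (\<integral>\<^sup>+\<omega>. ce a \<omega> * ce b \<omega> \<partial>P)"
  by (rule Z.nn_cond_exp_intg[symmetric]) auto

lemma nn_integral_ce_swap':
  assumes [measurable]: "a \<in> borel_measurable P" "b \<in> borel_measurable P"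
  shows "(\<integral>\<^sup>+\<omega>. a \<omega> * ce b \<omega> \<partial>P) = (\<integral>\<^sup>+\<omega>. ce a \<omega> * ce b \<omega> \<partial>P)"
  using nn_integral_ce_swap[of b a] by (simp add: mult.commute)

text \<open>The test functions are enlarged one side at a time: rectangles on both sides, then a
  general function of (V, Z) against a rectangle, then, by self-adjointness of \<open>ce\<close>, a
  general function of (U, Z) against a set, finally both general. The extensions from rectangles
  start from indicators, hence from finite measures; the last one has a possibly infinite density
  and extends from all measurable sets instead.\<close>

lemma cond_indepI:
  assumes [measurable]: "U \<in> borel_measurable P" "V \<in> borel_measurable P"
    and ind: "\<And>A B. A \<in> sets borel \<Longrightarrow> B \<in> sets borel \<Longrightarrow>
      AE \<omega> in P. ce (\<lambda>\<omega>. indicator A (U \<omega>) * indicator B (V \<omega>)) \<omega>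
        = ce (\<lambda>\<omega>. indicator A (U \<omega>)) \<omega> * ce (\<lambda>\<omega>. indicator B (V \<omega>)) \<omega>"
  shows "cond_indep U V"
proof -
  have rect: "(\<integral>\<^sup>+\<omega>. (indicator A (U \<omega>) * indicator D (Zv \<omega>)) * (indicator B (V \<omega>) * indicator D' (Zv \<omega>)) \<partial>P)
     = (\<integral>\<^sup>+\<omega>. ce (\<lambda>\<omega>. indicator A (U \<omega>) * indicator D (Zv \<omega>)) \<omega> * (indicator B (V \<omega>) * indicator D' (Zv \<omega>)) \<partial>P)"
    if [measurable]: "A \<in> sets borel" "B \<in> sets borel" "D \<in> sets borel" "D' \<in> sets borel" for A B D D'
  proof -
    have "AE \<omega> in P. indicator D (Zv \<omega>) * ce (\<lambda>\<omega>. indicator A (U \<omega>)) \<omega> =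
        ce (\<lambda>\<omega>. indicator D (Zv \<omega>) * indicator A (U \<omega>)) \<omega>"
      by (rule Z.nn_cond_exp_prod) auto
    then have pull: "AE \<omega> in P. ce (\<lambda>\<omega>. indicator A (U \<omega>) * indicator D (Zv \<omega>)) \<omega>
        = indicator D (Zv \<omega>) * ce (\<lambda>\<omega>. indicator A (U \<omega>)) \<omega>"
      by eventually_elim (simp add: mult.commute)
    have "(\<integral>\<^sup>+\<omega>. (indicator A (U \<omega>) * indicator D (Zv \<omega>)) * (indicator B (V \<omega>) * indicator D' (Zv \<omega>)) \<partial>P)
      = (\<integral>\<^sup>+\<omega>. (indicator D (Zv \<omega>) * indicator D' (Zv \<omega>)) * (indicator A (U \<omega>) * indicator B (V \<omega>)) \<partial>P)"
      by (simp add: mult_ac)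
    also have "\<dots> = (\<integral>\<^sup>+\<omega>. (indicator D (Zv \<omega>) * indicator D' (Zv \<omega>)) * ce (\<lambda>\<omega>. indicator A (U \<omega>) * indicator B (V \<omega>)) \<omega> \<partial>P)"
      by (rule Z.nn_cond_exp_intg[symmetric]) auto
    also have "\<dots> = (\<integral>\<^sup>+\<omega>. (indicator D (Zv \<omega>) * indicator D' (Zv \<omega>) * ce (\<lambda>\<omega>. indicator A (U \<omega>)) \<omega>) * ce (\<lambda>\<omega>. indicator B (V \<omega>)) \<omega> \<partial>P)"
      using ind[OF that(1,2)] by (intro nn_integral_cong_AE, eventually_elim) (simp add: mult_ac)
    also have "\<dots> = (\<integral>\<^sup>+\<omega>. (indicator D (Zv \<omega>) * indicator D' (Zv \<omega>) * ce (\<lambda>\<omega>. indicator A (U \<omega>)) \<omega>) * indicator B (V \<omega>) \<partial>P)"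
      by (rule Z.nn_cond_exp_intg) auto
    also have "\<dots> = (\<integral>\<^sup>+\<omega>. ce (\<lambda>\<omega>. indicator A (U \<omega>) * indicator D (Zv \<omega>)) \<omega> * (indicator B (V \<omega>) * indicator D' (Zv \<omega>)) \<partial>P)"
      using pull by (intro nn_integral_cong_AE, eventually_elim) (simp add: mult_ac)
    finally show ?thesis .
  qed
  have fin: "(\<integral>\<^sup>+\<omega>. a \<omega> \<partial>P) \<noteq> \<infinity>" if "\<And>\<omega>. a \<omega> \<le> 1" for a
  proof -
    have "(\<integral>\<^sup>+\<omega>. a \<omega> \<partial>P) \<le> (\<integral>\<^sup>+\<omega>. 1 \<partial>P)" using that by (intro nn_integral_mono) auto
    then show ?thesis by (auto simp: emeasure_space_1 top_unique)
  qed
  have rect2: "(\<integral>\<^sup>+\<omega>. (indicator A (U \<omega>) * indicator D (Zv \<omega>)) * \<psi> (V \<omega>, Zv \<omega>) \<partial>P)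
     = (\<integral>\<^sup>+\<omega>. ce (\<lambda>\<omega>. indicator A (U \<omega>) * indicator D (Zv \<omega>)) \<omega> * \<psi> (V \<omega>, Zv \<omega>) \<partial>P)"
    if [measurable]: "A \<in> sets borel" "D \<in> sets borel" and \<psi>: "\<psi> \<in> borel_measurable borel" for A D \<psi>
  proof (rule nn_integral_eq_from_rectangles[where V=V and Z=Zv and \<psi>=\<psi>])
    show "(\<integral>\<^sup>+\<omega>. indicator A (U \<omega>) * indicator D (Zv \<omega>) \<partial>P) \<noteq> \<infinity>"
      by (rule fin) (auto simp: indicator_def)
  qed (auto intro!: rect \<psi>)
  have gen1: "(\<integral>\<^sup>+\<omega>. indicator S (V \<omega>, Zv \<omega>) * \<phi> (U \<omega>, Zv \<omega>) \<partial>P)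
     = (\<integral>\<^sup>+\<omega>. ce (\<lambda>\<omega>. indicator S (V \<omega>, Zv \<omega>)) \<omega> * \<phi> (U \<omega>, Zv \<omega>) \<partial>P)"
    if [measurable]: "S \<in> sets borel" and \<phi>: "\<phi> \<in> borel_measurable borel" for S \<phi>
  proof (rule nn_integral_eq_from_rectangles[where V=U and Z=Zv and \<psi>=\<phi>])
    fix A :: "real set" and D :: "'z set" assume [measurable]: "A \<in> sets borel" "D \<in> sets borel"
    have "(\<integral>\<^sup>+\<omega>. indicator S (V \<omega>, Zv \<omega>) * (indicator A (U \<omega>) * indicator D (Zv \<omega>)) \<partial>P)
      = (\<integral>\<^sup>+\<omega>. (indicator A (U \<omega>) * indicator D (Zv \<omega>)) * indicator S (V \<omega>, Zv \<omega>) \<partial>P)"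
      by (simp add: mult_ac)
    also have "\<dots> = (\<integral>\<^sup>+\<omega>. ce (\<lambda>\<omega>. indicator A (U \<omega>) * indicator D (Zv \<omega>)) \<omega> * indicator S (V \<omega>, Zv \<omega>) \<partial>P)"
      by (rule rect2) auto
    also have "\<dots> = (\<integral>\<^sup>+\<omega>. (indicator A (U \<omega>) * indicator D (Zv \<omega>)) * ce (\<lambda>\<omega>. indicator S (V \<omega>, Zv \<omega>)) \<omega> \<partial>P)"
      by (subst nn_integral_ce_swap, measurable, subst nn_integral_ce_swap') auto
    finally show "(\<integral>\<^sup>+\<omega>. indicator S (V \<omega>, Zv \<omega>) * (indicator A (U \<omega>) * indicator D (Zv \<omega>)) \<partial>P)
       = (\<integral>\<^sup>+\<omega>. ce (\<lambda>\<omega>. indicator S (V \<omega>, Zv \<omega>)) \<omega> * (indicator A (U \<omega>) * indicator D (Zv \<omega>)) \<partial>P)"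
      by (simp add: mult.commute)
  next
    show "(\<integral>\<^sup>+\<omega>. indicator S (V \<omega>, Zv \<omega>) \<partial>P) \<noteq> \<infinity>"
      by (rule fin) (auto simp: indicator_def)
  qed (auto intro!: \<phi>)
  show ?thesis unfolding cond_indep_def
  proof (intro ballI)
    fix \<phi> \<psi> :: "real \<times> 'z \<Rightarrow> ennreal"
    assume [measurable]: "\<phi> \<in> borel_measurable borel" "\<psi> \<in> borel_measurable borel"
    have "(\<integral>\<^sup>+\<omega>. \<phi> (U \<omega>, Zv \<omega>) * \<psi> (V \<omega>, Zv \<omega>) \<partial>P)
       = (\<integral>\<^sup>+\<omega>. ce (\<lambda>\<omega>. \<phi> (U \<omega>, Zv \<omega>)) \<omega> * \<psi> (V \<omega>, Zv \<omega>) \<partial>P)"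
    proof (rule nn_integral_eq_from_sets[where N=borel and W="\<lambda>\<omega>. (V \<omega>, Zv \<omega>)" and \<psi>=\<psi>])
      fix S :: "(real \<times> 'z) set" assume [measurable]: "S \<in> sets borel"
      show "(\<integral>\<^sup>+\<omega>. \<phi> (U \<omega>, Zv \<omega>) * indicator S (V \<omega>, Zv \<omega>) \<partial>P)
        = (\<integral>\<^sup>+\<omega>. ce (\<lambda>\<omega>. \<phi> (U \<omega>, Zv \<omega>)) \<omega> * indicator S (V \<omega>, Zv \<omega>) \<partial>P)"
        using gen1[of S \<phi>]
        by (subst nn_integral_ce_swap, measurable, subst nn_integral_ce_swap'[symmetric]) (auto simp: mult.commute)
    qed auto
    also have "\<dots> = (\<integral>\<^sup>+\<omega>. ce (\<lambda>\<omega>. \<phi> (U \<omega>, Zv \<omega>)) \<omega> * ce (\<lambda>\<omega>. \<psi> (V \<omega>, Zv \<omega>)) \<omega> \<partial>P)"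
      by (rule nn_integral_ce_swap) auto
    finally show "(\<integral>\<^sup>+\<omega>. \<phi> (U \<omega>, Zv \<omega>) * \<psi> (V \<omega>, Zv \<omega>) \<partial>P)
      = (\<integral>\<^sup>+\<omega>. ce (\<lambda>\<omega>. \<phi> (U \<omega>, Zv \<omega>)) \<omega> * ce (\<lambda>\<omega>. \<psi> (V \<omega>, Zv \<omega>)) \<omega> \<partial>P)" .
  qed
qed

lemma cond_indep_XY:
  assumes "cond_indep_XY_Z P"
  shows "cond_indep Xv Yv"
proof (rule cond_indepI)
  fix A B :: "real set" assume [measurable]: "A \<in> sets borel" "B \<in> sets borel"
  have 1: "AE \<omega> in P. ce (\<lambda>\<omega>. ennreal (indicator A (Xv \<omega>) * indicator B (Yv \<omega>))) \<omega>
      = ennreal (real_cond_exp P (sigmaZ P) (\<lambda>\<omega>. indicator A (Xv \<omega>) * indicator B (Yv \<omega>)) \<omega>)"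
    by (rule ce_bounded_eq_real_cond_exp) (auto simp: indicator_def)
  have 2: "AE \<omega> in P. ce (\<lambda>\<omega>. ennreal (indicator A (Xv \<omega>))) \<omega>
      = ennreal (real_cond_exp P (sigmaZ P) (\<lambda>\<omega>. indicator A (Xv \<omega>)) \<omega>)"
    by (rule ce_bounded_eq_real_cond_exp) (auto simp: indicator_def)
  have 3: "AE \<omega> in P. ce (\<lambda>\<omega>. ennreal (indicator B (Yv \<omega>))) \<omega>
      = ennreal (real_cond_exp P (sigmaZ P) (\<lambda>\<omega>. indicator B (Yv \<omega>)) \<omega>)"
    by (rule ce_bounded_eq_real_cond_exp) (auto simp: indicator_def)
  have 4: "AE \<omega> in P. real_cond_exp P (sigmaZ P) (\<lambda>\<omega>. indicator B (Yv \<omega>)) \<omega> \<ge> 0"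
    by (rule Z.real_cond_exp_pos) auto
  have 5: "AE \<omega> in P. real_cond_exp P (sigmaZ P) (\<lambda>\<omega>. indicator A (Xv \<omega>)) \<omega> \<ge> 0"
    by (rule Z.real_cond_exp_pos) auto
  have "AE \<omega> in P. real_cond_exp P (sigmaZ P) (\<lambda>\<omega>. indicator A (Xv \<omega>) * indicator B (Yv \<omega>)) \<omega>
       = real_cond_exp P (sigmaZ P) (\<lambda>\<omega>. indicator A (Xv \<omega>)) \<omega>
         * real_cond_exp P (sigmaZ P) (\<lambda>\<omega>. indicator B (Yv \<omega>)) \<omega>"
    using assms unfolding cond_indep_XY_Z_def by auto
  with 1 2 3 4 5 show "AE \<omega> in P. ce (\<lambda>\<omega>. indicator A (Xv \<omega>) * indicator B (Yv \<omega>)) \<omega>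
        = ce (\<lambda>\<omega>. indicator A (Xv \<omega>)) \<omega> * ce (\<lambda>\<omega>. indicator B (Yv \<omega>)) \<omega>"
    by eventually_elim (simp add: ennreal_mult ennreal_indicator)
qed auto

end

section \<open>Residuals\<close>

text \<open>Fubini: every section of the graph at a fixed second coordinate is a single
  point.\<close>

lemma emeasure_lborel_graph:
  fixes f :: "'b::euclidean_space \<Rightarrow> real"
  assumes [measurable]: "f \<in> borel_measurable borel"
  shows "{q. fst q = f (snd q)} \<in> null_sets (lborel :: (real \<times> 'b) measure)"
proof (rule null_setsI)
  have "{q \<in> space (borel \<Otimes>\<^sub>M borel). fst q = f (snd q)} \<in> sets (borel \<Otimes>\<^sub>M borel :: (real \<times> 'b) measure)"
    by measurable
  then show S: "{q. fst q = f (snd q)} \<in> sets (lborel :: (real \<times> 'b) measure)"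
    unfolding borel_prod by simp
  have "emeasure (lborel :: (real \<times> 'b) measure) {q. fst q = f (snd q)}
      = emeasure (lborel \<Otimes>\<^sub>M lborel) {q :: real \<times> 'b. fst q = f (snd q)}"
    by (simp add: lborel_prod)
  also have "\<dots> = (\<integral>\<^sup>+z. emeasure lborel ((\<lambda>x. (x, z)) -` {q. fst q = f (snd q)}) \<partial>lborel)"
    using S unfolding lborel_prod[symmetric] by (intro lborel_pair.emeasure_pair_measure_alt2)
  also have "(\<lambda>z. (\<lambda>x. (x, z)) -` {q. fst q = f (snd q)}) = (\<lambda>z. {f z})" by auto
  finally show "emeasure (lborel :: (real \<times> 'b) measure) {q. fst q = f (snd q)} = 0" by simp
qed

text \<open>This is how absolute continuity enters: a residual of X or Y from any measurable
  function of Z is almost surely nonzero. The exceptional event for X is a graph over (y, z), the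
  one for Y a product of the real line with a graph over z.\<close>

lemma AE_not_on_graph:
  fixes P :: "(real \<times> real \<times> 'z::euclidean_space) measure"
  assumes ac: "absolutely_continuous lborel P" and [measurable]: "f \<in> borel_measurable borel"
    and sets: "sets P = sets borel"
  shows "AE \<omega> in P. Xv \<omega> \<noteq> f (Zv \<omega>)" "AE \<omega> in P. Yv \<omega> \<noteq> f (Zv \<omega>)"
proof -
  have meas: "(\<lambda>q :: real \<times> 'z. f (snd q)) \<in> borel_measurable borel"
    by (rule measurable_compose[OF _ assms(2)]) (auto intro!: borel_measurable_continuous_onI continuous_intros)
  have "{\<omega>. \<not> Xv \<omega> \<noteq> f (Zv \<omega>)} \<in> null_sets (lborel :: (real \<times> real \<times> 'z) measure)"
    using emeasure_lborel_graph[OF meas] by (simp add: Xv_def Zv_def)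
  then show "AE \<omega> in P. Xv \<omega> \<noteq> f (Zv \<omega>)"
    using ac by (intro AE_I'[of "{\<omega>. \<not> Xv \<omega> \<noteq> f (Zv \<omega>)}"]) (auto simp: absolutely_continuous_def)
  let ?N = "{q :: real \<times> 'z. fst q = f (snd q)}"
  have N: "?N \<in> null_sets lborel" by (rule emeasure_lborel_graph) fact
  have eq: "{\<omega>. \<not> Yv \<omega> \<noteq> f (Zv \<omega>)} = UNIV \<times> ?N" by (auto simp: Yv_def Zv_def)
  have "UNIV \<times> ?N \<in> sets (lborel \<Otimes>\<^sub>M lborel)" using N by (intro pair_measureI) auto
  moreover have "emeasure (lborel \<Otimes>\<^sub>M lborel) ((UNIV::real set) \<times> ?N) = 0"
    using N by (subst lborel.emeasure_pair_measure_Times) auto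
  ultimately have "{\<omega>. \<not> Yv \<omega> \<noteq> f (Zv \<omega>)} \<in> null_sets (lborel :: (real \<times> real \<times> 'z) measure)"
    unfolding eq lborel_prod by (intro null_setsI)
  then show "AE \<omega> in P. Yv \<omega> \<noteq> f (Zv \<omega>)"
    using ac by (intro AE_I'[of "{\<omega>. \<not> Yv \<omega> \<noteq> f (Zv \<omega>)}"]) (auto simp: absolutely_continuous_def)
qed

section \<open>Finiteness of conditional moments and centring of residuals\<close>

context law
begin

lemma cond_indep_intg:
  assumes "cond_indep U V" and [measurable]: "U \<in> borel_measurable P" "V \<in> borel_measurable P"
    and [measurable]: "\<phi> \<in> borel_measurable borel" "\<psi> \<in> borel_measurable borel"
  shows "(\<integral>\<^sup>+\<omega>. \<phi> (U \<omega>, Zv \<omega>) * \<psi> (V \<omega>, Zv \<omega>) \<partial>P)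
     = (\<integral>\<^sup>+\<omega>. \<phi> (U \<omega>, Zv \<omega>) * ce (\<lambda>\<omega>. \<psi> (V \<omega>, Zv \<omega>)) \<omega> \<partial>P)"
  using assms(1,4,5) unfolding cond_indep_def by (subst nn_integral_ce_swap') auto

text \<open>The product of the two conditional expectations has finite integral, hence is finite
  almost surely. This bounds the second factor only where the first is nonzero, since
  \<open>0 * \<infinity> = 0\<close>; on the set where the first vanishes, \<phi> itself vanishes
  almost surely, against \<open>pos\<close>.\<close>

lemma cond_indep_ce_finite:
  assumes ci: "cond_indep U V" and [measurable]: "U \<in> borel_measurable P" "V \<in> borel_measurable P"
    and [measurable]: "\<phi> \<in> borel_measurable borel" "\<psi> \<in> borel_measurable borel"
    and fin: "(\<integral>\<^sup>+\<omega>. \<phi> (U \<omega>, Zv \<omega>) * \<psi> (V \<omega>, Zv \<omega>) \<partial>P) < \<infinity>"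
    and pos: "AE \<omega> in P. \<phi> (U \<omega>, Zv \<omega>) \<noteq> 0"
  shows "AE \<omega> in P. ce (\<lambda>\<omega>. \<psi> (V \<omega>, Zv \<omega>)) \<omega> < \<infinity>"
proof -
  let ?a = "ce (\<lambda>\<omega>. \<phi> (U \<omega>, Zv \<omega>))" and ?b = "ce (\<lambda>\<omega>. \<psi> (V \<omega>, Zv \<omega>))"
  have "(\<integral>\<^sup>+\<omega>. ?a \<omega> * ?b \<omega> \<partial>P) \<noteq> \<infinity>"
    using ci fin unfolding cond_indep_def by auto
  then have ab: "AE \<omega> in P. ?a \<omega> * ?b \<omega> \<noteq> \<infinity>"
    by (intro nn_integral_PInf_AE) auto
  have "(\<integral>\<^sup>+\<omega>. indicator {0} (?a \<omega>) * \<phi> (U \<omega>, Zv \<omega>) \<partial>P) = (\<integral>\<^sup>+\<omega>. indicator {0} (?a \<omega>) * ?a \<omega> \<partial>P)"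
    by (rule Z.nn_cond_exp_intg[symmetric]) auto
  also have "\<dots> = (\<integral>\<^sup>+\<omega>. 0 \<partial>P)" by (intro nn_integral_cong) (auto simp: indicator_def)
  finally have "AE \<omega> in P. indicator {0} (?a \<omega>) * \<phi> (U \<omega>, Zv \<omega>) = 0"
    by (subst (asm) nn_integral_const, simp, subst (asm) nn_integral_0_iff_AE) auto
  with ab pos show ?thesis
    by eventually_elim (auto simp: indicator_def ennreal_mult_eq_top_iff less_top split: if_splits)
qed

lemma ce_finite_mono:
  assumes fin: "AE \<omega> in P. ce h \<omega> < \<infinity>" and [measurable]: "h \<in> borel_measurable P" "h' \<in> borel_measurable P"
    and le: "\<And>\<omega>. h' \<omega> \<le> 1 + h \<omega>"
  shows "AE \<omega> in P. ce h' \<omega> < \<infinity>"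
proof -
  have "AE \<omega> in P. ce h' \<omega> \<le> ce (\<lambda>\<omega>. 1 + h \<omega>) \<omega>"
    using le by (intro Z.nn_cond_exp_mono) auto
  moreover have "AE \<omega> in P. ce (\<lambda>_. 1) \<omega> + ce h \<omega> = ce (\<lambda>\<omega>. 1 + h \<omega>) \<omega>"
    by (rule Z.nn_cond_exp_sum) auto
  ultimately show ?thesis using fin ce_const[of 1]
    by eventually_elim (metis ennreal_add_eq_top ennreal_one_neq_top infinity_ennreal_def less_top order_le_less_trans)
qed

lemma ce_enn2real_eq_real_cond_exp:
  assumes fin: "AE \<omega> in P. ce (\<lambda>\<omega>. ennreal (h \<omega>)) \<omega> < \<infinity>" and [measurable]: "h \<in> borel_measurable P"
    and pos: "\<And>\<omega>. 0 \<le> h \<omega>"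
  shows "AE \<omega> in P. ce (\<lambda>\<omega>. ennreal (h \<omega>)) \<omega> = ennreal (real_cond_exp P (sigmaZ P) h \<omega>)"
    "AE \<omega> in P. real_cond_exp P (sigmaZ P) h \<omega> \<ge> 0"
proof -
  have [simp]: "(\<lambda>\<omega>. ennreal (- h \<omega>)) = (\<lambda>_. 0)" using pos by (auto simp: ennreal_neg)
  show "AE \<omega> in P. ce (\<lambda>\<omega>. ennreal (h \<omega>)) \<omega> = ennreal (real_cond_exp P (sigmaZ P) h \<omega>)"
    using fin ce_const[of 0] by eventually_elim (simp add: real_cond_exp_def)
  show "AE \<omega> in P. real_cond_exp P (sigmaZ P) h \<omega> \<ge> 0"
    using ce_const[of 0] by eventually_elim (simp add: real_cond_exp_def)
qed

text \<open>Since V need not be integrable, its conditional mean is only the difference of two conditional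
  expectations of nonnegative functions.\<close>
lemma ce_residual_balanced:
  assumes [measurable]: "V \<in> borel_measurable P" "m \<in> borel_measurable borel"
    and m: "AE \<omega> in P. m (Zv \<omega>) = real_cond_exp P (sigmaZ P) V \<omega>"
    and fin: "AE \<omega> in P. ce (\<lambda>\<omega>. ennreal ((V \<omega> - m (Zv \<omega>))\<^sup>2)) \<omega> < \<infinity>"
  shows "AE \<omega> in P. ce (\<lambda>\<omega>. ennreal (V \<omega> - m (Zv \<omega>))) \<omega> = ce (\<lambda>\<omega>. ennreal (- (V \<omega> - m (Zv \<omega>)))) \<omega>"
proof -
  let ?r = "\<lambda>\<omega>. V \<omega> - m (Zv \<omega>)"
  have sq: "x \<le> 1 + x\<^sup>2" for x :: real
    using zero_le_power2[of "x - 1/2"] by (simp add: power2_eq_square field_simps)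
  have e1: "ennreal x \<le> 1 + ennreal (x\<^sup>2)" for x :: real
    using sq[of x] by (metis ennreal_leI ennreal_plus ennreal_1 zero_le_one zero_le_power2)
  have e2: "ennreal (- x) \<le> 1 + ennreal (x\<^sup>2)" for x :: real
    using e1[of "- x"] by simp
  have fp: "AE \<omega> in P. ce (\<lambda>\<omega>. ennreal (?r \<omega>)) \<omega> < \<infinity>"
    by (rule ce_finite_mono[OF fin]) (auto intro: e1)
  have fm: "AE \<omega> in P. ce (\<lambda>\<omega>. ennreal (- ?r \<omega>)) \<omega> < \<infinity>"
  proof (rule ce_finite_mono[OF fin])
    show "ennreal (- ?r \<omega>) \<le> 1 + ennreal ((?r \<omega>)\<^sup>2)" for \<omega> by (rule e2)
  qed auto
  have cmz: "AE \<omega> in P. ce (\<lambda>\<omega>. ennreal (m (Zv \<omega>))) \<omega> = ennreal (m (Zv \<omega>))"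
    by (rule ce_sigmaZ) simp
  have cmz': "AE \<omega> in P. ce (\<lambda>\<omega>. ennreal (- m (Zv \<omega>))) \<omega> = ennreal (- m (Zv \<omega>))"
    by (rule ce_sigmaZ) simp
  have pm: "ennreal x = ennreal (max x 0)" for x by (simp add: max_def ennreal_neg)
  have add_le: "ennreal (x + y) \<le> ennreal x + ennreal y" for x y
    by (auto simp: ennreal_plus_if intro!: ennreal_leI)
  have V1: "AE \<omega> in P. ce (\<lambda>\<omega>. ennreal (V \<omega>)) \<omega> \<le> ce (\<lambda>\<omega>. ennreal (?r \<omega>) + ennreal (m (Zv \<omega>))) \<omega>"
  proof (rule Z.nn_cond_exp_mono, rule AE_I2)
    fix \<omega> show "ennreal (V \<omega>) \<le> ennreal (?r \<omega>) + ennreal (m (Zv \<omega>))"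
      using add_le[of "?r \<omega>" "m (Zv \<omega>)"] by simp
  qed auto
  have V1': "AE \<omega> in P. ce (\<lambda>\<omega>. ennreal (?r \<omega>)) \<omega> + ce (\<lambda>\<omega>. ennreal (m (Zv \<omega>))) \<omega> = ce (\<lambda>\<omega>. ennreal (?r \<omega>) + ennreal (m (Zv \<omega>))) \<omega>"
    by (rule Z.nn_cond_exp_sum) auto
  have V2: "AE \<omega> in P. ce (\<lambda>\<omega>. ennreal (- V \<omega>)) \<omega> \<le> ce (\<lambda>\<omega>. ennreal (- ?r \<omega>) + ennreal (- m (Zv \<omega>))) \<omega>"
  proof (rule Z.nn_cond_exp_mono, rule AE_I2)
    fix \<omega> show "ennreal (- V \<omega>) \<le> ennreal (- ?r \<omega>) + ennreal (- m (Zv \<omega>))"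
      using add_le[of "- ?r \<omega>" "- m (Zv \<omega>)"] by simp
  qed auto
  have V2': "AE \<omega> in P. ce (\<lambda>\<omega>. ennreal (- ?r \<omega>)) \<omega> + ce (\<lambda>\<omega>. ennreal (- m (Zv \<omega>))) \<omega> = ce (\<lambda>\<omega>. ennreal (- ?r \<omega>) + ennreal (- m (Zv \<omega>))) \<omega>"
    by (rule Z.nn_cond_exp_sum) auto
  have fin_le: "x < \<infinity>" if "x \<le> s" "p + q = s" "p < \<infinity>" "q = ennreal y" for x s p q :: ennreal and y
    using that by (auto intro!: order_le_less_trans[of x "p + q"] simp: ennreal_add_less_top)
  \<comment> \<open>Finiteness of both parts matters: \<open>enn2real\<close> sends \<infinity> to
    0, so otherwise the value of \<open>real_cond_exp\<close> would not be a genuine difference of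
    the two.\<close>
  have FV: "AE \<omega> in P. ce (\<lambda>\<omega>. ennreal (V \<omega>)) \<omega> < \<infinity>"
    using V1 V1' fp cmz by eventually_elim (rule fin_le)
  have FV': "AE \<omega> in P. ce (\<lambda>\<omega>. ennreal (- V \<omega>)) \<omega> < \<infinity>"
    using V2 V2' fm cmz' by eventually_elim (rule fin_le)
  text \<open>The identity r = V - m(Z), with all terms moved so that they are nonnegative.\<close>
  have bal: "(\<lambda>\<omega>. ennreal (?r \<omega>) + (ennreal (- V \<omega>) + ennreal (m (Zv \<omega>))))
     = (\<lambda>\<omega>. ennreal (- ?r \<omega>) + (ennreal (V \<omega>) + ennreal (- m (Zv \<omega>))))"
  proof
    fix \<omega>
    show "ennreal (?r \<omega>) + (ennreal (- V \<omega>) + ennreal (m (Zv \<omega>)))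
     = ennreal (- ?r \<omega>) + (ennreal (V \<omega>) + ennreal (- m (Zv \<omega>)))"
      by (subst (1 2 3 4 5 6) pm) (simp flip: ennreal_plus add: max_def)
  qed
  have s1: "AE \<omega> in P. ce (\<lambda>\<omega>. ennreal (?r \<omega>)) \<omega> + ce (\<lambda>\<omega>. ennreal (- V \<omega>) + ennreal (m (Zv \<omega>))) \<omega>
     = ce (\<lambda>\<omega>. ennreal (?r \<omega>) + (ennreal (- V \<omega>) + ennreal (m (Zv \<omega>)))) \<omega>"
    by (rule Z.nn_cond_exp_sum) auto
  have s2: "AE \<omega> in P. ce (\<lambda>\<omega>. ennreal (- V \<omega>)) \<omega> + ce (\<lambda>\<omega>. ennreal (m (Zv \<omega>))) \<omega>
     = ce (\<lambda>\<omega>. ennreal (- V \<omega>) + ennreal (m (Zv \<omega>))) \<omega>"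
    by (rule Z.nn_cond_exp_sum) auto
  have s3: "AE \<omega> in P. ce (\<lambda>\<omega>. ennreal (- ?r \<omega>)) \<omega> + ce (\<lambda>\<omega>. ennreal (V \<omega>) + ennreal (- m (Zv \<omega>))) \<omega>
     = ce (\<lambda>\<omega>. ennreal (- ?r \<omega>) + (ennreal (V \<omega>) + ennreal (- m (Zv \<omega>)))) \<omega>"
    by (rule Z.nn_cond_exp_sum) auto
  have s4: "AE \<omega> in P. ce (\<lambda>\<omega>. ennreal (V \<omega>)) \<omega> + ce (\<lambda>\<omega>. ennreal (- m (Zv \<omega>))) \<omega>
     = ce (\<lambda>\<omega>. ennreal (V \<omega>) + ennreal (- m (Zv \<omega>))) \<omega>"
    by (rule Z.nn_cond_exp_sum) auto
  \<comment> \<open>With every term finite the balance cancels: \<open>x\<close> is the difference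
    of \<open>v\<close> and \<open>v'\<close>, and its positive and negative parts stand on opposite
    sides.\<close>
  have arith: "p = q"
    if pf: "p < \<infinity>" "q < \<infinity>" "v < \<infinity>" "v' < \<infinity>" and x: "x = enn2real v - enn2real v'"
      and e: "p + (v' + ennreal x) = q + (v + ennreal (- x))" for p q v v' :: ennreal and x :: real
  proof -
    obtain p' q' w w' where [simp]: "p = ennreal p'" "q = ennreal q'" "v = ennreal w" "v' = ennreal w'"
      and [simp]: "0 \<le> p'" "0 \<le> q'" "0 \<le> w" "0 \<le> w'"
      using pf by (metis enn2real_nonneg ennreal_enn2real infinity_ennreal_def)
    have x': "x = w - w'" using x by simp
    show ?thesis
    proof (cases "x \<ge> 0")
      case True
      then show ?thesis using e x' by (simp add: ennreal_neg flip: ennreal_plus)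
    next
      case False
      then show ?thesis using e x' by (simp add: ennreal_neg flip: ennreal_plus)
    qed
  qed
  show ?thesis
    using fp fm FV FV' m cmz cmz' s1 s2 s3 s4
  proof eventually_elim
    case (elim \<omega>)
    show ?case
    proof (rule arith[OF elim(1-4)])
      show "m (Zv \<omega>) = enn2real (ce (\<lambda>\<omega>. ennreal (V \<omega>)) \<omega>) - enn2real (ce (\<lambda>\<omega>. ennreal (- V \<omega>)) \<omega>)"
        using elim(5) by (simp only: real_cond_exp_def)
      show "ce (\<lambda>\<omega>. ennreal (?r \<omega>)) \<omega> + (ce (\<lambda>\<omega>. ennreal (- V \<omega>)) \<omega> + ennreal (m (Zv \<omega>)))
        = ce (\<lambda>\<omega>. ennreal (- ?r \<omega>)) \<omega> + (ce (\<lambda>\<omega>. ennreal (V \<omega>)) \<omega> + ennreal (- m (Zv \<omega>)))"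
        using elim(6-11) by (simp only: bal)
    qed
  qed
qed

text \<open>Splitting \<open>h\<close> and the residual by sign leaves products of nonnegative
  functions. In each of them conditional independence replaces the part of the residual by its
  conditional expectation, and the balance proved above says that both parts have the same one.
  Integrability serves to pass from the two equal nonnegative integrals to the Bochner
  integral.\<close>

lemma cond_indep_residual_integral_zero:
  assumes ci: "cond_indep U V" and [measurable]: "U \<in> borel_measurable P" "V \<in> borel_measurable P"
    and [measurable]: "m \<in> borel_measurable borel"
    and m: "AE \<omega> in P. m (Zv \<omega>) = real_cond_exp P (sigmaZ P) V \<omega>"
    and fin: "AE \<omega> in P. ce (\<lambda>\<omega>. ennreal ((V \<omega> - m (Zv \<omega>))\<^sup>2)) \<omega> < \<infinity>"
    and [measurable]: "h \<in> borel_measurable borel"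
    and int: "integrable P (\<lambda>\<omega>. h (U \<omega>, Zv \<omega>) * (V \<omega> - m (Zv \<omega>)))"
  shows "(\<integral>\<omega>. h (U \<omega>, Zv \<omega>) * (V \<omega> - m (Zv \<omega>)) \<partial>P) = 0"
proof -
  let ?r = "\<lambda>\<omega>. V \<omega> - m (Zv \<omega>)"
  have [measurable]: "(\<lambda>q :: real \<times> 'z. fst q - m (snd q)) \<in> borel_measurable borel"
    unfolding borel_prod[symmetric] by measurable
  have [measurable]: "(\<lambda>q. ennreal (k * h q)) \<in> borel_measurable borel" for k
    by measurable
  have swap: "(\<integral>\<^sup>+\<omega>. ennreal (k * h (U \<omega>, Zv \<omega>)) * ennreal (?r \<omega>) \<partial>P)
     = (\<integral>\<^sup>+\<omega>. ennreal (k * h (U \<omega>, Zv \<omega>)) * ennreal (- ?r \<omega>) \<partial>P)" for k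
  proof -
    have "(\<integral>\<^sup>+\<omega>. ennreal (k * h (U \<omega>, Zv \<omega>)) * ennreal (?r \<omega>) \<partial>P)
      = (\<integral>\<^sup>+\<omega>. ennreal (k * h (U \<omega>, Zv \<omega>)) * ce (\<lambda>\<omega>. ennreal (?r \<omega>)) \<omega> \<partial>P)"
      using cond_indep_intg[OF ci, of "\<lambda>q. ennreal (k * h q)" "\<lambda>q. ennreal (fst q - m (snd q))"]
      by simp
    also have "\<dots> = (\<integral>\<^sup>+\<omega>. ennreal (k * h (U \<omega>, Zv \<omega>)) * ce (\<lambda>\<omega>. ennreal (- ?r \<omega>)) \<omega> \<partial>P)"
      using ce_residual_balanced[OF assms(3,4) m fin]
      by (intro nn_integral_cong_AE, eventually_elim) simp
    also have "\<dots> = (\<integral>\<^sup>+\<omega>. ennreal (k * h (U \<omega>, Zv \<omega>)) * ennreal (- ?r \<omega>) \<partial>P)"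
      using cond_indep_intg[OF ci, of "\<lambda>q. ennreal (k * h q)" "\<lambda>q. ennreal (- (fst q - m (snd q)))"]
      by (simp del: minus_diff_eq)
    finally show ?thesis .
  qed
  \<comment> \<open>The positive part of a product comes from factors of equal sign. The parameter
    of \<open>swap\<close> takes the values 1 and -1 to select the two parts of
    \<open>h\<close>.\<close>
  have split: "ennreal (x * y) = ennreal (1 * x) * ennreal y + ennreal (-1 * x) * ennreal (- y)" for x y :: real
  proof (cases "x \<ge> 0")
    case True
    then show ?thesis by (cases "y \<ge> 0") (simp_all add: ennreal_mult ennreal_neg mult_nonneg_nonpos)
  next
    case False
    then show ?thesis
      by (cases "y \<ge> 0") (simp_all add: ennreal_neg mult_nonpos_nonneg ennreal_mult[symmetric])
  qed
  have "(\<integral>\<^sup>+\<omega>. ennreal (h (U \<omega>, Zv \<omega>) * ?r \<omega>) \<partial>P)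
     = (\<integral>\<^sup>+\<omega>. ennreal (1 * h (U \<omega>, Zv \<omega>)) * ennreal (?r \<omega>) \<partial>P)
       + (\<integral>\<^sup>+\<omega>. ennreal (-1 * h (U \<omega>, Zv \<omega>)) * ennreal (- ?r \<omega>) \<partial>P)"
    by (subst nn_integral_add[symmetric], simp, simp, intro nn_integral_cong, rule split)
  also have "\<dots> = (\<integral>\<^sup>+\<omega>. ennreal (1 * h (U \<omega>, Zv \<omega>)) * ennreal (- ?r \<omega>) \<partial>P)
       + (\<integral>\<^sup>+\<omega>. ennreal (-1 * h (U \<omega>, Zv \<omega>)) * ennreal (- (- ?r \<omega>)) \<partial>P)"
    using swap[of 1] swap[of "-1"] by simp
  also have "\<dots> = (\<integral>\<^sup>+\<omega>. ennreal (h (U \<omega>, Zv \<omega>) * (- ?r \<omega>)) \<partial>P)"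
    by (subst nn_integral_add[symmetric], simp, simp, intro nn_integral_cong, rule split[symmetric])
  finally have "(\<integral>\<^sup>+\<omega>. ennreal (h (U \<omega>, Zv \<omega>) * ?r \<omega>) \<partial>P) = (\<integral>\<^sup>+\<omega>. ennreal (- (h (U \<omega>, Zv \<omega>) * ?r \<omega>)) \<partial>P)"
    by (simp only: mult_minus_right)
  then show ?thesis
    by (subst real_lebesgue_integral_def[OF int]) simp
qed

end

section \<open>Second moments on product spaces\<close>

lemma integral_square_sum_orthogonal:
  fixes f :: "'i \<Rightarrow> 'a \<Rightarrow> real"
  assumes "finite I" and [measurable]: "\<And>i. i \<in> I \<Longrightarrow> f i \<in> borel_measurable M"
    and sq: "\<And>i. i \<in> I \<Longrightarrow> integrable M (\<lambda>x. (f i x)\<^sup>2)"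
    and orth: "\<And>i j. i \<in> I \<Longrightarrow> j \<in> I \<Longrightarrow> i \<noteq> j \<Longrightarrow> (\<integral>x. f i x * f j x \<partial>M) = 0"
  shows "integrable M (\<lambda>x. (\<Sum>i\<in>I. f i x)\<^sup>2)"
    and "(\<integral>x. (\<Sum>i\<in>I. f i x)\<^sup>2 \<partial>M) = (\<Sum>i\<in>I. \<integral>x. (f i x)\<^sup>2 \<partial>M)"
proof -
  have int: "integrable M (\<lambda>x. f i x * f j x)" if "i \<in> I" "j \<in> I" for i j
  proof (rule Bochner_Integration.integrable_bound)
    show "integrable M (\<lambda>x. (f i x)\<^sup>2 + (f j x)\<^sup>2)" using that sq by simp
    have "\<bar>a * b\<bar> \<le> a\<^sup>2 + b\<^sup>2" for a b :: real
    proof -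
      have "2 * (\<bar>a\<bar> * \<bar>b\<bar>) \<le> a\<^sup>2 + b\<^sup>2" "0 \<le> \<bar>a\<bar> * \<bar>b\<bar>"
        using sum_squares_bound[of "\<bar>a\<bar>" "\<bar>b\<bar>"] by (simp_all add: mult.assoc)
      then show ?thesis unfolding abs_mult by linarith
    qed
    then show "AE x in M. norm (f i x * f j x) \<le> norm ((f i x)\<^sup>2 + (f j x)\<^sup>2)" by auto
  qed (use that in measurable)
  have eq: "(\<Sum>i\<in>I. f i x)\<^sup>2 = (\<Sum>i\<in>I. \<Sum>j\<in>I. f i x * f j x)" for x
    by (simp add: power2_eq_square sum_product)
  show "integrable M (\<lambda>x. (\<Sum>i\<in>I. f i x)\<^sup>2)"
    unfolding eq using int by (intro Bochner_Integration.integrable_sum) auto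
  have "(\<integral>x. (\<Sum>i\<in>I. f i x)\<^sup>2 \<partial>M) = (\<Sum>i\<in>I. \<Sum>j\<in>I. \<integral>x. f i x * f j x \<partial>M)"
    unfolding eq using int by (subst Bochner_Integration.integral_sum) (auto intro!: sum.cong)
  also have "\<dots> = (\<Sum>i\<in>I. \<Sum>j\<in>I. if j = i then \<integral>x. (f i x)\<^sup>2 \<partial>M else 0)"
    using orth by (intro sum.cong) (auto simp: power2_eq_square)
  also have "\<dots> = (\<Sum>i\<in>I. \<integral>x. (f i x)\<^sup>2 \<partial>M)"
    using \<open>finite I\<close> by simp
  finally show "(\<integral>x. (\<Sum>i\<in>I. f i x)\<^sup>2 \<partial>M) = (\<Sum>i\<in>I. \<integral>x. (f i x)\<^sup>2 \<partial>M)" .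
qed

section \<open>Coordinatewise integration over i.i.d. samples\<close>

context prob_space
begin

lemma nn_integral_PiM_coordinate_cong:
  assumes "finite I" "i \<in> I"
    and F: "F \<in> borel_measurable (PiM I (\<lambda>_. M))" and G: "G \<in> borel_measurable (PiM I (\<lambda>_. M))"
    and eq: "\<And>x. x \<in> space (PiM (I - {i}) (\<lambda>_. M)) \<Longrightarrow> (\<integral>\<^sup>+y. F (x(i := y)) \<partial>M) = (\<integral>\<^sup>+y. G (x(i := y)) \<partial>M)"
  shows "integral\<^sup>N (PiM I (\<lambda>_. M)) F = integral\<^sup>N (PiM I (\<lambda>_. M)) G"
proof -
  interpret product_sigma_finite "\<lambda>_. M" by standard
  have I: "insert i (I - {i}) = I" using assms by auto
  have "integral\<^sup>N (PiM (insert i (I - {i})) (\<lambda>_. M)) F = (\<integral>\<^sup>+ x. (\<integral>\<^sup>+ y. F (x(i := y)) \<partial>M) \<partial>(PiM (I - {i}) (\<lambda>_. M)))"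
    by (rule product_nn_integral_insert) (use assms I in auto)
  also have "\<dots> = (\<integral>\<^sup>+ x. (\<integral>\<^sup>+ y. G (x(i := y)) \<partial>M) \<partial>(PiM (I - {i}) (\<lambda>_. M)))"
    by (intro nn_integral_cong eq)
  also have "\<dots> = integral\<^sup>N (PiM (insert i (I - {i})) (\<lambda>_. M)) G"
    by (rule product_nn_integral_insert[symmetric]) (use assms I in auto)
  finally show ?thesis unfolding I .
qed

lemma integral_PiM_coordinate_zero:
  fixes F :: "('i \<Rightarrow> 'a) \<Rightarrow> real"
  assumes "finite I" "i \<in> I"
    and eq: "\<And>x. x \<in> space (PiM (I - {i}) (\<lambda>_. M)) \<Longrightarrow> (\<integral>y. F (x(i := y)) \<partial>M) = 0"
  shows "integral\<^sup>L (PiM I (\<lambda>_. M)) F = 0"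
\<comment> \<open>A non-integrable \<open>F\<close> has Bochner integral 0 by convention, so Fubini
  is invoked only in the integrable case.\<close>
proof (cases "integrable (PiM I (\<lambda>_. M)) F")
  case True
  interpret product_sigma_finite "\<lambda>_. M" by standard
  have I: "insert i (I - {i}) = I" using assms by auto
  have "integral\<^sup>L (PiM (insert i (I - {i})) (\<lambda>_. M)) F = (\<integral>x. (\<integral>y. F (x(i := y)) \<partial>M) \<partial>(PiM (I - {i}) (\<lambda>_. M)))"
    by (rule product_integral_insert) (use assms I True in auto)
  also have "\<dots> = (\<integral>x. 0 \<partial>(PiM (I - {i}) (\<lambda>_. M)))"
    by (intro Bochner_Integration.integral_cong eq) auto
  finally show ?thesis unfolding I by simp
qed (simp add: not_integrable_integral_eq)

text \<open>A fit uses the entire sample. With all observations but the i-th frozen, the data vector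
  is a constant vector \<open>c\<close> updated at i by \<open>Q y\<close>, so anything computed
  measurably from the data becomes a measurable function of \<open>Q y\<close> alone.\<close>

lemma fun_upd_data:
  assumes Q: "Q \<in> measurable M N" and x: "x \<in> space (PiM (I - {i}) (\<lambda>_. M))" and i: "i \<in> I"
    and K: "K \<in> measurable (PiM I (\<lambda>_. N)) L"
  defines "c \<equiv> \<lambda>j\<in>I - {i}. Q (x j)"
  shows "(\<lambda>j\<in>I. Q ((x(i := y)) j)) = c(i := Q y)"
    and "(\<lambda>q. K (c(i := q))) \<in> measurable N L"
proof -
  show "(\<lambda>j\<in>I. Q ((x(i := y)) j)) = c(i := Q y)"
    using i unfolding c_def by (auto simp: fun_eq_iff)
  have c: "c \<in> space (PiM (I - {i}) (\<lambda>_. N))"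
    using x measurable_space[OF Q] unfolding c_def by (auto simp: space_PiM PiE_iff)
  have I: "insert i (I - {i}) = I" using i by auto
  have "(\<lambda>q. c(i := q)) \<in> measurable N (PiM I (\<lambda>_. N))"
    using measurable_component_update[OF c, of i] unfolding I by simp
  then show "(\<lambda>q. K (c(i := q))) \<in> measurable N L"
    by (rule measurable_compose[OF _ K])
qed

text \<open>The weight \<open>K\<close> also sees the i-th coordinate, but only through
  \<open>Q\<close>; once the other coordinates are fixed it is one of the test functions allowed in
  \<open>eq\<close>.\<close>

lemma nn_integral_PiM_replace:
  assumes Q [measurable]: "Q \<in> measurable M N" and "finite I" "i \<in> I"
    and K [measurable]: "K \<in> borel_measurable (PiM I (\<lambda>_. N))"
    and [measurable]: "a \<in> borel_measurable M" "b \<in> borel_measurable M"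
    and eq: "\<And>\<phi>. \<phi> \<in> borel_measurable N \<Longrightarrow> (\<integral>\<^sup>+y. \<phi> (Q y) * a y \<partial>M) = (\<integral>\<^sup>+y. \<phi> (Q y) * b y \<partial>M)"
  shows "(\<integral>\<^sup>+\<omega>. K (\<lambda>j\<in>I. Q (\<omega> j)) * a (\<omega> i) \<partial>PiM I (\<lambda>_. M)) = (\<integral>\<^sup>+\<omega>. K (\<lambda>j\<in>I. Q (\<omega> j)) * b (\<omega> i) \<partial>PiM I (\<lambda>_. M))"
proof (rule nn_integral_PiM_coordinate_cong[OF assms(2,3)])
  fix x assume x: "x \<in> space (PiM (I - {i}) (\<lambda>_. M))"
  note u = fun_upd_data[OF Q x \<open>i \<in> I\<close> K]
  show "(\<integral>\<^sup>+y. K (\<lambda>j\<in>I. Q ((x(i := y)) j)) * a ((x(i := y)) i) \<partial>M)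
     = (\<integral>\<^sup>+y. K (\<lambda>j\<in>I. Q ((x(i := y)) j)) * b ((x(i := y)) i) \<partial>M)"
    unfolding u(1) using eq[OF u(2)] by simp
qed (use \<open>i \<in> I\<close> in measurable)

text \<open>In the integral over coordinate i, \<open>r (x j)\<close> is a constant because j
  differs from i, and \<open>K\<close> is a function of \<open>Q y\<close>, so \<open>zero\<close>
  applies. A non-integrable section again contributes 0 by convention.\<close>

lemma integral_PiM_offdiagonal_zero:
  fixes K :: "('i \<Rightarrow> 'q) \<Rightarrow> real"
  assumes Q: "Q \<in> measurable M N" and "finite I" "i \<in> I" "j \<in> I" "i \<noteq> j"
    and K: "K \<in> borel_measurable (PiM I (\<lambda>_. N))"
    and zero: "\<And>h :: 'q \<Rightarrow> real. h \<in> borel_measurable N \<Longrightarrow> integrable M (\<lambda>y. h (Q y) * r y) \<Longrightarrow> (\<integral>y. h (Q y) * r y \<partial>M) = 0"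
  shows "(\<integral>\<omega>. K (\<lambda>j\<in>I. Q (\<omega> j)) * r (\<omega> i) * r (\<omega> j) \<partial>PiM I (\<lambda>_. M)) = 0"
proof (rule integral_PiM_coordinate_zero[OF assms(2,3)])
  fix x assume x: "x \<in> space (PiM (I - {i}) (\<lambda>_. M))"
  note u = fun_upd_data[OF Q x \<open>i \<in> I\<close> K]
  have "(\<integral>y. (K ((\<lambda>j\<in>I - {i}. Q (x j))(i := Q y)) * r (x j)) * r y \<partial>M) = 0"
    using zero[of "\<lambda>q. K ((\<lambda>j\<in>I - {i}. Q (x j))(i := q)) * r (x j)"] u(2)
    by (cases "integrable M (\<lambda>y. (K ((\<lambda>j\<in>I - {i}. Q (x j))(i := Q y)) * r (x j)) * r y)")
       (auto simp: not_integrable_integral_eq)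
  then show "(\<integral>y. K (\<lambda>j\<in>I. Q ((x(i := y)) j)) * r ((x(i := y)) i) * r ((x(i := y)) j) \<partial>M) = 0"
    unfolding u(1) using \<open>i \<noteq> j\<close> by (simp add: mult_ac)
qed

text \<open>In other words, given the data Q the coordinates of r are independent and centred with variance s.\<close>
lemma PiM_conditional_second_moment:
  fixes K :: "'i \<Rightarrow> ('i \<Rightarrow> 'q) \<Rightarrow> real"
  assumes Q [measurable]: "Q \<in> measurable M N" and I: "finite I"
    and K [measurable]: "\<And>i. i \<in> I \<Longrightarrow> K i \<in> borel_measurable (PiM I (\<lambda>_. N))"
    and [measurable]: "r \<in> borel_measurable M" "s \<in> borel_measurable M"
    and zero: "\<And>h :: 'q \<Rightarrow> real. h \<in> borel_measurable N \<Longrightarrow> integrable M (\<lambda>y. h (Q y) * r y) \<Longrightarrow> (\<integral>y. h (Q y) * r y \<partial>M) = 0"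
    and var: "\<And>\<phi>. \<phi> \<in> borel_measurable N \<Longrightarrow> (\<integral>\<^sup>+y. \<phi> (Q y) * ennreal ((r y)\<^sup>2) \<partial>M) = (\<integral>\<^sup>+y. \<phi> (Q y) * ennreal (s y) \<partial>M)"
    and s: "AE y in M. 0 \<le> s y"
    and B: "AE \<omega> in PiM I (\<lambda>_. M). (\<Sum>i\<in>I. (K i (\<lambda>j\<in>I. Q (\<omega> j)))\<^sup>2 * s (\<omega> i)) \<le> B" "0 \<le> B"
  shows "integrable (PiM I (\<lambda>_. M)) (\<lambda>\<omega>. \<Sum>i\<in>I. (K i (\<lambda>j\<in>I. Q (\<omega> j)) * r (\<omega> i))\<^sup>2)"
    and "(\<integral>\<omega>. (\<Sum>i\<in>I. (K i (\<lambda>j\<in>I. Q (\<omega> j)) * r (\<omega> i))\<^sup>2) \<partial>PiM I (\<lambda>_. M)) \<le> B"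
    and "integrable (PiM I (\<lambda>_. M)) (\<lambda>\<omega>. (\<Sum>i\<in>I. K i (\<lambda>j\<in>I. Q (\<omega> j)) * r (\<omega> i))\<^sup>2)"
    and "(\<integral>\<omega>. (\<Sum>i\<in>I. K i (\<lambda>j\<in>I. Q (\<omega> j)) * r (\<omega> i))\<^sup>2 \<partial>PiM I (\<lambda>_. M)) \<le> B"
proof -
  let ?\<Pi> = "PiM I (\<lambda>_. M)"
  interpret \<Pi>: prob_space ?\<Pi> by (rule prob_space_PiM) (rule prob_space_axioms)
  define k where "k i \<omega> = K i (\<lambda>j\<in>I. Q (\<omega> j))" for i \<omega>
  have [measurable]: "k i \<in> borel_measurable ?\<Pi>" if "i \<in> I" for i
    unfolding k_def using that by measurable
  have sI: "AE \<omega> in ?\<Pi>. \<forall>i\<in>I. 0 \<le> s (\<omega> i)"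
    using I s by (intro eventually_ball_finite ballI AE_PiM_component prob_space_axioms) auto
  \<comment> \<open>The sum of squares is first integrated in \<open>ennreal\<close>, because no
    product of weight and residual is yet known to be square integrable; the bound \<open>B\<close>
    then provides the integrability.\<close>
  have "(\<integral>\<^sup>+\<omega>. ennreal (\<Sum>i\<in>I. (k i \<omega> * r (\<omega> i))\<^sup>2) \<partial>?\<Pi>) = (\<Sum>i\<in>I. \<integral>\<^sup>+\<omega>. ennreal ((k i \<omega>)\<^sup>2) * ennreal ((r (\<omega> i))\<^sup>2) \<partial>?\<Pi>)"
    by (subst nn_integral_sum[symmetric])
       (auto simp: sum_nonneg power_mult_distrib ennreal_mult[symmetric] simp flip: sum_ennreal intro!: nn_integral_cong)
  also have "\<dots> = (\<Sum>i\<in>I. \<integral>\<^sup>+\<omega>. ennreal ((k i \<omega>)\<^sup>2) * ennreal (s (\<omega> i)) \<partial>?\<Pi>)"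
  proof (intro sum.cong refl)
    fix i assume i: "i \<in> I"
    have [measurable]: "(\<lambda>q. ennreal ((K i q)\<^sup>2)) \<in> borel_measurable (PiM I (\<lambda>_. N))"
      using i by measurable
    show "(\<integral>\<^sup>+\<omega>. ennreal ((k i \<omega>)\<^sup>2) * ennreal ((r (\<omega> i))\<^sup>2) \<partial>?\<Pi>) = (\<integral>\<^sup>+\<omega>. ennreal ((k i \<omega>)\<^sup>2) * ennreal (s (\<omega> i)) \<partial>?\<Pi>)"
      unfolding k_def
      by (rule nn_integral_PiM_replace[where K="\<lambda>q. ennreal ((K i q)\<^sup>2)" and Q=Q and N=N
          and a="\<lambda>y. ennreal ((r y)\<^sup>2)" and b="\<lambda>y. ennreal (s y)"]) (use I i var in auto)
  qed
  also have "\<dots> = (\<integral>\<^sup>+\<omega>. (\<Sum>i\<in>I. ennreal ((k i \<omega>)\<^sup>2) * ennreal (s (\<omega> i))) \<partial>?\<Pi>)"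
    by (subst nn_integral_sum) auto
  also have "\<dots> \<le> (\<integral>\<^sup>+\<omega>. ennreal B \<partial>?\<Pi>)"
  proof (rule nn_integral_mono_AE, use sI B(1) in eventually_elim)
    case (elim \<omega>)
    have "(\<Sum>i\<in>I. ennreal ((k i \<omega>)\<^sup>2) * ennreal (s (\<omega> i))) = (\<Sum>i\<in>I. ennreal ((k i \<omega>)\<^sup>2 * s (\<omega> i)))"
      using elim(1) by (intro sum.cong) (auto simp: ennreal_mult)
    also have "\<dots> = ennreal (\<Sum>i\<in>I. (k i \<omega>)\<^sup>2 * s (\<omega> i))"
      using elim(1) by (intro sum_ennreal) auto
    finally show ?case using elim(2) by (simp add: k_def ennreal_leI)
  qed
  also have "\<dots> = ennreal B" using \<Pi>.emeasure_space_1 by simp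
  finally have le: "(\<integral>\<^sup>+\<omega>. ennreal (\<Sum>i\<in>I. (k i \<omega> * r (\<omega> i))\<^sup>2) \<partial>?\<Pi>) \<le> ennreal B" .
  have int: "integrable ?\<Pi> (\<lambda>\<omega>. \<Sum>i\<in>I. (k i \<omega> * r (\<omega> i))\<^sup>2)"
  proof (rule integrableI_bounded)
    show "(\<integral>\<^sup>+\<omega>. ennreal (norm (\<Sum>i\<in>I. (k i \<omega> * r (\<omega> i))\<^sup>2)) \<partial>?\<Pi>) < \<infinity>"
      using le by (simp add: sum_nonneg order_le_less_trans)
  qed measurable
  have leB: "(\<integral>\<omega>. (\<Sum>i\<in>I. (k i \<omega> * r (\<omega> i))\<^sup>2) \<partial>?\<Pi>) \<le> B"
    using le B(2) by (subst integral_eq_nn_integral) (auto simp: sum_nonneg enn2real_leI)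
  have int1: "integrable ?\<Pi> (\<lambda>\<omega>. (k i \<omega> * r (\<omega> i))\<^sup>2)" if "i \<in> I" for i
    by (rule Bochner_Integration.integrable_bound[OF int])
       (use that I in \<open>auto intro!: member_le_sum sum_nonneg simp: abs_of_nonneg[OF sum_nonneg]\<close>)
  have orth: "(\<integral>\<omega>. (k i \<omega> * r (\<omega> i)) * (k j \<omega> * r (\<omega> j)) \<partial>?\<Pi>) = 0" if "i \<in> I" "j \<in> I" "i \<noteq> j" for i j
  proof -
    have [measurable]: "(\<lambda>q. K i q * K j q) \<in> borel_measurable (PiM I (\<lambda>_. N))"
      using that by measurable
    have "(\<integral>\<omega>. (K i (\<lambda>j\<in>I. Q (\<omega> j)) * K j (\<lambda>j\<in>I. Q (\<omega> j))) * r (\<omega> i) * r (\<omega> j) \<partial>?\<Pi>) = 0"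
      by (rule integral_PiM_offdiagonal_zero[OF Q I that, where K="\<lambda>q. K i q * K j q"]) (auto intro: zero)
    then show ?thesis unfolding k_def by (simp add: mult_ac)
  qed
  have rm [measurable]: "(\<lambda>\<omega>. k i \<omega> * r (\<omega> i)) \<in> borel_measurable ?\<Pi>" if "i \<in> I" for i
    using that by measurable
  note sq = integral_square_sum_orthogonal[OF I rm int1 orth]
  show "integrable ?\<Pi> (\<lambda>\<omega>. \<Sum>i\<in>I. (K i (\<lambda>j\<in>I. Q (\<omega> j)) * r (\<omega> i))\<^sup>2)"
    and "(\<integral>\<omega>. (\<Sum>i\<in>I. (K i (\<lambda>j\<in>I. Q (\<omega> j)) * r (\<omega> i))\<^sup>2) \<partial>?\<Pi>) \<le> B"
    and "integrable ?\<Pi> (\<lambda>\<omega>. (\<Sum>i\<in>I. K i (\<lambda>j\<in>I. Q (\<omega> j)) * r (\<omega> i))\<^sup>2)"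
    using int leB sq(1) unfolding k_def by auto
  have "(\<integral>\<omega>. (\<Sum>i\<in>I. k i \<omega> * r (\<omega> i))\<^sup>2 \<partial>?\<Pi>) \<le> B"
    using leB sq(2) int1 by (subst (asm) Bochner_Integration.integral_sum) auto
  then show "(\<integral>\<omega>. (\<Sum>i\<in>I. K i (\<lambda>j\<in>I. Q (\<omega> j)) * r (\<omega> i))\<^sup>2 \<partial>?\<Pi>) \<le> B"
    unfolding k_def .
qed

text \<open>The conditional statement with trivial data: \<open>Q\<close> is constant, all weights
  are 1, and the conditional variance is the plain second moment.\<close>

lemma PiM_iid_second_moment:
  fixes r :: "'a \<Rightarrow> real"
  assumes I: "finite I" and [measurable]: "r \<in> borel_measurable M"
    and sq: "integrable M (\<lambda>y. (r y)\<^sup>2)" and zero: "(\<integral>y. r y \<partial>M) = 0"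
  shows "integrable (PiM I (\<lambda>_. M)) (\<lambda>\<omega>. (\<Sum>i\<in>I. r (\<omega> i))\<^sup>2)"
    and "(\<integral>\<omega>. (\<Sum>i\<in>I. r (\<omega> i))\<^sup>2 \<partial>PiM I (\<lambda>_. M)) \<le> card I * (\<integral>y. (r y)\<^sup>2 \<partial>M)"
proof -
  have Q: "(\<lambda>_. ()) \<in> measurable M (count_space UNIV)" by simp
  have z: "(\<integral>y. h ((\<lambda>_. ()) y) * r y \<partial>M) = 0" for h :: "unit \<Rightarrow> real"
    using zero by simp
  have v: "(\<integral>\<^sup>+y. \<phi> ((\<lambda>_. ()) y) * ennreal ((r y)\<^sup>2) \<partial>M) = (\<integral>\<^sup>+y. \<phi> ((\<lambda>_. ()) y) * ennreal (\<integral>y. (r y)\<^sup>2 \<partial>M) \<partial>M)" for \<phi> :: "unit \<Rightarrow> ennreal"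
    using sq by (simp add: nn_integral_cmult nn_integral_eq_integral emeasure_space_1)
  note m = PiM_conditional_second_moment[OF Q I, where K="\<lambda>_ _. 1" and r=r and s="\<lambda>_. \<integral>y. (r y)\<^sup>2 \<partial>M"
      and B="card I * (\<integral>y. (r y)\<^sup>2 \<partial>M)"]
  show "integrable (PiM I (\<lambda>_. M)) (\<lambda>\<omega>. (\<Sum>i\<in>I. r (\<omega> i))\<^sup>2)"
    using m(3) z v by simp
  show "(\<integral>\<omega>. (\<Sum>i\<in>I. r (\<omega> i))\<^sup>2 \<partial>PiM I (\<lambda>_. M)) \<le> card I * (\<integral>y. (r y)\<^sup>2 \<partial>M)"
    using m(4) z v by simp
qed

end

section \<open>Limit theorems for arrays\<close>

text \<open>Converts the Taylor remainder of a characteristic function, a minimum of a quadratic and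
  a cubic term, into a moment of order 2 + \<eta>. It rests on
  \<open>min 1 b \<le> b powr \<eta>\<close>, where \<eta> \<le> 1 matters for small b.\<close>

lemma min_powr_bound:
  fixes a x \<eta> :: real
  assumes "0 \<le> a" "0 < \<eta>" "\<eta> \<le> 1"
  shows "min (6 * x\<^sup>2) (a * \<bar>x\<bar> ^ 3) \<le> 6 * a powr \<eta> * \<bar>x\<bar> powr (2 + \<eta>)"
proof (cases "x = 0 \<or> a = 0")
  case False
  then have pos: "0 < \<bar>x\<bar>" "0 < a" using assms by auto
  have min1: "min 1 b \<le> b powr \<eta>" if "0 < b" for b :: real
  proof (cases "b \<le> 1")
    case True
    have "b powr 1 \<le> b powr \<eta>" using that True assms by (intro powr_mono') auto
    then show ?thesis using that by auto
  next
    case False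
    then have "1 powr \<eta> \<le> b powr \<eta>" using assms by (intro powr_mono2) auto
    then show ?thesis by auto
  qed
  have "min (6 * x\<^sup>2) (a * \<bar>x\<bar> ^ 3) \<le> min (6 * x\<^sup>2) (6 * (a * \<bar>x\<bar> ^ 3))"
    using pos by (intro min.mono) auto
  also have "\<dots> = 6 * x\<^sup>2 * min 1 (a * \<bar>x\<bar>)"
    using pos by (subst min_mult_distrib_left) (auto simp: power2_eq_square power3_eq_cube abs_mult_self_eq mult_ac)
  also have "\<dots> \<le> 6 * x\<^sup>2 * (a * \<bar>x\<bar>) powr \<eta>"
    using pos by (intro mult_left_mono min1) auto
  also have "\<dots> = 6 * a powr \<eta> * (\<bar>x\<bar> powr 2 * \<bar>x\<bar> powr \<eta>)"
    using pos by (simp add: powr_mult)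
  also have "\<dots> = 6 * a powr \<eta> * \<bar>x\<bar> powr (2 + \<eta>)"
    by (simp add: powr_add)
  finally show ?thesis .
qed (use assms in auto)

lemma (in prob_space) char_PiM_sum:
  fixes r :: "'a \<Rightarrow> real"
  assumes "finite I" and [measurable]: "r \<in> borel_measurable M"
  shows "char (distr (PiM I (\<lambda>_. M)) borel (\<lambda>\<omega>. (\<Sum>i\<in>I. r (\<omega> i)) / b)) t = char (distr M borel r) (t / b) ^ card I"
proof -
  interpret product_sigma_finite "\<lambda>_. M" by standard
  have "char (distr (PiM I (\<lambda>_. M)) borel (\<lambda>\<omega>. (\<Sum>i\<in>I. r (\<omega> i)) / b)) t
    = (CLINT \<omega>|PiM I (\<lambda>_. M). iexp (t * ((\<Sum>i\<in>I. r (\<omega> i)) / b)))"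
    unfolding char_def using \<open>finite I\<close> by (subst integral_distr) auto
  also have "\<dots> = (CLINT \<omega>|PiM I (\<lambda>_. M). (\<Prod>i\<in>I. iexp (t / b * r (\<omega> i))))"
    using \<open>finite I\<close>
    by (intro Bochner_Integration.integral_cong refl)
       (simp add: exp_sum[symmetric] sum_distrib_left sum_divide_distrib mult_ac)
  also have "\<dots> = (\<Prod>i\<in>I. CLINT y|M. iexp (t / b * r y))"
    using \<open>finite I\<close> by (intro product_integral_prod) (auto intro!: integrable_const_bound[where B=1])
  also have "\<dots> = char (distr M borel r) (t / b) ^ card I"
    unfolding char_def by (subst integral_distr) auto
  finally show ?thesis .
qed

text \<open>For complex numbers of modulus at most 1, n-th powers differ by at most n times the
  difference of the bases. The condition on n keeps \<open>1 - t\<^sup>2 / (2 * n)\<close> at or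
  above -1, hence in the unit disc, and the factor n cancels the one in
  \<open>(t / sqrt n)\<^sup>2\<close>.\<close>

lemma (in prob_space) lyapunov_char_bound:
  fixes r :: "'a \<Rightarrow> real"
  assumes [measurable]: "r \<in> borel_measurable M"
    and \<eta>: "0 < \<eta>" "\<eta> \<le> 1"
    and sq: "integrable M (\<lambda>y. (r y)\<^sup>2)" and zero: "expectation r = 0" and var: "expectation (\<lambda>y. (r y)\<^sup>2) = 1"
    and mom: "integrable M (\<lambda>y. \<bar>r y\<bar> powr (2 + \<eta>))" "expectation (\<lambda>y. \<bar>r y\<bar> powr (2 + \<eta>)) \<le> K"
    and n: "t\<^sup>2 / 4 \<le> real n" "0 < n"
  shows "cmod (char (distr (PiM {..<n} (\<lambda>_. M)) borel (\<lambda>\<omega>. (\<Sum>i<n. r (\<omega> i)) / sqrt n)) t - (1 + (- (t\<^sup>2) / 2) / n) ^ n)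
    \<le> t\<^sup>2 * (\<bar>t\<bar> / sqrt n) powr \<eta> * K"
proof -
  let ?t = "t / sqrt n"
  interpret D: real_distribution "distr M borel r" by (rule real_distribution_distr) simp
  have int: "integrable M r" by (rule square_integrable_imp_integrable[OF _ sq]) simp
  have "cmod (char (distr M borel r) ?t - (1 - ?t\<^sup>2 * 1 / 2)) \<le> ?t\<^sup>2 / 6 * expectation (\<lambda>y. min (6 * (r y)\<^sup>2) (\<bar>?t\<bar> * \<bar>r y\<bar> ^ 3))"
    using char_approx3'[OF _ int sq zero, of 1 "distr M borel r" ?t] zero var by (simp add: zero)
  also have "expectation (\<lambda>y. min (6 * (r y)\<^sup>2) (\<bar>?t\<bar> * \<bar>r y\<bar> ^ 3)) \<le> expectation (\<lambda>y. 6 * \<bar>?t\<bar> powr \<eta> * \<bar>r y\<bar> powr (2 + \<eta>))"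
  proof (rule integral_mono)
    show "integrable M (\<lambda>y. min (6 * (r y)\<^sup>2) (\<bar>?t\<bar> * \<bar>r y\<bar> ^ 3))"
      by (rule Bochner_Integration.integrable_bound[where f="\<lambda>y. 6 * (r y)\<^sup>2"]) (use sq in auto)
    show "min (6 * (r y)\<^sup>2) (\<bar>?t\<bar> * \<bar>r y\<bar> ^ 3) \<le> 6 * \<bar>?t\<bar> powr \<eta> * \<bar>r y\<bar> powr (2 + \<eta>)" for y
      by (rule min_powr_bound) (use \<eta> in auto)
  qed (use mom(1) in simp)
  also have "\<dots> \<le> 6 * \<bar>?t\<bar> powr \<eta> * K"
    using mom(2) by (simp add: mult_left_mono)
  finally have 1: "cmod (char (distr M borel r) ?t - (1 - ?t\<^sup>2 * 1 / 2)) \<le> ?t\<^sup>2 / 6 * (6 * \<bar>?t\<bar> powr \<eta> * K)"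
    by (simp add: mult_left_mono)
  have t2: "?t\<^sup>2 = t\<^sup>2 / n" by (simp add: power_divide)
  have "cmod (char (distr M borel r) ?t ^ n - complex_of_real (1 + (- (t\<^sup>2) / 2) / n) ^ n)
      \<le> n * cmod (char (distr M borel r) ?t - complex_of_real (1 + (- (t\<^sup>2) / 2) / n))"
  proof (rule norm_power_diff)
    show "cmod (char (distr M borel r) ?t) \<le> 1" by (rule D.cmod_char_le_1)
    show "cmod (complex_of_real (1 + - (t\<^sup>2) / 2 / real n)) \<le> 1"
      unfolding norm_of_real using n by (intro abs_leI) (auto simp: field_simps)
  qed
  also have "\<dots> \<le> n * (?t\<^sup>2 / 6 * (6 * \<bar>?t\<bar> powr \<eta> * K))"
    using 1 unfolding t2 by (intro mult_left_mono) (auto simp: field_simps)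
  also have "\<dots> = t\<^sup>2 * (\<bar>t\<bar> / sqrt n) powr \<eta> * K"
    unfolding t2 using n by simp
  finally show ?thesis by (subst char_PiM_sum) auto
qed

text \<open>Stage n uses n independent copies from its own law \<open>M n\<close>. The bound on
  characteristic functions involves the law only through \<open>K\<close>, so it tends to 0 along
  any sequence of laws and Levy's continuity theorem applies.\<close>

theorem lyapunov_clt_array:
  fixes M :: "nat \<Rightarrow> 'a measure" and r :: "nat \<Rightarrow> 'a \<Rightarrow> real"
  assumes M: "\<And>n. prob_space (M n)" and r [measurable]: "\<And>n. r n \<in> borel_measurable (M n)"
    and \<eta>: "0 < \<eta>" "\<eta> \<le> 1"
    and sq: "\<And>n. integrable (M n) (\<lambda>y. (r n y)\<^sup>2)" and zero: "\<And>n. (\<integral>y. r n y \<partial>M n) = 0"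
    and var: "\<And>n. (\<integral>y. (r n y)\<^sup>2 \<partial>M n) = 1"
    and mom: "\<And>n. integrable (M n) (\<lambda>y. \<bar>r n y\<bar> powr (2 + \<eta>))" "\<And>n. (\<integral>y. \<bar>r n y\<bar> powr (2 + \<eta>) \<partial>M n) \<le> K"
  shows "weak_conv_m (\<lambda>n. distr (PiM {..<n} (\<lambda>_. M n)) borel (\<lambda>\<omega>. (\<Sum>i<n. r n (\<omega> i)) / sqrt n)) std_normal_distribution"
proof (rule levy_continuity)
  fix n
  interpret M: prob_space "M n" by (rule M)
  interpret P: prob_space "PiM {..<n} (\<lambda>_. M n)" by (rule prob_space_PiM) (rule M)
  show "real_distribution (distr (PiM {..<n} (\<lambda>_. M n)) borel (\<lambda>\<omega>. (\<Sum>i<n. r n (\<omega> i)) / sqrt n))"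
    by (rule P.real_distribution_distr) measurable
next
  fix t
  let ?c = "\<lambda>n. char (distr (PiM {..<n} (\<lambda>_. M n)) borel (\<lambda>\<omega>. (\<Sum>i<n. r n (\<omega> i)) / sqrt n)) t"
  have *: "\<forall>\<^sub>F n in sequentially. cmod (?c n - complex_of_real ((1 + (- (t\<^sup>2) / 2) / n) ^ n)) \<le> t\<^sup>2 * (\<bar>t\<bar> / sqrt n) powr \<eta> * K"
  proof (rule eventually_sequentiallyI)
    fix n assume n: "max 1 (nat \<lceil>t\<^sup>2 / 4\<rceil>) \<le> n"
    then have n': "t\<^sup>2 / 4 \<le> real n" "0 < n" by (simp_all add: nat_ceiling_le_eq)
    from prob_space.lyapunov_char_bound[OF M r \<eta> sq zero var mom n', of n]
    show "cmod (?c n - complex_of_real ((1 + (- (t\<^sup>2) / 2) / n) ^ n)) \<le> t\<^sup>2 * (\<bar>t\<bar> / sqrt n) powr \<eta> * K"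
      by simp
  qed
  have "(\<lambda>n. t\<^sup>2 * (\<bar>t\<bar> / sqrt (real n)) powr \<eta> * K) \<longlonglongrightarrow> t\<^sup>2 * 0 * K"
  proof (intro tendsto_intros)
    have "(\<lambda>n. \<bar>t\<bar> / sqrt (real n)) \<longlonglongrightarrow> 0"
      by (intro tendsto_divide_0[OF tendsto_const] filterlim_at_top_imp_at_infinity
        filterlim_compose[OF sqrt_at_top] filterlim_real_sequentially)
    then show "(\<lambda>n. (\<bar>t\<bar> / sqrt (real n)) powr \<eta>) \<longlonglongrightarrow> 0"
      by (rule tendsto_zero_powrI[OF _ tendsto_const _ \<eta>(1)]) simp
  qed
  then have **: "(\<lambda>n. t\<^sup>2 * (\<bar>t\<bar> / sqrt (real n)) powr \<eta> * K) \<longlonglongrightarrow> 0" by simp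
  have ***: "(\<lambda>n. ?c n - complex_of_real ((1 + (- (t\<^sup>2) / 2) / n) ^ n)) \<longlonglongrightarrow> 0"
    by (rule Lim_null_comparison[OF * **])
  have "(\<lambda>n. complex_of_real ((1 + (-(t^2) / 2) / n)^n)) \<longlonglongrightarrow> complex_of_real (exp (-(t^2) / 2))"
    by (rule isCont_tendsto_compose [OF _ tendsto_exp_limit_sequentially]) auto
  then have "?c \<longlonglongrightarrow> complex_of_real (exp (-(t\<^sup>2) / 2))"
    by (rule Lim_transform[OF _ ***])
  then show "?c \<longlonglongrightarrow> char std_normal_distribution t"
    by (simp add: char_std_normal_distribution)
qed (rule real_dist_normal_dist)

text \<open>With moments of order 1 + \<eta> only, the variance may be infinite, so \<open>z\<close>
  is cut at \<open>L\<close>. The centred bounded part is treated by Chebyshev, the tail part by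
  Markov, and the remaining deterministic error is the mean of the tail part; each receives a share
  \<delta> / 3.\<close>

lemma (in prob_space) truncated_wlln_bound:
  fixes z :: "'a \<Rightarrow> real" and n :: nat and K L \<delta> \<eta> :: real
  assumes [measurable]: "z \<in> borel_measurable M" and z: "\<And>y. 0 \<le> z y" and \<eta>: "0 < \<eta>"
    and int: "integrable M z" and mean: "expectation z = 1"
    and mom: "integrable M (\<lambda>y. z y powr (1 + \<eta>))" "expectation (\<lambda>y. z y powr (1 + \<eta>)) \<le> K"
    and L: "0 < L" and \<delta>: "0 < \<delta>" and KL: "K / L powr \<eta> \<le> \<delta> / 3" and n: "0 < n"
  shows "\<P>(\<omega> in PiM {..<n} (\<lambda>_. M). \<delta> < \<bar>(\<Sum>i<n. z (\<omega> i)) / n - 1\<bar>) \<le> 9 * L\<^sup>2 / (n * \<delta>\<^sup>2) + 3 * (K / L powr \<eta>) / \<delta>"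
proof -
  let ?\<Pi> = "PiM {..<n} (\<lambda>_. M)"
  interpret \<Pi>: prob_space ?\<Pi> by (rule prob_space_PiM) (rule prob_space_axioms)
  define \<tau> where "\<tau> y = (if z y \<le> L then z y else 0)" for y
  define \<rho> where "\<rho> y = (if z y \<le> L then 0 else z y)" for y
  have [measurable]: "\<tau> \<in> borel_measurable M" "\<rho> \<in> borel_measurable M"
    unfolding \<tau>_def \<rho>_def by measurable
  have sum: "z y = \<tau> y + \<rho> y" for y by (simp add: \<tau>_def \<rho>_def)
  have \<tau>: "0 \<le> \<tau> y" "\<tau> y \<le> L" and \<rho>: "0 \<le> \<rho> y" for y using z L by (auto simp: \<tau>_def \<rho>_def)
  have i\<tau>: "integrable M \<tau>" using \<tau> by (intro integrable_const_bound[where B=L]) auto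
  have i\<rho>: "integrable M \<rho>"
    by (rule Bochner_Integration.integrable_bound[OF int]) (use z in \<open>auto simp: \<rho>_def\<close>)
  define e where "e = expectation \<rho>"
  have m: "expectation \<tau> = 1 - e" using mean i\<tau> i\<rho> unfolding sum e_def by simp
  have "e \<le> expectation (\<lambda>y. z y powr (1 + \<eta>) / L powr \<eta>)"
    unfolding e_def
  proof (rule integral_mono[OF i\<rho>])
    \<comment> \<open>Above the cut, the factor \<open>(z y / L) powr \<eta>\<close> is at least 1
      and can be inserted.\<close>
    show "\<rho> y \<le> z y powr (1 + \<eta>) / L powr \<eta>" for y
    proof (cases "z y \<le> L")
      case False
      then have "L powr \<eta> \<le> z y powr \<eta>" using L \<eta> by (intro powr_mono2) auto
      then have "z y * L powr \<eta> \<le> z y * z y powr \<eta>" using z by (intro mult_left_mono) auto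
      also have "z y * z y powr \<eta> = z y powr (1 + \<eta>)" using False L by (simp add: powr_add)
      finally show ?thesis using False L by (simp add: \<rho>_def field_simps)
    qed (simp add: \<rho>_def)
  qed (use mom in simp)
  also have "\<dots> \<le> K / L powr \<eta>" using mom(2) by (simp add: divide_right_mono)
  finally have e: "e \<le> K / L powr \<eta>" .
  define a where "a y = \<tau> y - expectation \<tau>" for y
  have [measurable]: "a \<in> borel_measurable M" unfolding a_def by measurable
  have e0: "0 \<le> expectation \<tau>" "expectation \<tau> \<le> L"
    using \<tau> i\<tau> by (auto intro!: integral_nonneg integral_le_const)
  have aL: "(a y)\<^sup>2 \<le> L\<^sup>2" for y
    using \<tau>[of y] e0 unfolding a_def by (intro power2_le_iff_abs_le[THEN iffD2]) auto
  have ia: "integrable M (\<lambda>y. (a y)\<^sup>2)" using aL by (intro integrable_const_bound[where B="L\<^sup>2"]) auto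
  have a0: "expectation a = 0" unfolding a_def using i\<tau> by (simp add: prob_space)
  have aL': "expectation (\<lambda>y. (a y)\<^sup>2) \<le> L\<^sup>2" using aL ia by (intro integral_le_const) auto
  note sm = PiM_iid_second_moment[OF finite_lessThan _ ia a0, of n]
  have "\<P>(\<omega> in ?\<Pi>. n * \<delta> / 3 \<le> \<bar>\<Sum>i<n. a (\<omega> i)\<bar>) \<le> \<Pi>.expectation (\<lambda>\<omega>. (\<Sum>i<n. a (\<omega> i))\<^sup>2) / (n * \<delta> / 3)\<^sup>2"
    by (rule \<Pi>.second_moment_method) (use n \<delta> sm in auto)
  also have "\<dots> \<le> n * L\<^sup>2 / (n * \<delta> / 3)\<^sup>2"
  proof (rule divide_right_mono)
    have "\<Pi>.expectation (\<lambda>\<omega>. (\<Sum>i<n. a (\<omega> i))\<^sup>2) \<le> n * expectation (\<lambda>y. (a y)\<^sup>2)" using sm(2) by simp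
    also have "\<dots> \<le> n * L\<^sup>2" using aL' by (intro mult_left_mono) auto
    finally show "\<Pi>.expectation (\<lambda>\<omega>. (\<Sum>i<n. a (\<omega> i))\<^sup>2) \<le> n * L\<^sup>2" .
  qed simp
  also have "\<dots> = 9 * L\<^sup>2 / (n * \<delta>\<^sup>2)" using n \<delta> by (simp add: power2_eq_square field_simps)
  finally have p1: "\<P>(\<omega> in ?\<Pi>. n * \<delta> / 3 \<le> \<bar>\<Sum>i<n. a (\<omega> i)\<bar>) \<le> 9 * L\<^sup>2 / (n * \<delta>\<^sup>2)" .
  have ic: "integrable ?\<Pi> (\<lambda>\<omega>. \<rho> (\<omega> i))" "\<Pi>.expectation (\<lambda>\<omega>. \<rho> (\<omega> i)) = e" if "i < n" for i
  proof -
    have d: "distr ?\<Pi> M (\<lambda>\<omega>. \<omega> i) = M" using that by (intro distr_PiM_component prob_space_axioms) auto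
    have [measurable]: "(\<lambda>\<omega>. \<omega> i) \<in> measurable ?\<Pi> M" by (rule measurable_component_singleton) (use that in simp)
    show "integrable ?\<Pi> (\<lambda>\<omega>. \<rho> (\<omega> i))"
      using i\<rho> by (subst (asm) d[symmetric], subst (asm) integrable_distr_eq) auto
    have "expectation \<rho> = integral\<^sup>L (distr ?\<Pi> M (\<lambda>\<omega>. \<omega> i)) \<rho>" by (simp add: d)
    then show "\<Pi>.expectation (\<lambda>\<omega>. \<rho> (\<omega> i)) = e"
      unfolding e_def by (subst (asm) integral_distr) auto
  qed
  have "\<P>(\<omega> in ?\<Pi>. n * \<delta> / 3 \<le> (\<Sum>i<n. \<rho> (\<omega> i))) \<le> \<Pi>.expectation (\<lambda>\<omega>. \<Sum>i<n. \<rho> (\<omega> i)) / (n * \<delta> / 3)"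
    by (rule integral_Markov_inequality_measure[where A="{}"]) (use n \<delta> \<rho> ic in \<open>auto intro!: AE_I2 sum_nonneg\<close>)
  also have "\<Pi>.expectation (\<lambda>\<omega>. \<Sum>i<n. \<rho> (\<omega> i)) = n * e"
    using ic by (subst Bochner_Integration.integral_sum) auto
  also have "n * e / (n * \<delta> / 3) = 3 * e / \<delta>" using n by simp
  also have "\<dots> \<le> 3 * (K / L powr \<eta>) / \<delta>" using e \<delta> by (intro divide_right_mono) auto
  finally have p2: "\<P>(\<omega> in ?\<Pi>. n * \<delta> / 3 \<le> (\<Sum>i<n. \<rho> (\<omega> i))) \<le> 3 * (K / L powr \<eta>) / \<delta>" .
  have "\<P>(\<omega> in ?\<Pi>. \<delta> < \<bar>(\<Sum>i<n. z (\<omega> i)) / n - 1\<bar>)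
     \<le> measure ?\<Pi> ({\<omega> \<in> space ?\<Pi>. n * \<delta> / 3 \<le> \<bar>\<Sum>i<n. a (\<omega> i)\<bar>} \<union> {\<omega> \<in> space ?\<Pi>. n * \<delta> / 3 \<le> (\<Sum>i<n. \<rho> (\<omega> i))})"
  proof (rule \<Pi>.finite_measure_mono)
    show "{\<omega> \<in> space ?\<Pi>. \<delta> < \<bar>(\<Sum>i<n. z (\<omega> i)) / n - 1\<bar>}
      \<subseteq> {\<omega> \<in> space ?\<Pi>. n * \<delta> / 3 \<le> \<bar>\<Sum>i<n. a (\<omega> i)\<bar>} \<union> {\<omega> \<in> space ?\<Pi>. n * \<delta> / 3 \<le> (\<Sum>i<n. \<rho> (\<omega> i))}"
    proof (rule subsetI, rule ccontr)
      fix \<omega> assume \<omega>: "\<omega> \<in> {\<omega> \<in> space ?\<Pi>. \<delta> < \<bar>(\<Sum>i<n. z (\<omega> i)) / n - 1\<bar>}"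
       "\<omega> \<notin> {\<omega> \<in> space ?\<Pi>. n * \<delta> / 3 \<le> \<bar>\<Sum>i<n. a (\<omega> i)\<bar>} \<union> {\<omega> \<in> space ?\<Pi>. n * \<delta> / 3 \<le> (\<Sum>i<n. \<rho> (\<omega> i))}"
      from \<omega> have b1: "\<delta> < \<bar>(\<Sum>i<n. z (\<omega> i)) / n - 1\<bar>" by blast
      from \<omega> have "\<not> n * \<delta> / 3 \<le> \<bar>\<Sum>i<n. a (\<omega> i)\<bar>" "\<not> n * \<delta> / 3 \<le> (\<Sum>i<n. \<rho> (\<omega> i))" by blast+
      then have b: "\<bar>\<Sum>i<n. a (\<omega> i)\<bar> < n * \<delta> / 3" "(\<Sum>i<n. \<rho> (\<omega> i)) < n * \<delta> / 3"
        unfolding not_le .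
      have "(\<Sum>i<n. z (\<omega> i)) = (\<Sum>i<n. a (\<omega> i)) + (\<Sum>i<n. \<rho> (\<omega> i)) + n * (1 - e)"
        unfolding sum a_def m by (simp add: sum.distrib sum_subtractf algebra_simps)
      then have eq: "(\<Sum>i<n. z (\<omega> i)) - n = (\<Sum>i<n. a (\<omega> i)) + (\<Sum>i<n. \<rho> (\<omega> i)) - n * e"
        by (simp add: algebra_simps)
      have r0: "0 \<le> (\<Sum>i<n. \<rho> (\<omega> i))" using \<rho> by (intro sum_nonneg) auto
      have "0 \<le> e" using \<rho> by (simp add: e_def integral_nonneg)
      moreover have "e \<le> \<delta> / 3" using e KL by (rule order_trans)
      ultimately have ee: "0 \<le> n * e" "n * e \<le> n * \<delta> / 3"
        using mult_left_mono[of e "\<delta> / 3" "real n"] by auto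
      have nd: "0 < n * \<delta>" using n \<delta> by simp
      have "\<bar>(\<Sum>i<n. z (\<omega> i)) - n\<bar> \<le> n * \<delta>"
        unfolding eq using b ee r0 nd by linarith
      then have "\<bar>(\<Sum>i<n. z (\<omega> i)) / n - 1\<bar> \<le> \<delta>"
        using n by (simp add: abs_le_iff field_simps)
      with b1 show False by simp
    qed
  qed measurable
  also have "\<dots> \<le> \<P>(\<omega> in ?\<Pi>. n * \<delta> / 3 \<le> \<bar>\<Sum>i<n. a (\<omega> i)\<bar>) + \<P>(\<omega> in ?\<Pi>. n * \<delta> / 3 \<le> (\<Sum>i<n. \<rho> (\<omega> i)))"
    by (rule measure_Un_le) measurable
  finally show ?thesis using p1 p2 by linarith
qed

text \<open>The quantifier over laws sits inside the choice of \<open>N\<close>: the threshold may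
  depend on the moment bound \<open>K\<close> but not on the law.\<close>

lemma uniform_wlln:
  fixes \<delta> \<epsilon> \<eta> K :: real
  assumes "0 < \<delta>" "0 < \<epsilon>" "0 < \<eta>"
  shows "\<exists>N::nat. \<forall>n\<ge>N. \<forall>(M :: 'a measure) z. prob_space M \<longrightarrow> z \<in> borel_measurable M \<longrightarrow> (\<forall>y. 0 \<le> z y) \<longrightarrow>
    integrable M z \<longrightarrow> integral\<^sup>L M z = 1 \<longrightarrow> integrable M (\<lambda>y. z y powr (1 + \<eta>)) \<longrightarrow> (\<integral>y. z y powr (1 + \<eta>) \<partial>M) \<le> K \<longrightarrow>
    \<P>(\<omega> in PiM {..<n::nat} (\<lambda>_. M). \<delta> < \<bar>(\<Sum>i<n. z (\<omega> i)) / n - 1\<bar>) \<le> \<epsilon>"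
proof -
  \<comment> \<open>The first bound keeps the mean of the tail part within \<delta> / 3, the second
    makes the Markov term at most \<epsilon> / 2. \<open>L\<close> is then chosen with
    \<open>K / L powr \<eta> \<le> k\<close>, the maximum keeping it positive, and \<open>N\<close>
    leaves the other \<epsilon> / 2 to the Chebyshev term.\<close>
  define k where "k = min (\<delta> / 3) (\<epsilon> * \<delta> / 6)"
  have k: "0 < k" using assms by (simp add: k_def)
  define L where "L = (max 1 (\<bar>K\<bar> / k)) powr (1 / \<eta>)"
  have L: "0 < L" by (simp add: L_def)
  have Lp: "L powr \<eta> = max 1 (\<bar>K\<bar> / k)" using assms unfolding L_def by (simp add: powr_powr)
  have "K \<le> k * (\<bar>K\<bar> / k)" using k by simp
  also have "\<dots> \<le> k * L powr \<eta>" unfolding Lp using k by (intro mult_left_mono) auto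
  finally have KL: "K / L powr \<eta> \<le> k" using L by (simp add: field_simps)
  define N where "N = max 1 (nat \<lceil>18 * L\<^sup>2 / (\<epsilon> * \<delta>\<^sup>2)\<rceil>)"
  show ?thesis
  proof (intro exI[of _ N] allI impI)
    fix n :: nat and M :: "'a measure" and z :: "'a \<Rightarrow> real"
    assume n: "N \<le> n" and h: "prob_space M" "z \<in> borel_measurable M" "\<forall>y. 0 \<le> z y"
    "integrable M z" "integral\<^sup>L M z = 1" "integrable M (\<lambda>y. z y powr (1 + \<eta>))" "(\<integral>y. z y powr (1 + \<eta>) \<partial>M) \<le> K"
    from n have n': "0 < n" "18 * L\<^sup>2 / (\<epsilon> * \<delta>\<^sup>2) \<le> n" by (simp_all add: N_def nat_ceiling_le_eq)
    interpret prob_space M by (rule h)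
    have "\<P>(\<omega> in PiM {..<n} (\<lambda>_. M). \<delta> < \<bar>(\<Sum>i<n. z (\<omega> i)) / n - 1\<bar>) \<le> 9 * L\<^sup>2 / (n * \<delta>\<^sup>2) + 3 * (K / L powr \<eta>) / \<delta>"
      by (rule truncated_wlln_bound[where \<eta>=\<eta>]) (use assms KL L n' h in \<open>simp_all add: k_def\<close>)
    also have "9 * L\<^sup>2 / (n * \<delta>\<^sup>2) \<le> \<epsilon> / 2" using n' assms by (simp add: field_simps)
    also have "3 * (K / L powr \<eta>) / \<delta> \<le> 3 * (\<epsilon> * \<delta> / 6) / \<delta>"
      using KL assms by (intro divide_right_mono mult_left_mono) (auto simp: k_def)
    also have "\<dots> = \<epsilon> / 2" using assms by simp
    finally show "\<P>(\<omega> in PiM {..<n} (\<lambda>_. M). \<delta> < \<bar>(\<Sum>i<n. z (\<omega> i)) / n - 1\<bar>) \<le> \<epsilon>" by simp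
  qed
qed

section \<open>Convergence in probability\<close>

text \<open>Polya's argument: continuity of \<open>G\<close> supplies points where it takes the
  values k / m, and convergence at these finitely many points controls every x by monotonicity of
  \<open>F n\<close> and \<open>G\<close>.\<close>

lemma uniform_cdf_convergence:
  fixes G :: "real \<Rightarrow> real" and F :: "nat \<Rightarrow> real \<Rightarrow> real"
  assumes G: "\<And>x. isCont G x" "mono G" "(G \<longlongrightarrow> 0) at_bot" "(G \<longlongrightarrow> 1) at_top"
    and F: "\<And>n. mono (F n)" "\<And>n x. 0 \<le> F n x" "\<And>n x. F n x \<le> 1"
    and lim: "\<And>x. (\<lambda>n. F n x) \<longlonglongrightarrow> G x" and \<epsilon>: "0 < \<epsilon>"
  shows "\<exists>N. \<forall>n\<ge>N. \<forall>x. \<bar>F n x - G x\<bar> \<le> \<epsilon>"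
proof -
  obtain m :: nat where m: "3 / \<epsilon> < real m" using reals_Archimedean2 by blast
  then have m0: "0 < m" using \<epsilon> by (cases m) auto
  have m3: "3 / m \<le> \<epsilon>" using m \<epsilon> m0 by (simp add: field_simps)
  have "\<exists>x. G x = k / m" if k: "0 < k" "k < m" for k
  proof -
    have "\<forall>\<^sub>F x in at_bot. G x < k / m"
      using k by (intro order_tendstoD(2)[OF G(3)]) auto
    then obtain a where a: "G a < k / m" by (auto dest: eventually_happens)
    have "\<forall>\<^sub>F x in at_top. k / m < G x"
      using k by (intro order_tendstoD(1)[OF G(4)]) auto
    then obtain b where b: "k / m < G b" by (auto dest: eventually_happens)
    have "a \<le> b"
    proof (rule ccontr)
      assume "\<not> a \<le> b"
      then have "G b \<le> G a" using G(2) by (auto simp: mono_def)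
      with a b show False by simp
    qed
    then show ?thesis using IVT[of G a "k / m" b] a b G(1) by auto
  qed
  then have "\<exists>q. \<forall>k. 0 < k \<and> k < m \<longrightarrow> G (q k) = k / m" by (intro choice) auto
  then obtain q where q: "\<And>k. 0 < k \<Longrightarrow> k < m \<Longrightarrow> G (q k) = k / m" by blast
  have "\<forall>\<^sub>F n in sequentially. \<forall>k\<in>{..<m}. \<bar>F n (q k) - G (q k)\<bar> < 1 / m"
  proof (rule eventually_ball_finite)
    show "\<forall>k\<in>{..<m}. \<forall>\<^sub>F n in sequentially. \<bar>F n (q k) - G (q k)\<bar> < 1 / m"
      using tendstoD[OF lim, of "1 / m"] m0 by (auto simp: dist_real_def)
  qed simp
  then obtain N where N: "\<And>n k. n \<ge> N \<Longrightarrow> k < m \<Longrightarrow> \<bar>F n (q k) - G (q k)\<bar> < 1 / m"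
    unfolding eventually_sequentially by auto
  have G01: "0 \<le> G x" "G x \<le> 1" for x
  proof -
    have "F n x \<ge> 0" "F n x \<le> 1" for n using F by auto
    then show "0 \<le> G x" "G x \<le> 1"
      using LIMSEQ_le_const[OF lim, of 0 x] LIMSEQ_le_const2[OF lim, of x 1] by auto
  qed
  have "\<bar>F n x - G x\<bar> \<le> 3 / m" if n: "n \<ge> N" for n x
  proof -
    define k where "k = nat \<lfloor>m * G x\<rfloor>"
    have "real k = of_int \<lfloor>m * G x\<rfloor>" using G01[of x] by (simp add: k_def)
    then have k: "k \<le> m * G x" "m * G x < k + 1"
      using floor_correct[of "m * G x"] by linarith+
    have k': "k / m \<le> G x" "G x < (k + 1) / m"
      using k m0 by (auto simp: field_simps)
    have up: "F n x \<le> G x + 2 / m"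
    proof (cases "k + 1 < m")
      case True
      have "G x < G (q (k + 1))" using q[of "k + 1"] True k' by simp
      then have "x \<le> q (k + 1)" using G(2) by (meson linorder_not_le monoD less_imp_le)
      then have "F n x \<le> F n (q (k + 1))" using F(1) by (auto dest: monoD)
      also have "\<dots> \<le> (k + 1) / m + 1 / m" using N[OF n True] q[of "k + 1"] True by simp
      also have "\<dots> = k / m + 2 / m" by (simp add: add_divide_distrib)
      finally show ?thesis using k' by simp
    next
      case False
      then have "real m \<le> k + 1" by simp
      then have "1 \<le> (k + 1) / m" using m0 by (simp add: field_simps)
      also have "\<dots> = k / m + 1 / m" by (simp add: add_divide_distrib)
      also have "\<dots> \<le> G x + 2 / m" using k' m0 by (intro add_mono) (auto simp: divide_right_mono)
      finally show ?thesis using F(3)[of n x] by simp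
    qed
    \<comment> \<open>Index k - 1 rather than k: \<open>G (q k)\<close> may equal
      \<open>G x\<close>, which does not place \<open>q k\<close> to the left of x, whereas k - 1
      gives a strict inequality. It also stays below m when k = m. The price is one more 1 / m; for
      k < 2 the left side is at most 0.\<close>
    have low: "G x - 3 / m \<le> F n x"
    proof (cases "2 \<le> k")
      case True
      have "m * G x \<le> real m * 1" using G01[of x] by (intro mult_left_mono) auto
      then have km: "k \<le> m" using k by linarith
      have km1: "k - 1 < m" using km True by simp
      have k1: "real (k - 1) = real k - 1" using True by simp
      have "G (q (k - 1)) = real (k - 1) / m" using q[of "k - 1"] True km by simp
      also have "\<dots> < k / m" using True m0 by (simp add: k1 divide_strict_right_mono)
      finally have "G (q (k - 1)) < G x" using k' by simp
      then have "q (k - 1) \<le> x" using G(2) by (meson linorder_not_le monoD less_imp_le)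
      then have "F n (q (k - 1)) \<le> F n x" using F(1) by (auto dest: monoD)
      moreover have "real (k - 1) / m - 1 / m \<le> F n (q (k - 1))"
        using N[OF n km1] q[of "k - 1"] km1 True by (simp only: abs_less_iff) linarith
      moreover have "real (k - 1) / m - 1 / m = (real k + 1) / m - 3 / m"
        unfolding k1 by (simp add: diff_divide_distrib add_divide_distrib)
      moreover have "G x < (real k + 1) / m" using k' by (simp add: add.commute)
      ultimately show ?thesis by linarith
    next
      case False
      then have "(real k + 1) / m \<le> 3 / m" using m0 by (intro divide_right_mono) auto
      moreover have "G x < (real k + 1) / m" using k' by (simp add: add.commute)
      ultimately show ?thesis using F(2)[of n x] by linarith
    qed
    have "0 \<le> 1 / real m" "2 / real m \<le> 3 / m" by (auto simp: divide_right_mono)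
    with up low show ?thesis by (intro abs_leI) linarith+
  qed
  then show ?thesis using m3 by (intro exI[of _ N]) (auto intro: order_trans)
qed

text \<open>The exceptional sets are covered by measurable ones because the measure of a non-measurable set
  is 0 by convention.\<close>
definition tends_in_prob :: "(nat \<Rightarrow> 'w measure) \<Rightarrow> (nat \<Rightarrow> 'w \<Rightarrow> 'm::metric_space) \<Rightarrow> 'm \<Rightarrow> bool" where
  "tends_in_prob S V v \<longleftrightarrow> (\<forall>\<delta>>0. \<forall>\<epsilon>>0. \<exists>N. \<forall>n\<ge>N. \<exists>A\<in>sets (S n).
     measure (S n) A \<le> \<epsilon> \<and> (\<forall>\<omega>\<in>space (S n) - A. dist (V n \<omega>) v < \<delta>))"

lemma tends_in_probI:
  assumes "\<And>\<delta> \<epsilon>. 0 < \<delta> \<Longrightarrow> 0 < \<epsilon> \<Longrightarrow> \<exists>N. \<forall>n\<ge>N. \<exists>A\<in>sets (S n).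
     measure (S n) A \<le> \<epsilon> \<and> (\<forall>\<omega>\<in>space (S n) - A. dist (V n \<omega>) v < \<delta>)"
  shows "tends_in_prob S V v"
  using assms unfolding tends_in_prob_def by blast

lemma tends_in_prob_const: "tends_in_prob S (\<lambda>n \<omega>. v) v"
  unfolding tends_in_prob_def by (auto intro!: exI bexI[of _ "{}"])

lemma tends_in_prob_Pair:
  assumes S: "\<And>n. prob_space (S n)" and V: "tends_in_prob S V v" and W: "tends_in_prob S W w"
  shows "tends_in_prob S (\<lambda>n \<omega>. (V n \<omega>, W n \<omega>)) (v, w)"
proof (rule tends_in_probI)
  fix \<delta> \<epsilon> :: real assume "0 < \<delta>" "0 < \<epsilon>"
  then have p: "0 < \<delta> / 2" "0 < \<epsilon> / 2" by auto
  obtain N1 where N1: "\<And>n. n \<ge> N1 \<Longrightarrow> \<exists>A\<in>sets (S n).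
     measure (S n) A \<le> \<epsilon> / 2 \<and> (\<forall>\<omega>\<in>space (S n) - A. dist (V n \<omega>) v < \<delta> / 2)"
    using V p unfolding tends_in_prob_def by blast
  obtain N2 where N2: "\<And>n. n \<ge> N2 \<Longrightarrow> \<exists>A\<in>sets (S n).
     measure (S n) A \<le> \<epsilon> / 2 \<and> (\<forall>\<omega>\<in>space (S n) - A. dist (W n \<omega>) w < \<delta> / 2)"
    using W p unfolding tends_in_prob_def by blast
  show "\<exists>N. \<forall>n\<ge>N. \<exists>A\<in>sets (S n). measure (S n) A \<le> \<epsilon> \<and>
     (\<forall>\<omega>\<in>space (S n) - A. dist (V n \<omega>, W n \<omega>) (v, w) < \<delta>)"
  proof (intro exI[of _ "max N1 N2"] allI impI)
    fix n assume n: "max N1 N2 \<le> n"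
    interpret prob_space "S n" by (rule S)
    obtain A where A: "A \<in> sets (S n)" "measure (S n) A \<le> \<epsilon> / 2" "\<forall>\<omega>\<in>space (S n) - A. dist (V n \<omega>) v < \<delta> / 2"
      using N1[of n] n by auto
    obtain B where B: "B \<in> sets (S n)" "measure (S n) B \<le> \<epsilon> / 2" "\<forall>\<omega>\<in>space (S n) - B. dist (W n \<omega>) w < \<delta> / 2"
      using N2[of n] n by auto
    show "\<exists>A\<in>sets (S n). measure (S n) A \<le> \<epsilon> \<and> (\<forall>\<omega>\<in>space (S n) - A. dist (V n \<omega>, W n \<omega>) (v, w) < \<delta>)"
    proof (intro bexI[of _ "A \<union> B"] conjI ballI)
      show "measure (S n) (A \<union> B) \<le> \<epsilon>" using measure_Un_le[OF A(1) B(1)] A B by linarith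
      fix \<omega> assume "\<omega> \<in> space (S n) - (A \<union> B)"
      then have "dist (V n \<omega>) v < \<delta> / 2" "dist (W n \<omega>) w < \<delta> / 2" using A(3) B(3) by auto
      moreover have "dist (V n \<omega>, W n \<omega>) (v, w) \<le> dist (V n \<omega>) v + dist (W n \<omega>) w"
        unfolding dist_Pair_Pair by (rule sqrt_sum_squares_le_sum) auto
      ultimately show "dist (V n \<omega>, W n \<omega>) (v, w) < \<delta>" by simp
    qed (use A B in auto)
  qed
qed

lemma tends_in_prob_isCont:
  assumes V: "tends_in_prob S V v" and f: "isCont f v"
  shows "tends_in_prob S (\<lambda>n \<omega>. f (V n \<omega>)) (f v)"
proof (rule tends_in_probI)
  fix \<delta> \<epsilon> :: real assume p: "0 < \<delta>" "0 < \<epsilon>"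
  obtain d where d: "0 < d" "\<And>x. dist x v < d \<Longrightarrow> dist (f x) (f v) < \<delta>"
    using f p unfolding continuous_at_eps_delta by blast
  obtain N where N: "\<And>n. n \<ge> N \<Longrightarrow> \<exists>A\<in>sets (S n).
     measure (S n) A \<le> \<epsilon> \<and> (\<forall>\<omega>\<in>space (S n) - A. dist (V n \<omega>) v < d)"
    using V p d(1) unfolding tends_in_prob_def by blast
  show "\<exists>N. \<forall>n\<ge>N. \<exists>A\<in>sets (S n). measure (S n) A \<le> \<epsilon> \<and> (\<forall>\<omega>\<in>space (S n) - A. dist (f (V n \<omega>)) (f v) < \<delta>)"
    using N d(2) by (intro exI[of _ N]) blast
qed

lemma tends_in_prob_isCont2:
  assumes S: "\<And>n. prob_space (S n)" and V: "tends_in_prob S V v" "tends_in_prob S W w" and f: "isCont (\<lambda>(x, y). f x y) (v, w)"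
  shows "tends_in_prob S (\<lambda>n \<omega>. f (V n \<omega>) (W n \<omega>)) (f v w)"
  using tends_in_prob_isCont[OF tends_in_prob_Pair[OF assms(1-3)] f] by simp

lemma tends_in_prob_add:
  fixes v w :: real
  assumes "\<And>n. prob_space (S n)" "tends_in_prob S V v" "tends_in_prob S W w"
  shows "tends_in_prob S (\<lambda>n \<omega>. V n \<omega> + W n \<omega>) (v + w)"
  by (rule tends_in_prob_isCont2[OF assms]) (auto simp: case_prod_unfold intro!: continuous_intros)

lemma tends_in_prob_bound:
  fixes V W :: "nat \<Rightarrow> 'w \<Rightarrow> real"
  assumes W: "tends_in_prob S W 0" and le: "\<And>n \<omega>. \<omega> \<in> space (S n) \<Longrightarrow> \<bar>V n \<omega> - v\<bar> \<le> W n \<omega>"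
  shows "tends_in_prob S V v"
proof (rule tends_in_probI)
  fix \<delta> \<epsilon> :: real assume p: "0 < \<delta>" "0 < \<epsilon>"
  obtain N where N: "\<And>n. n \<ge> N \<Longrightarrow> \<exists>A\<in>sets (S n).
     measure (S n) A \<le> \<epsilon> \<and> (\<forall>\<omega>\<in>space (S n) - A. dist (W n \<omega>) 0 < \<delta>)"
    using W p unfolding tends_in_prob_def by blast
  have "dist (V n \<omega>) v < \<delta>" if "\<omega> \<in> space (S n)" "dist (W n \<omega>) 0 < \<delta>" for n \<omega>
    using le[OF that(1)] that(2) by (simp add: dist_real_def)
  then show "\<exists>N. \<forall>n\<ge>N. \<exists>A\<in>sets (S n). measure (S n) A \<le> \<epsilon> \<and> (\<forall>\<omega>\<in>space (S n) - A. dist (V n \<omega>) v < \<delta>)"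
    using N by (intro exI[of _ N]) blast
qed

text \<open>Where \<rho> is positive, T \<le> t means that X is at most t * \<rho> - r. Off a small
  event this random threshold is within \<delta> of t, so the event is squeezed between two events
  about X alone, and continuity of \<open>G\<close> closes the gap.\<close>

lemma slutsky_studentized:
  fixes X T r \<rho> :: "nat \<Rightarrow> 'w \<Rightarrow> real"
  assumes S: "\<And>n. prob_space (S n)"
    and X [measurable]: "\<And>n. X n \<in> borel_measurable (S n)" and T [measurable]: "\<And>n. T n \<in> borel_measurable (S n)"
    and r: "tends_in_prob S r 0" and \<rho>: "tends_in_prob S \<rho> 1"
    and T_eq: "\<And>n \<omega>. \<omega> \<in> space (S n) \<Longrightarrow> T n \<omega> = (X n \<omega> + r n \<omega>) / \<rho> n \<omega>"
    and lim: "\<And>x. (\<lambda>n. \<P>(\<omega> in S n. X n \<omega> \<le> x)) \<longlonglongrightarrow> G x" and G: "\<And>x. isCont G x"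
  shows "(\<lambda>n. \<P>(\<omega> in S n. T n \<omega> \<le> t)) \<longlonglongrightarrow> G t"
proof (rule LIMSEQ_I)
  fix \<epsilon> :: real assume \<epsilon>: "0 < \<epsilon>"
  obtain d where d: "0 < d" "\<And>x. dist x t < d \<Longrightarrow> dist (G x) (G t) < \<epsilon> / 3"
    using G[of t] \<epsilon> unfolding continuous_at_eps_delta by (metis divide_pos_pos zero_less_numeral)
  define \<delta> where "\<delta> = d / 2"
  have \<delta>: "0 < \<delta>" "\<bar>G (t + \<delta>) - G t\<bar> < \<epsilon> / 3" "\<bar>G (t - \<delta>) - G t\<bar> < \<epsilon> / 3"
    using d(1) d(2)[of "t + \<delta>"] d(2)[of "t - \<delta>"] by (auto simp: \<delta>_def dist_real_def)
  have "isCont (\<lambda>(x, y). (t * x - y, x)) (1, 0 :: real)"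
    by (auto simp: case_prod_unfold intro!: continuous_intros)
  from tends_in_prob_isCont2[OF S \<rho> r this]
  have tr: "tends_in_prob S (\<lambda>n \<omega>. (t * \<rho> n \<omega> - r n \<omega>, \<rho> n \<omega>)) (t, 1)" by simp
  \<comment> \<open>In the minimum, \<delta> controls the threshold, and a distance below 1 between
    \<rho> and 1 makes \<rho> positive.\<close>
  obtain N1 where N1: "\<And>n. n \<ge> N1 \<Longrightarrow> \<exists>A\<in>sets (S n). measure (S n) A \<le> \<epsilon> / 3 \<and>
     (\<forall>\<omega>\<in>space (S n) - A. dist (t * \<rho> n \<omega> - r n \<omega>, \<rho> n \<omega>) (t, 1) < min \<delta> 1)"
    using tr \<epsilon> \<delta>(1) unfolding tends_in_prob_def by (metis divide_pos_pos min_less_iff_conj zero_less_numeral zero_less_one)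
  obtain N2 where N2: "\<And>n. n \<ge> N2 \<Longrightarrow> \<bar>\<P>(\<omega> in S n. X n \<omega> \<le> t + \<delta>) - G (t + \<delta>)\<bar> < \<epsilon> / 3"
    using LIMSEQ_D[OF lim, of "\<epsilon> / 3" "t + \<delta>"] \<epsilon> by auto
  obtain N3 where N3: "\<And>n. n \<ge> N3 \<Longrightarrow> \<bar>\<P>(\<omega> in S n. X n \<omega> \<le> t - \<delta>) - G (t - \<delta>)\<bar> < \<epsilon> / 3"
    using LIMSEQ_D[OF lim, of "\<epsilon> / 3" "t - \<delta>"] \<epsilon> by auto
  show "\<exists>N. \<forall>n\<ge>N. norm (\<P>(\<omega> in S n. T n \<omega> \<le> t) - G t) < \<epsilon>"
  proof (intro exI[of _ "max N1 (max N2 N3)"] allI impI)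
    fix n assume n: "max N1 (max N2 N3) \<le> n"
    interpret prob_space "S n" by (rule S)
    obtain A where A: "A \<in> sets (S n)" "prob A \<le> \<epsilon> / 3"
      "\<And>\<omega>. \<omega> \<in> space (S n) - A \<Longrightarrow> dist (t * \<rho> n \<omega> - r n \<omega>, \<rho> n \<omega>) (t, 1) < min \<delta> 1"
      using N1[of n] n by auto
    have good: "\<bar>t * \<rho> n \<omega> - r n \<omega> - t\<bar> < \<delta>" "0 < \<rho> n \<omega>" if "\<omega> \<in> space (S n) - A" for \<omega>
    proof -
      have "dist (t * \<rho> n \<omega> - r n \<omega>) t < min \<delta> 1" "dist (\<rho> n \<omega>) 1 < min \<delta> 1"
        using order_le_less_trans[OF dist_fst_le A(3)[OF that]] order_le_less_trans[OF dist_snd_le A(3)[OF that]] by simp_all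
      then show "\<bar>t * \<rho> n \<omega> - r n \<omega> - t\<bar> < \<delta>" "0 < \<rho> n \<omega>" by (auto simp: dist_real_def)
    qed
    have T': "T n \<omega> \<le> t \<longleftrightarrow> X n \<omega> \<le> t * \<rho> n \<omega> - r n \<omega>" if "\<omega> \<in> space (S n) - A" for \<omega>
      using good(2)[OF that] T_eq[of \<omega> n] that by (auto simp: divide_le_eq le_diff_eq)
    have "\<P>(\<omega> in S n. T n \<omega> \<le> t) \<le> prob ({\<omega> \<in> space (S n). X n \<omega> \<le> t + \<delta>} \<union> A)"
      using T' good(1) A(1) by (intro finite_measure_mono) (fastforce, measurable)
    also have "\<dots> \<le> \<P>(\<omega> in S n. X n \<omega> \<le> t + \<delta>) + prob A"
      using A(1) by (intro measure_Un_le) measurable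
    finally have u: "\<P>(\<omega> in S n. T n \<omega> \<le> t) \<le> \<P>(\<omega> in S n. X n \<omega> \<le> t + \<delta>) + \<epsilon> / 3" using A(2) by simp
    have "\<P>(\<omega> in S n. X n \<omega> \<le> t - \<delta>) \<le> prob ({\<omega> \<in> space (S n). T n \<omega> \<le> t} \<union> A)"
      using T' good(1) A(1) by (intro finite_measure_mono) (fastforce, measurable)
    also have "\<dots> \<le> \<P>(\<omega> in S n. T n \<omega> \<le> t) + prob A"
      using A(1) by (intro measure_Un_le) measurable
    finally have l: "\<P>(\<omega> in S n. X n \<omega> \<le> t - \<delta>) \<le> \<P>(\<omega> in S n. T n \<omega> \<le> t) + \<epsilon> / 3" using A(2) by simp
    have x1: "\<bar>\<P>(\<omega> in S n. X n \<omega> \<le> t + \<delta>) - G (t + \<delta>)\<bar> < \<epsilon> / 3"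
      and x2: "\<bar>\<P>(\<omega> in S n. X n \<omega> \<le> t - \<delta>) - G (t - \<delta>)\<bar> < \<epsilon> / 3"
      using N2[of n] N3[of n] n by simp_all
    show "norm (\<P>(\<omega> in S n. T n \<omega> \<le> t) - G t) < \<epsilon>"
      unfolding real_norm_def using u l x1 x2 \<delta>(2,3) by linarith
  qed
qed

lemma Phi_props:
  shows "isCont Phi x" "mono Phi" "(Phi \<longlongrightarrow> 0) at_bot" "(Phi \<longlongrightarrow> 1) at_top"
proof -
  interpret N: real_distribution std_normal_distribution by (rule real_dist_normal_dist)
  have "emeasure std_normal_distribution {x} = 0"
    by (subst emeasure_density) (auto intro!: nn_integral_null_set simp: mult.commute)
  then show "isCont Phi x" unfolding Phi_def by (simp add: N.isCont_cdf measure_def)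
  show "mono Phi" unfolding Phi_def by (intro monoI N.cdf_nondecreasing)
  show "(Phi \<longlongrightarrow> 0) at_bot" unfolding Phi_def by (rule N.cdf_lim_at_bot)
  show "(Phi \<longlongrightarrow> 1) at_top" unfolding Phi_def by (rule N.cdf_lim_at_top_prob)
qed

section \<open>Moment identities for one residual given the other variable\<close>

context law
begin

text \<open>Finiteness is assumed only for the joint moment of the two residuals. Since the residual
  of \<open>U\<close> is almost surely nonzero, this forces a finite conditional moment of order
  \<open>p\<close> for the residual of \<open>V\<close>, hence a finite conditional second moment.
  \<open>U\<close> and \<open>V\<close> are kept abstract so that X and Y can exchange
  roles.\<close>

lemma cond_indep_residual:
  fixes U V :: "real \<times> real \<times> 'z \<Rightarrow> real" and f g v :: "'z \<Rightarrow> real" and p :: real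
  assumes ci: "cond_indep U V" and [measurable]: "U \<in> borel_measurable P" "V \<in> borel_measurable P"
    and [measurable]: "f \<in> borel_measurable borel" "g \<in> borel_measurable borel" "v \<in> borel_measurable borel"
    and g: "AE \<omega> in P. g (Zv \<omega>) = real_cond_exp P (sigmaZ P) V \<omega>"
    and v: "AE \<omega> in P. v (Zv \<omega>) = real_cond_exp P (sigmaZ P) (\<lambda>\<omega>. (V \<omega> - g (Zv \<omega>))\<^sup>2) \<omega>"
    and p: "2 \<le> p" and mom: "(\<integral>\<^sup>+\<omega>. ennreal (\<bar>(U \<omega> - f (Zv \<omega>)) * (V \<omega> - g (Zv \<omega>))\<bar> powr p) \<partial>P) < \<infinity>"
    and nz: "AE \<omega> in P. U \<omega> \<noteq> f (Zv \<omega>)"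
  shows "\<And>h. h \<in> borel_measurable borel \<Longrightarrow> integrable P (\<lambda>\<omega>. h (U \<omega>, Zv \<omega>) * (V \<omega> - g (Zv \<omega>))) \<Longrightarrow>
      (\<integral>\<omega>. h (U \<omega>, Zv \<omega>) * (V \<omega> - g (Zv \<omega>)) \<partial>P) = 0"
    and "\<And>\<phi>. \<phi> \<in> borel_measurable borel \<Longrightarrow>
      (\<integral>\<^sup>+\<omega>. \<phi> (U \<omega>, Zv \<omega>) * ennreal ((V \<omega> - g (Zv \<omega>))\<^sup>2) \<partial>P) = (\<integral>\<^sup>+\<omega>. \<phi> (U \<omega>, Zv \<omega>) * ennreal (v (Zv \<omega>)) \<partial>P)"
    and "AE \<omega> in P. 0 \<le> v (Zv \<omega>)"
proof -
  have [measurable]: "(\<lambda>q :: real \<times> 'z. fst q - g (snd q)) \<in> borel_measurable borel"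
    "(\<lambda>q :: real \<times> 'z. fst q - f (snd q)) \<in> borel_measurable borel"
    unfolding borel_prod[symmetric] by measurable
  have "AE \<omega> in P. ce (\<lambda>\<omega>. ennreal (\<bar>V \<omega> - g (Zv \<omega>)\<bar> powr p)) \<omega> < \<infinity>"
    using cond_indep_ce_finite[OF ci, of "\<lambda>q. ennreal (\<bar>fst q - f (snd q)\<bar> powr p)" "\<lambda>q. ennreal (\<bar>fst q - g (snd q)\<bar> powr p)"]
      mom nz by (simp add: abs_mult powr_mult ennreal_mult)
  then have fin: "AE \<omega> in P. ce (\<lambda>\<omega>. ennreal ((V \<omega> - g (Zv \<omega>))\<^sup>2)) \<omega> < \<infinity>"
  proof (rule ce_finite_mono)
    show "ennreal ((V \<omega> - g (Zv \<omega>))\<^sup>2) \<le> 1 + ennreal (\<bar>V \<omega> - g (Zv \<omega>)\<bar> powr p)" for \<omega>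
    proof -
      have "x\<^sup>2 \<le> 1 + \<bar>x\<bar> powr p" for x :: real
      proof (cases "\<bar>x\<bar> \<le> 1")
        case True
        then have "x\<^sup>2 \<le> 1" by (simp add: abs_square_le_1)
        then show ?thesis by (smt (verit) powr_ge_zero)
      next
        case False
        then have "\<bar>x\<bar> powr 2 \<le> \<bar>x\<bar> powr p" using p by (intro powr_mono) auto
        then show ?thesis using False by simp
      qed
      then show ?thesis by (metis ennreal_1 ennreal_leI ennreal_plus powr_ge_zero zero_le_one)
    qed
  qed auto
  show "(\<integral>\<omega>. h (U \<omega>, Zv \<omega>) * (V \<omega> - g (Zv \<omega>)) \<partial>P) = 0"
    if "h \<in> borel_measurable borel" "integrable P (\<lambda>\<omega>. h (U \<omega>, Zv \<omega>) * (V \<omega> - g (Zv \<omega>)))" for h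
    by (rule cond_indep_residual_integral_zero[OF ci _ _ _ g fin that(1) that(2)]) auto
  have ev: "AE \<omega> in P. ce (\<lambda>\<omega>. ennreal ((V \<omega> - g (Zv \<omega>))\<^sup>2)) \<omega> = ennreal (v (Zv \<omega>))"
  proof -
    have "AE \<omega> in P. ce (\<lambda>\<omega>. ennreal ((V \<omega> - g (Zv \<omega>))\<^sup>2)) \<omega>
        = ennreal (real_cond_exp P (sigmaZ P) (\<lambda>\<omega>. (V \<omega> - g (Zv \<omega>))\<^sup>2) \<omega>)"
      by (rule ce_enn2real_eq_real_cond_exp(1)[OF fin]) auto
    then show ?thesis using v by eventually_elim simp
  qed
  show "(\<integral>\<^sup>+\<omega>. \<phi> (U \<omega>, Zv \<omega>) * ennreal ((V \<omega> - g (Zv \<omega>))\<^sup>2) \<partial>P) = (\<integral>\<^sup>+\<omega>. \<phi> (U \<omega>, Zv \<omega>) * ennreal (v (Zv \<omega>)) \<partial>P)"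
    if [measurable]: "\<phi> \<in> borel_measurable borel" for \<phi>
  proof -
    have "(\<integral>\<^sup>+\<omega>. \<phi> (U \<omega>, Zv \<omega>) * ennreal ((V \<omega> - g (Zv \<omega>))\<^sup>2) \<partial>P)
      = (\<integral>\<^sup>+\<omega>. \<phi> (U \<omega>, Zv \<omega>) * ce (\<lambda>\<omega>. ennreal ((V \<omega> - g (Zv \<omega>))\<^sup>2)) \<omega> \<partial>P)"
      using cond_indep_intg[OF ci, of \<phi> "\<lambda>q. ennreal ((fst q - g (snd q))\<^sup>2)"] by simp
    also have "\<dots> = (\<integral>\<^sup>+\<omega>. \<phi> (U \<omega>, Zv \<omega>) * ennreal (v (Zv \<omega>)) \<partial>P)"
      using ev by (intro nn_integral_cong_AE, eventually_elim) simp
    finally show ?thesis .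
  qed
  show "AE \<omega> in P. 0 \<le> v (Zv \<omega>)"
  proof -
    have "AE \<omega> in P. 0 \<le> real_cond_exp P (sigmaZ P) (\<lambda>\<omega>. (V \<omega> - g (Zv \<omega>))\<^sup>2) \<omega>"
      by (rule ce_enn2real_eq_real_cond_exp(2)[OF fin]) auto
    then show ?thesis using v by eventually_elim simp
  qed
qed

end

text \<open>The regression error at observation i as a function of the pairs (response, covariate)
  alone, whichever response is regressed. In this form it can serve as the weight in the conditional
  second moment bound.\<close>

definition reg_error :: "(nat \<Rightarrow> (nat \<Rightarrow> real) \<Rightarrow> (nat \<Rightarrow> 'z::euclidean_space) \<Rightarrow> 'z \<Rightarrow> real) \<Rightarrow> ('z \<Rightarrow> real) \<Rightarrow> nat \<Rightarrow> nat \<Rightarrow> (nat \<Rightarrow> real \<times> 'z) \<Rightarrow> real" where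
  "reg_error reg f n i q = f (snd (q i)) - reg n (\<lambda>j\<in>{..<n}. fst (q j)) (\<lambda>j\<in>{..<n}. snd (q j)) (snd (q i))"

lemma snd_component_measurable:
  assumes "i < n"
  shows "(\<lambda>q. snd (q i)) \<in> borel_measurable (PiM {..<n} (\<lambda>_. borel :: (real \<times> 'z::euclidean_space) measure))"
proof -
  have 1: "(\<lambda>q. q i) \<in> measurable (PiM {..<n} (\<lambda>_. borel :: (real \<times> 'z) measure)) borel"
    using assms by (intro measurable_component_singleton) simp
  have 2: "snd \<in> borel_measurable (borel :: (real \<times> 'z) measure)" unfolding borel_prod[symmetric] by measurable
  show ?thesis by (rule measurable_compose[OF 1 2])
qed

lemma reg_error_measurable [measurable]:
  fixes reg :: "nat \<Rightarrow> (nat \<Rightarrow> real) \<Rightarrow> (nat \<Rightarrow> 'z::euclidean_space) \<Rightarrow> 'z \<Rightarrow> real"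
  assumes reg: "regression_method reg" and [measurable]: "f \<in> borel_measurable borel" and i: "i < n"
  shows "reg_error reg f n i \<in> borel_measurable (PiM {..<n} (\<lambda>_. borel))"
proof -
  have [measurable]: "(\<lambda>q. q j) \<in> measurable (PiM {..<n} (\<lambda>_. borel :: (real \<times> 'z) measure)) borel" if "j \<in> {..<n}" for j
    using that by (rule measurable_component_singleton)
  have f1 [measurable]: "fst \<in> borel_measurable (borel :: (real \<times> 'z) measure)"
   and f2 [measurable]: "snd \<in> borel_measurable (borel :: (real \<times> 'z) measure)"
    unfolding borel_prod[symmetric] by measurable
  let ?q = "\<lambda>q :: nat \<Rightarrow> real \<times> 'z. (\<lambda>j\<in>{..<n}. fst (q j), \<lambda>j\<in>{..<n}. snd (q j), snd (q i))"
  have 1: "?q \<in> measurable (PiM {..<n} (\<lambda>_. borel)) (PiM {..<n} (\<lambda>_. borel) \<Otimes>\<^sub>M PiM {..<n} (\<lambda>_. borel) \<Otimes>\<^sub>M borel)"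
    using i by (intro measurable_Pair measurable_restrict) (auto intro!: measurable_compose[OF _ f1] measurable_compose[OF _ f2])
  have 2: "(\<lambda>(r, zs, z). reg n r zs z) \<in> borel_measurable (PiM {..<n} (\<lambda>_. (borel :: real measure)) \<Otimes>\<^sub>M PiM {..<n} (\<lambda>_. (borel :: 'z measure)) \<Otimes>\<^sub>M borel)"
    using reg unfolding regression_method_def by blast
  have "(\<lambda>q. reg n (\<lambda>j\<in>{..<n}. fst (q j)) (\<lambda>j\<in>{..<n}. snd (q j)) (snd (q i))) \<in> borel_measurable (PiM {..<n} (\<lambda>_. borel))"
    using measurable_compose[OF 1 2] by simp
  moreover have "(\<lambda>q. f (snd (q i))) \<in> borel_measurable (PiM {..<n} (\<lambda>_. borel :: (real \<times> 'z) measure))"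
    using i by (intro measurable_compose[OF _ assms(2)] snd_component_measurable)
  ultimately show ?thesis unfolding reg_error_def[abs_def] by (rule borel_measurable_diff[rotated])
qed

definition data :: "nat \<Rightarrow> (real \<times> real \<times> 'z \<Rightarrow> real) \<Rightarrow> (nat \<Rightarrow> real \<times> real \<times> 'z) \<Rightarrow> nat \<Rightarrow> real \<times> 'z" where
  "data n U \<omega> = (\<lambda>j\<in>{..<n}. (U (\<omega> j), Zv (\<omega> j)))"

lemma reg_error_data:
  assumes "i < n"
  shows "reg_error reg f n i (data n Xv \<omega>) = f (Zv (\<omega> i)) - fhat reg n \<omega> (Zv (\<omega> i))"
    and "reg_error reg f n i (data n Yv \<omega>) = f (Zv (\<omega> i)) - ghat reg n \<omega> (Zv (\<omega> i))"
  using assms by (auto simp: reg_error_def data_def fhat_def ghat_def cong: restrict_cong)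

context law
begin

lemma sampleP_prob: "prob_space (sampleP P n)"
  unfolding sampleP_def by (rule prob_space_PiM) (rule prob_space_axioms)

lemma component_sampleP [measurable]: "i < n \<Longrightarrow> (\<lambda>\<omega>. \<omega> i) \<in> measurable (sampleP P n) P"
  unfolding sampleP_def by (rule measurable_component_singleton) simp

lemma data_measurable [measurable]:
  assumes [measurable]: "U \<in> borel_measurable P"
  shows "data n U \<in> measurable (sampleP P n) (PiM {..<n} (\<lambda>_. borel))"
  unfolding data_def[abs_def]
proof (rule measurable_restrict)
  fix i assume "i \<in> {..<n}"
  then have "(\<lambda>\<omega>. \<omega> i) \<in> measurable (sampleP P n) P" by (intro component_sampleP) simp
  moreover have "(\<lambda>y. (U y, Zv y)) \<in> measurable P borel" by measurable
  ultimately show "(\<lambda>\<omega>. (U (\<omega> i), Zv (\<omega> i))) \<in> measurable (sampleP P n) borel"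
    by (rule measurable_compose)
qed

text \<open>The event on which the weighted regression error is at most \<open>\<kappa>\<close> is determined by the data the
  residuals are conditioned on, so it can be absorbed into the weights.\<close>
lemma weighted_residual_tail:
  fixes D :: "nat \<Rightarrow> (nat \<Rightarrow> real \<times> 'z) \<Rightarrow> real" and U r :: "real \<times> real \<times> 'z \<Rightarrow> real" and v W :: "'z \<Rightarrow> real"
  assumes [measurable]: "U \<in> borel_measurable P" "r \<in> borel_measurable P" "v \<in> borel_measurable borel" "W \<in> borel_measurable borel"
    and D: "\<And>i. i < n \<Longrightarrow> D i \<in> borel_measurable (PiM {..<n} (\<lambda>_. borel))"
    and zero: "\<And>h. h \<in> borel_measurable borel \<Longrightarrow> integrable P (\<lambda>\<omega>. h (U \<omega>, Zv \<omega>) * r \<omega>) \<Longrightarrow> (\<integral>\<omega>. h (U \<omega>, Zv \<omega>) * r \<omega> \<partial>P) = 0"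
    and var: "\<And>\<phi>. \<phi> \<in> borel_measurable borel \<Longrightarrow>
      (\<integral>\<^sup>+\<omega>. \<phi> (U \<omega>, Zv \<omega>) * ennreal ((r \<omega>)\<^sup>2) \<partial>P) = (\<integral>\<^sup>+\<omega>. \<phi> (U \<omega>, Zv \<omega>) * ennreal (v (Zv \<omega>)) \<partial>P)"
    and v: "AE \<omega> in P. 0 \<le> v (Zv \<omega>)"
    and W: "\<And>z. \<bar>W z\<bar> \<le> L" and \<kappa>: "0 \<le> \<kappa>" and \<delta>: "0 < \<delta>" and n: "0 < n"
  defines "d \<equiv> \<lambda>i \<omega>. D i (data n U \<omega>)"
  defines "E \<equiv> \<lambda>\<omega>. 1 / n * (\<Sum>i<n. (d i \<omega>)\<^sup>2 * v (Zv (\<omega> i))) \<le> \<kappa>"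
  shows "\<P>(\<omega> in sampleP P n. E \<omega> \<and> \<delta> \<le> \<bar>(\<Sum>i<n. d i \<omega> * W (Zv (\<omega> i)) * r (\<omega> i)) / sqrt n\<bar>) \<le> L\<^sup>2 * \<kappa> / \<delta>\<^sup>2"
    and "\<P>(\<omega> in sampleP P n. E \<omega> \<and> \<delta> \<le> (\<Sum>i<n. (d i \<omega> * W (Zv (\<omega> i)) * r (\<omega> i))\<^sup>2) / n) \<le> L\<^sup>2 * \<kappa> / \<delta>"
proof -
  interpret \<Pi>: prob_space "sampleP P n" by (rule sampleP_prob)
  define Eq where "Eq q \<longleftrightarrow> 1 / n * (\<Sum>i<n. (D i q)\<^sup>2 * v (snd (q i))) \<le> \<kappa>" for q
  define K where "K i q = D i q * W (snd (q i)) * (if Eq q then 1 else 0)" for i q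
  have [measurable]: "(\<lambda>q. v (snd (q i))) \<in> borel_measurable (PiM {..<n} (\<lambda>_. borel :: (real \<times> 'z) measure))"
     "(\<lambda>q. W (snd (q i))) \<in> borel_measurable (PiM {..<n} (\<lambda>_. borel :: (real \<times> 'z) measure))" if "i < n" for i
    using that by (auto intro: measurable_compose[OF snd_component_measurable])
  note D [measurable]
  have Eq_meas [measurable]: "Measurable.pred (PiM {..<n} (\<lambda>_. borel)) Eq"
    unfolding Eq_def by measurable
  have K: "K i \<in> borel_measurable (PiM {..<n} (\<lambda>_. borel))" if "i \<in> {..<n}" for i
  proof -
    have [measurable]: "(\<lambda>q. W (snd (q i))) \<in> borel_measurable (PiM {..<n} (\<lambda>_. borel :: (real \<times> 'z) measure))"
      "D i \<in> borel_measurable (PiM {..<n} (\<lambda>_. borel))"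
      using that D by (auto intro: measurable_compose[OF snd_component_measurable])
    show ?thesis unfolding K_def[abs_def] by measurable
  qed
  have Kd: "K i (data n U \<omega>) = d i \<omega> * W (Zv (\<omega> i)) * (if E \<omega> then 1 else 0)" if "i < n" for i \<omega>
  proof -
    have s: "snd (data n U \<omega> j) = Zv (\<omega> j)" if "j < n" for j using that by (simp add: data_def)
    then have "(\<Sum>i<n. (D i (data n U \<omega>))\<^sup>2 * v (snd (data n U \<omega> i))) = (\<Sum>i<n. (D i (data n U \<omega>))\<^sup>2 * v (Zv (\<omega> i)))"
      by (intro sum.cong) auto
    then have "Eq (data n U \<omega>) \<longleftrightarrow> E \<omega>" unfolding Eq_def E_def d_def by simp
    then show ?thesis using s[OF that] by (simp add: K_def d_def)
  qed
  have vI: "AE \<omega> in sampleP P n. \<forall>i\<in>{..<n}. 0 \<le> v (Zv (\<omega> i))"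
    unfolding sampleP_def using v by (intro eventually_ball_finite ballI AE_PiM_component prob_space_axioms) auto
  have L: "0 \<le> L" using W[of undefined] by linarith
  have bnd: "AE \<omega> in sampleP P n. (\<Sum>i<n. (K i (data n U \<omega>))\<^sup>2 * v (Zv (\<omega> i))) \<le> n * (L\<^sup>2 * \<kappa>)"
    using vI
  proof eventually_elim
    case (elim \<omega>)
    show ?case
    proof (cases "E \<omega>")
      case True
      have "(\<Sum>i<n. (K i (data n U \<omega>))\<^sup>2 * v (Zv (\<omega> i))) = (\<Sum>i<n. (W (Zv (\<omega> i)))\<^sup>2 * ((d i \<omega>)\<^sup>2 * v (Zv (\<omega> i))))"
        using True by (intro sum.cong) (auto simp: Kd power_mult_distrib mult_ac)
      also have "\<dots> \<le> (\<Sum>i<n. L\<^sup>2 * ((d i \<omega>)\<^sup>2 * v (Zv (\<omega> i))))"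
        using elim W L by (intro sum_mono mult_right_mono) (auto simp: power2_le_iff_abs_le)
      also have "\<dots> = n * (L\<^sup>2 * (1 / n * (\<Sum>i<n. (d i \<omega>)\<^sup>2 * v (Zv (\<omega> i)))))"
        using n by (simp add: sum_distrib_left)
      also have "\<dots> \<le> n * (L\<^sup>2 * \<kappa>)"
        using True unfolding E_def by (intro mult_left_mono) auto
      finally show ?thesis .
    next
      case False
      then have "(\<Sum>i<n. (K i (data n U \<omega>))\<^sup>2 * v (Zv (\<omega> i))) = 0" by (simp add: Kd)
      then show ?thesis using \<kappa> by simp
    qed
  qed
  have Q: "(\<lambda>y. (U y, Zv y)) \<in> measurable P borel" by measurable
  have vm: "(\<lambda>y. v (Zv y)) \<in> borel_measurable P" by measurable
  have nB: "0 \<le> n * (L\<^sup>2 * \<kappa>)" using \<kappa> by simp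
  note sm = PiM_conditional_second_moment[where N=borel and Q="\<lambda>y. (U y, Zv y)" and s="\<lambda>y. v (Zv y)" and r=r
      and B="n * (L\<^sup>2 * \<kappa>)", OF Q finite_lessThan K assms(2) vm _ _ v bnd[unfolded sampleP_def data_def] nB,
      folded sampleP_def data_def, OF _ zero var, simplified]
  have rew: "K i (data n U \<omega>) * r (\<omega> i) = (if E \<omega> then d i \<omega> * W (Zv (\<omega> i)) * r (\<omega> i) else 0)" if "i < n" for i \<omega>
    using Kd[OF that] by simp
  have s1: "(\<Sum>i<n. K i (data n U \<omega>) * r (\<omega> i)) = (if E \<omega> then \<Sum>i<n. d i \<omega> * W (Zv (\<omega> i)) * r (\<omega> i) else 0)" for \<omega>
  proof -
    have "(\<Sum>i<n. K i (data n U \<omega>) * r (\<omega> i)) = (\<Sum>i<n. if E \<omega> then d i \<omega> * W (Zv (\<omega> i)) * r (\<omega> i) else 0)"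
      by (intro sum.cong refl) (simp only: lessThan_iff rew)
    then show ?thesis by (cases "E \<omega>") simp_all
  qed
  have s2: "(\<Sum>i<n. (K i (data n U \<omega>) * r (\<omega> i))\<^sup>2) = (if E \<omega> then \<Sum>i<n. (d i \<omega> * W (Zv (\<omega> i)) * r (\<omega> i))\<^sup>2 else 0)" for \<omega>
  proof -
    have "(\<Sum>i<n. (K i (data n U \<omega>) * r (\<omega> i))\<^sup>2) = (\<Sum>i<n. (if E \<omega> then d i \<omega> * W (Zv (\<omega> i)) * r (\<omega> i) else 0)\<^sup>2)"
      by (intro sum.cong refl) (simp only: lessThan_iff rew)
    then show ?thesis by (cases "E \<omega>") simp_all
  qed
  have km [measurable]: "(\<lambda>\<omega>. K i (data n U \<omega>)) \<in> borel_measurable (sampleP P n)" if "i < n" for i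
    using K[of i] that by (intro measurable_compose[OF data_measurable]) auto
  have rm [measurable]: "(\<lambda>\<omega>. r (\<omega> i)) \<in> borel_measurable (sampleP P n)" if "i < n" for i
    using that by measurable
  have n': "0 < sqrt n" using n by simp
  then have np: "\<not> \<delta> * sqrt n \<le> 0" "\<not> \<delta> * n \<le> 0" using n \<delta> by (simp_all add: not_le)
  \<comment> \<open>Off \<open>E\<close> the sum with absorbed indicator is 0, which lies below the
    positive threshold, so the two events coincide.\<close>
  have "\<P>(\<omega> in sampleP P n. E \<omega> \<and> \<delta> \<le> \<bar>(\<Sum>i<n. d i \<omega> * W (Zv (\<omega> i)) * r (\<omega> i)) / sqrt n\<bar>)
    = \<P>(\<omega> in sampleP P n. \<delta> * sqrt n \<le> \<bar>\<Sum>i<n. K i (data n U \<omega>) * r (\<omega> i)\<bar>)"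
    unfolding s1 using n' np by (intro arg_cong[where f="measure _"]) (auto simp: pos_le_divide_eq split: if_splits)
  also have "\<dots> \<le> \<Pi>.expectation (\<lambda>\<omega>. (\<Sum>i<n. K i (data n U \<omega>) * r (\<omega> i))\<^sup>2) / (\<delta> * sqrt n)\<^sup>2"
    by (rule \<Pi>.second_moment_method) (use sm(3) n' \<delta> in auto)
  also have "\<dots> \<le> n * (L\<^sup>2 * \<kappa>) / (\<delta> * sqrt n)\<^sup>2"
    by (rule divide_right_mono) (use sm(4) in auto)
  also have "\<dots> = L\<^sup>2 * \<kappa> / \<delta>\<^sup>2" using n by (simp add: power_mult_distrib)
  finally show "\<P>(\<omega> in sampleP P n. E \<omega> \<and> \<delta> \<le> \<bar>(\<Sum>i<n. d i \<omega> * W (Zv (\<omega> i)) * r (\<omega> i)) / sqrt n\<bar>) \<le> L\<^sup>2 * \<kappa> / \<delta>\<^sup>2" .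
  have "\<P>(\<omega> in sampleP P n. E \<omega> \<and> \<delta> \<le> (\<Sum>i<n. (d i \<omega> * W (Zv (\<omega> i)) * r (\<omega> i))\<^sup>2) / n)
    = \<P>(\<omega> in sampleP P n. \<delta> * n \<le> (\<Sum>i<n. (K i (data n U \<omega>) * r (\<omega> i))\<^sup>2))"
    unfolding s2 using n np by (intro arg_cong[where f="measure _"]) (auto simp: pos_le_divide_eq not_le split: if_splits)
  also have "\<dots> \<le> \<Pi>.expectation (\<lambda>\<omega>. \<Sum>i<n. (K i (data n U \<omega>) * r (\<omega> i))\<^sup>2) / (\<delta> * n)"
    by (rule integral_Markov_inequality_measure[where A="{}"]) (use sm(1) n \<delta> in \<open>auto intro!: AE_I2 sum_nonneg\<close>)
  also have "\<dots> \<le> n * (L\<^sup>2 * \<kappa>) / (\<delta> * n)"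
    by (rule divide_right_mono) (use sm(2) \<delta> in auto)
  also have "\<dots> = L\<^sup>2 * \<kappa> / \<delta>" using n by simp
  finally show "\<P>(\<omega> in sampleP P n. E \<omega> \<and> \<delta> \<le> (\<Sum>i<n. (d i \<omega> * W (Zv (\<omega> i)) * r (\<omega> i))\<^sup>2) / n) \<le> L\<^sup>2 * \<kappa> / \<delta>" .
qed

end

section \<open>Remainder terms\<close>

text \<open>Reverse triangle inequality for \<open>L2_set\<close>, rescaled by
  \<open>sqrt n\<close>.\<close>

lemma rms_perturbation:
  fixes a b e d :: "nat \<Rightarrow> real"
  shows "\<bar>sqrt ((\<Sum>i<n. (a i + b i + e i + d i)\<^sup>2) / n) - sqrt ((\<Sum>i<n. (a i)\<^sup>2) / n)\<bar>
    \<le> sqrt ((\<Sum>i<n. (b i)\<^sup>2) / n) + sqrt ((\<Sum>i<n. (e i)\<^sup>2) / n) + sqrt ((\<Sum>i<n. (d i)\<^sup>2) / n)"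
proof -
  let ?l = "\<lambda>f. L2_set f {..<n}"
  have l: "sqrt ((\<Sum>i<n. (f i)\<^sup>2) / n) = ?l f / sqrt n" for f by (simp add: L2_set_def real_sqrt_divide)
  have t: "?l (\<lambda>i. f i + g i) \<le> ?l f + ?l g" for f g by (rule L2_set_triangle_ineq)
  have m: "?l (\<lambda>i. - f i) = ?l f" for f by (simp add: L2_set_def)
  have "?l (\<lambda>i. a i + b i + e i + d i) \<le> ?l a + (?l b + ?l e + ?l d)"
    using t[of "\<lambda>i. a i + b i + e i" d] t[of "\<lambda>i. a i + b i" e] t[of a b] by simp
  moreover have "?l (\<lambda>i. (a i + b i + e i + d i) + - d i + - e i + - b i) \<le> ?l (\<lambda>i. a i + b i + e i + d i) + (?l b + ?l e + ?l d)"
    using t[of "\<lambda>i. (a i + b i + e i + d i) + - d i + - e i" "\<lambda>i. - b i"] t[of "\<lambda>i. (a i + b i + e i + d i) + - d i" "\<lambda>i. - e i"]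
      t[of "\<lambda>i. a i + b i + e i + d i" "\<lambda>i. - d i"] unfolding m by linarith
  ultimately have "\<bar>?l (\<lambda>i. a i + b i + e i + d i) - ?l a\<bar> \<le> ?l b + ?l e + ?l d" by (simp add: abs_le_iff)
  then have "\<bar>?l (\<lambda>i. a i + b i + e i + d i) - ?l a\<bar> / sqrt n \<le> (?l b + ?l e + ?l d) / sqrt n"
    by (intro divide_right_mono) auto
  then show ?thesis unfolding l by (simp add: add_divide_distrib flip: diff_divide_distrib)
qed

text \<open>\<open>q\<close> has the shape of the quotient of the product of \<open>A_f\<close> and
  \<open>A_g\<close> by the rate 1 / n. The first bound is Cauchy-Schwarz; the second uses that a
  single square is at most the sum of all of them. Thus numerator and denominator contributions of
  the product term are governed by the same quantity.\<close>

lemma weighted_product_bounds: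
  fixes x y w :: "nat \<Rightarrow> real"
  assumes w: "\<And>i. \<bar>w i\<bar> \<le> L" and n: "0 < n"
  defines "q \<equiv> (1 / n * (\<Sum>i<n. (x i)\<^sup>2)) * (1 / n * (\<Sum>i<n. (y i)\<^sup>2)) / (1 / real n)"
  shows "\<bar>(\<Sum>i<n. x i * y i * w i) / sqrt n\<bar> \<le> L * sqrt q"
    and "sqrt ((\<Sum>i<n. (x i * y i * w i)\<^sup>2) / n) \<le> L * sqrt q"
proof -
  define A B where "A = (\<Sum>i<n. (x i)\<^sup>2)" and "B = (\<Sum>i<n. (y i)\<^sup>2)"
  have AB: "0 \<le> A" "0 \<le> B" by (auto simp: A_def B_def sum_nonneg)
  have L: "0 \<le> L" using w[of 0] by linarith
  have q: "q = A * B / n" using n by (simp add: q_def A_def B_def field_simps)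
  have "\<bar>\<Sum>i<n. x i * y i * w i\<bar> \<le> (\<Sum>i<n. \<bar>x i * y i * w i\<bar>)" by (rule sum_abs)
  also have "\<dots> \<le> (\<Sum>i<n. L * (\<bar>x i\<bar> * \<bar>y i\<bar>))"
    using w by (intro sum_mono) (simp add: abs_mult mult.commute[of L] mult_left_mono)
  also have "\<dots> = L * (\<Sum>i<n. \<bar>x i\<bar> * \<bar>y i\<bar>)" by (simp add: sum_distrib_left)
  also have "\<dots> \<le> L * (L2_set x {..<n} * L2_set y {..<n})"
    using L by (intro mult_left_mono L2_set_mult_ineq)
  also have "\<dots> = L * sqrt (A * B)" by (simp add: L2_set_def A_def B_def real_sqrt_mult)
  finally have "\<bar>\<Sum>i<n. x i * y i * w i\<bar> / sqrt n \<le> L * sqrt (A * B) / sqrt n" by (intro divide_right_mono) auto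
  then show "\<bar>(\<Sum>i<n. x i * y i * w i) / sqrt n\<bar> \<le> L * sqrt q"
    by (simp add: q real_sqrt_divide)
  have "(\<Sum>i<n. (x i * y i * w i)\<^sup>2) \<le> (\<Sum>i<n. (x i)\<^sup>2 * (B * L\<^sup>2))"
  proof (rule sum_mono)
    fix i assume i: "i \<in> {..<n}"
    have "(y i)\<^sup>2 \<le> B" unfolding B_def by (rule member_le_sum) (use i in auto)
    moreover have "(w i)\<^sup>2 \<le> L\<^sup>2" using w L by (simp add: power2_le_iff_abs_le)
    ultimately have "(x i)\<^sup>2 * ((y i)\<^sup>2 * (w i)\<^sup>2) \<le> (x i)\<^sup>2 * (B * L\<^sup>2)"
      using AB by (intro mult_left_mono mult_mono) auto
    then show "(x i * y i * w i)\<^sup>2 \<le> (x i)\<^sup>2 * (B * L\<^sup>2)" by (simp add: power_mult_distrib mult_ac)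
  qed
  also have "\<dots> = L\<^sup>2 * (A * B)" by (simp add: A_def sum_distrib_left mult_ac)
  finally have "sqrt ((\<Sum>i<n. (x i * y i * w i)\<^sup>2) / n) \<le> sqrt (L\<^sup>2 * (A * B) / n)"
    by (intro real_sqrt_le_mono divide_right_mono) auto
  also have "\<dots> = L * sqrt q" using L by (simp add: q real_sqrt_mult real_sqrt_divide)
  finally show "sqrt ((\<Sum>i<n. (x i * y i * w i)\<^sup>2) / n) \<le> L * sqrt q" .
qed

text \<open>Studentisation cancels positive constants in the weight. This permits dividing the
  weight by the standard deviation of the residual product, although the statistic itself does not
  involve that number.\<close>

lemma T_w_scale:
  assumes "0 < s"
  shows "T_w regX regY (\<lambda>z. w z / s) n \<omega> = T_w regX regY w n \<omega>"
proof -
  have R: "R_w regX regY (\<lambda>z. w z / s) n \<omega> i = R_w regX regY w n \<omega> i / s" for i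
    by (simp add: R_w_def)
  define m v where "m = (\<Sum>i<n. R_w regX regY w n \<omega> i)" and "v = (\<Sum>i<n. (R_w regX regY w n \<omega> i)\<^sup>2)"
  have "T_w regX regY (\<lambda>z. w z / s) n \<omega> = (1 / sqrt n * (m / s)) / sqrt (1 / n * (v / s\<^sup>2) - (1 / n * (m / s))\<^sup>2)"
    unfolding T_w_def R m_def v_def by (simp add: sum_divide_distrib power_divide)
  also have "1 / n * (v / s\<^sup>2) - (1 / n * (m / s))\<^sup>2 = (1 / n * v - (1 / n * m)\<^sup>2) / s\<^sup>2"
    by (simp add: diff_divide_distrib power_divide power_mult_distrib)
  also have "sqrt \<dots> = sqrt (1 / n * v - (1 / n * m)\<^sup>2) / s"
    using assms by (simp add: real_sqrt_divide)
  also have "(1 / sqrt n * (m / s)) / (sqrt (1 / n * v - (1 / n * m)\<^sup>2) / s) = (1 / sqrt n * m) / sqrt (1 / n * v - (1 / n * m)\<^sup>2)"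
    using assms by simp
  also have "\<dots> = T_w regX regY w n \<omega>" unfolding T_w_def m_def v_def ..
  finally show ?thesis .
qed

text \<open>Passage from the class to one sequence of laws. Halving \<delta> turns the weak
  inequality that holds off the exceptional event into the strict one required there.\<close>

lemma o_unif_tends_in_prob:
  assumes o: "o_unif \<P> V W" and P: "\<And>n. P n \<in> \<P>"
    and [measurable]: "\<And>n. V (P n) n \<in> borel_measurable (sampleP (P n) n)"
  shows "tends_in_prob (\<lambda>n. sampleP (P n) n) (\<lambda>n \<omega>. V (P n) n \<omega> / W n) 0"
proof (rule tends_in_probI)
  fix \<delta> \<epsilon> :: real assume p: "0 < \<delta>" "0 < \<epsilon>"
  then have "0 < \<delta> / 2" by simp
  with o p(2) obtain N where N: "\<And>n Q. n \<ge> N \<Longrightarrow> Q \<in> \<P> \<Longrightarrow>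
      measure (sampleP Q n) {\<omega> \<in> space (sampleP Q n). \<bar>V Q n \<omega> / W n\<bar> > \<delta> / 2} \<le> \<epsilon>"
    unfolding o_unif_def by meson
  show "\<exists>N. \<forall>n\<ge>N. \<exists>A\<in>sets (sampleP (P n) n). measure (sampleP (P n) n) A \<le> \<epsilon> \<and>
      (\<forall>\<omega>\<in>space (sampleP (P n) n) - A. dist (V (P n) n \<omega> / W n) 0 < \<delta>)"
  proof (intro exI[of _ N] allI impI)
    fix n assume n: "N \<le> n"
    show "\<exists>A\<in>sets (sampleP (P n) n). measure (sampleP (P n) n) A \<le> \<epsilon> \<and>
      (\<forall>\<omega>\<in>space (sampleP (P n) n) - A. dist (V (P n) n \<omega> / W n) 0 < \<delta>)"
    proof (rule bexI[where x="{\<omega> \<in> space (sampleP (P n) n). \<bar>V (P n) n \<omega> / W n\<bar> > \<delta> / 2}"], intro conjI ballI)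
      fix \<omega> assume "\<omega> \<in> space (sampleP (P n) n) - {\<omega> \<in> space (sampleP (P n) n). \<bar>V (P n) n \<omega> / W n\<bar> > \<delta> / 2}"
      then have "\<bar>V (P n) n \<omega> / W n\<bar> \<le> \<delta> / 2" by (metis (mono_tags, lifting) DiffD1 DiffD2 mem_Collect_eq not_le)
      also have "\<dots> < \<delta>" using p by simp
      finally show "dist (V (P n) n \<omega> / W n) 0 < \<delta>" by (simp only: dist_real_def diff_0_right)
    qed (use N[OF n P] in auto)
  qed
qed

text \<open>The tail of \<open>V\<close> is at most the probability that \<open>B\<close> exceeds
  \<kappa> plus a term linear in \<kappa>; \<kappa> is fixed before n grows.\<close>

lemma tends_in_prob_tail:
  fixes V :: "nat \<Rightarrow> 'w \<Rightarrow> real" and B :: "nat \<Rightarrow> 'w \<Rightarrow> real"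
  assumes B: "tends_in_prob S B 0"
    and V [measurable]: "\<And>n. V n \<in> borel_measurable (S n)" and Bm [measurable]: "\<And>n. B n \<in> borel_measurable (S n)"
    and tail: "\<And>\<delta>. 0 < \<delta> \<Longrightarrow> \<exists>k\<ge>0. \<forall>\<kappa> n. 0 \<le> \<kappa> \<longrightarrow> 0 < n \<longrightarrow> \<P>(\<omega> in S n. B n \<omega> \<le> \<kappa> \<and> \<delta> \<le> \<bar>V n \<omega>\<bar>) \<le> k * \<kappa>"
  shows "tends_in_prob S V 0"
proof (rule tends_in_probI)
  fix \<delta> \<epsilon> :: real assume p: "0 < \<delta>" "0 < \<epsilon>"
  obtain k where k: "0 \<le> k" "\<And>\<kappa> n. 0 \<le> \<kappa> \<Longrightarrow> 0 < n \<Longrightarrow> \<P>(\<omega> in S n. B n \<omega> \<le> \<kappa> \<and> \<delta> \<le> \<bar>V n \<omega>\<bar>) \<le> k * \<kappa>"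
    using tail[OF p(1)] by blast
  \<comment> \<open>Adding 1 to \<open>k\<close> keeps the denominator positive when
    \<open>k\<close> is 0.\<close>
  define \<kappa> where "\<kappa> = \<epsilon> / (2 * (k + 1))"
  have \<kappa>: "0 < \<kappa>" "k * \<kappa> \<le> \<epsilon> / 2" using p k(1) by (auto simp: \<kappa>_def field_simps)
  obtain N where N: "\<And>n. n \<ge> N \<Longrightarrow> \<exists>A\<in>sets (S n). measure (S n) A \<le> \<epsilon> / 2 \<and> (\<forall>\<omega>\<in>space (S n) - A. dist (B n \<omega>) 0 < \<kappa>)"
    using B \<kappa>(1) p unfolding tends_in_prob_def by (meson half_gt_zero)
  show "\<exists>N. \<forall>n\<ge>N. \<exists>A\<in>sets (S n). measure (S n) A \<le> \<epsilon> \<and> (\<forall>\<omega>\<in>space (S n) - A. dist (V n \<omega>) 0 < \<delta>)"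
  proof (intro exI[of _ "max N 1"] allI impI)
    fix n assume n: "max N 1 \<le> n"
    obtain A where A: "A \<in> sets (S n)" "measure (S n) A \<le> \<epsilon> / 2" "\<And>\<omega>. \<omega> \<in> space (S n) - A \<Longrightarrow> dist (B n \<omega>) 0 < \<kappa>"
      using N[of n] n by auto
    let ?E = "{\<omega> \<in> space (S n). B n \<omega> \<le> \<kappa> \<and> \<delta> \<le> \<bar>V n \<omega>\<bar>}"
    have E: "?E \<in> sets (S n)" by measurable
    show "\<exists>A\<in>sets (S n). measure (S n) A \<le> \<epsilon> \<and> (\<forall>\<omega>\<in>space (S n) - A. dist (V n \<omega>) 0 < \<delta>)"
    proof (intro bexI[of _ "A \<union> ?E"] conjI ballI)
      have "measure (S n) (A \<union> ?E) \<le> measure (S n) A + measure (S n) ?E" by (rule measure_Un_le[OF A(1) E])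
      also have "\<dots> \<le> \<epsilon> / 2 + \<epsilon> / 2" using A(2) k(2)[of \<kappa> n] \<kappa> n by (intro add_mono) auto
      finally show "measure (S n) (A \<union> ?E) \<le> \<epsilon>" by simp
      fix \<omega> assume \<omega>: "\<omega> \<in> space (S n) - (A \<union> ?E)"
      then have "B n \<omega> \<le> \<kappa>" using A(3)[of \<omega>] by (auto simp: dist_real_def)
      then show "dist (V n \<omega>) 0 < \<delta>" using \<omega> by (auto simp: dist_real_def)
    qed (use A E in auto)
  qed
qed

text \<open>The first conclusion has the scaling of the numerator of the statistic, the second is
  the mean square that enters its denominator; both come from the same conditional variance
  bound.\<close>

lemma weighted_residual_tends:
  fixes P :: "nat \<Rightarrow> (real \<times> real \<times> 'z::euclidean_space) measure" and D :: "nat \<Rightarrow> nat \<Rightarrow> (nat \<Rightarrow> real \<times> 'z) \<Rightarrow> real"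
    and U :: "real \<times> real \<times> 'z \<Rightarrow> real" and r :: "nat \<Rightarrow> real \<times> real \<times> 'z \<Rightarrow> real" and v W :: "nat \<Rightarrow> 'z \<Rightarrow> real"
  assumes law: "\<And>n. law (P n)"
    and U [measurable]: "\<And>n. U \<in> borel_measurable (P n)" and r [measurable]: "\<And>n. r n \<in> borel_measurable (P n)"
    and v [measurable]: "\<And>n. v n \<in> borel_measurable borel" and W [measurable]: "\<And>n. W n \<in> borel_measurable borel"
    and D: "\<And>n i. i < n \<Longrightarrow> D n i \<in> borel_measurable (PiM {..<n} (\<lambda>_. borel))"
    and zero: "\<And>n h. h \<in> borel_measurable borel \<Longrightarrow> integrable (P n) (\<lambda>\<omega>. h (U \<omega>, Zv \<omega>) * r n \<omega>) \<Longrightarrow> (\<integral>\<omega>. h (U \<omega>, Zv \<omega>) * r n \<omega> \<partial>P n) = 0"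
    and var: "\<And>n \<phi>. \<phi> \<in> borel_measurable borel \<Longrightarrow>
      (\<integral>\<^sup>+\<omega>. \<phi> (U \<omega>, Zv \<omega>) * ennreal ((r n \<omega>)\<^sup>2) \<partial>P n) = (\<integral>\<^sup>+\<omega>. \<phi> (U \<omega>, Zv \<omega>) * ennreal (v n (Zv \<omega>)) \<partial>P n)"
    and pos: "\<And>n. AE \<omega> in P n. 0 \<le> v n (Zv \<omega>)"
    and L: "\<And>n z. \<bar>W n z\<bar> \<le> L"
  defines "S \<equiv> \<lambda>n. sampleP (P n) n"
  assumes B: "tends_in_prob S (\<lambda>n \<omega>. 1 / n * (\<Sum>i<n. (D n i (data n U \<omega>))\<^sup>2 * v n (Zv (\<omega> i)))) 0"
  shows "tends_in_prob S (\<lambda>n \<omega>. (\<Sum>i<n. D n i (data n U \<omega>) * W n (Zv (\<omega> i)) * r n (\<omega> i)) / sqrt n) 0"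
    and "tends_in_prob S (\<lambda>n \<omega>. (\<Sum>i<n. (D n i (data n U \<omega>) * W n (Zv (\<omega> i)) * r n (\<omega> i))\<^sup>2) / n) 0"
proof -
  have m1 [measurable]: "(\<lambda>\<omega>. D n i (data n U \<omega>)) \<in> borel_measurable (S n)" if "i < n" for n i
    unfolding S_def by (rule measurable_compose[OF law.data_measurable[OF law U] D[OF that]])
  have m2 [measurable]: "(\<lambda>\<omega>. r n (\<omega> i)) \<in> borel_measurable (S n)" if "i < n" for n i
    unfolding S_def by (rule measurable_compose[OF law.component_sampleP[OF law that] r])
  have m3: "(\<lambda>\<omega>. Zv (\<omega> i)) \<in> borel_measurable (S n)" if "i < n" for n i
    unfolding S_def by (rule measurable_compose[OF law.component_sampleP[OF law that] law.measurable_coordinates(3)[OF law]])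
  have m4 [measurable]: "(\<lambda>\<omega>. v n (Zv (\<omega> i))) \<in> borel_measurable (S n)" "(\<lambda>\<omega>. W n (Zv (\<omega> i))) \<in> borel_measurable (S n)" if "i < n" for n i
    using measurable_compose[OF m3[OF that] v] measurable_compose[OF m3[OF that] W] by auto
  have tail: "\<P>(\<omega> in S n. 1 / n * (\<Sum>i<n. (D n i (data n U \<omega>))\<^sup>2 * v n (Zv (\<omega> i))) \<le> \<kappa> \<and>
        \<delta> \<le> \<bar>(\<Sum>i<n. D n i (data n U \<omega>) * W n (Zv (\<omega> i)) * r n (\<omega> i)) / sqrt n\<bar>) \<le> L\<^sup>2 * \<kappa> / \<delta>\<^sup>2"
      "\<P>(\<omega> in S n. 1 / n * (\<Sum>i<n. (D n i (data n U \<omega>))\<^sup>2 * v n (Zv (\<omega> i))) \<le> \<kappa> \<and>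
        \<delta> \<le> (\<Sum>i<n. (D n i (data n U \<omega>) * W n (Zv (\<omega> i)) * r n (\<omega> i))\<^sup>2) / n) \<le> L\<^sup>2 * \<kappa> / \<delta>"
    if "0 \<le> \<kappa>" "0 < \<delta>" "0 < n" for \<kappa> \<delta> n
    unfolding S_def
    by (rule law.weighted_residual_tail[OF law U r v W D zero var pos L that]; assumption)+
  show "tends_in_prob S (\<lambda>n \<omega>. (\<Sum>i<n. D n i (data n U \<omega>) * W n (Zv (\<omega> i)) * r n (\<omega> i)) / sqrt n) 0"
  proof (rule tends_in_prob_tail[OF B])
    fix \<delta> :: real assume "0 < \<delta>"
    then show "\<exists>k\<ge>0. \<forall>\<kappa> n. 0 \<le> \<kappa> \<longrightarrow> 0 < n \<longrightarrow> \<P>(\<omega> in S n. 1 / n * (\<Sum>i<n. (D n i (data n U \<omega>))\<^sup>2 * v n (Zv (\<omega> i))) \<le> \<kappa> \<and>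
        \<delta> \<le> \<bar>(\<Sum>i<n. D n i (data n U \<omega>) * W n (Zv (\<omega> i)) * r n (\<omega> i)) / sqrt n\<bar>) \<le> k * \<kappa>"
      using tail(1) by (intro exI[of _ "L\<^sup>2 / \<delta>\<^sup>2"]) auto
  qed measurable
  show "tends_in_prob S (\<lambda>n \<omega>. (\<Sum>i<n. (D n i (data n U \<omega>) * W n (Zv (\<omega> i)) * r n (\<omega> i))\<^sup>2) / n) 0"
  proof (rule tends_in_prob_tail[OF B])
    fix \<delta> :: real assume "0 < \<delta>"
    then show "\<exists>k\<ge>0. \<forall>\<kappa> n. 0 \<le> \<kappa> \<longrightarrow> 0 < n \<longrightarrow> \<P>(\<omega> in S n. 1 / n * (\<Sum>i<n. (D n i (data n U \<omega>))\<^sup>2 * v n (Zv (\<omega> i))) \<le> \<kappa> \<and>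
        \<delta> \<le> \<bar>(\<Sum>i<n. (D n i (data n U \<omega>) * W n (Zv (\<omega> i)) * r n (\<omega> i))\<^sup>2) / n\<bar>) \<le> k * \<kappa>"
      using tail(2) by (intro exI[of _ "L\<^sup>2 / \<delta>"]) (auto simp: sum_nonneg)
  qed measurable
qed

section \<open>The standardised product of residuals\<close>

locale gcm_law = law P for P :: "(real \<times> real \<times> 'z::euclidean_space) measure" +
  fixes \<eta> K :: real
  assumes P0: "P \<in> P0" and \<eta>: "0 < \<eta>"
    and moment: "(\<integral>\<^sup>+\<omega>. ennreal (\<bar>epsP P \<omega> * xiP P \<omega>\<bar> powr (2 + \<eta>)) \<partial>P) \<le> ennreal K"
begin

lemma regression_functions_measurable [measurable]:
  "fP P \<in> borel_measurable borel" "gP P \<in> borel_measurable borel"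
  "uP P \<in> borel_measurable borel" "vP P \<in> borel_measurable borel"
  unfolding fP_def gP_def uP_def vP_def by (rule cond_exp_fun(1))+

lemma residuals_measurable [measurable]: "epsP P \<in> borel_measurable P" "xiP P \<in> borel_measurable P"
  unfolding epsP_def[abs_def] xiP_def[abs_def] by measurable

text \<open>One lemma used twice with X and Y exchanged. The first three facts serve weights that
  depend on (X, Z), such as the error of the regression of X; the last three serve weights that
  depend on (Y, Z).\<close>

lemma residuals:
  "\<And>h. h \<in> borel_measurable borel \<Longrightarrow> integrable P (\<lambda>\<omega>. h (Xv \<omega>, Zv \<omega>) * xiP P \<omega>) \<Longrightarrow> (\<integral>\<omega>. h (Xv \<omega>, Zv \<omega>) * xiP P \<omega> \<partial>P) = 0"
  "\<And>\<phi>. \<phi> \<in> borel_measurable borel \<Longrightarrow>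
      (\<integral>\<^sup>+\<omega>. \<phi> (Xv \<omega>, Zv \<omega>) * ennreal ((xiP P \<omega>)\<^sup>2) \<partial>P) = (\<integral>\<^sup>+\<omega>. \<phi> (Xv \<omega>, Zv \<omega>) * ennreal (vP P (Zv \<omega>)) \<partial>P)"
  "AE \<omega> in P. 0 \<le> vP P (Zv \<omega>)"
  "\<And>h. h \<in> borel_measurable borel \<Longrightarrow> integrable P (\<lambda>\<omega>. h (Yv \<omega>, Zv \<omega>) * epsP P \<omega>) \<Longrightarrow> (\<integral>\<omega>. h (Yv \<omega>, Zv \<omega>) * epsP P \<omega> \<partial>P) = 0"
  "\<And>\<phi>. \<phi> \<in> borel_measurable borel \<Longrightarrow>
      (\<integral>\<^sup>+\<omega>. \<phi> (Yv \<omega>, Zv \<omega>) * ennreal ((epsP P \<omega>)\<^sup>2) \<partial>P) = (\<integral>\<^sup>+\<omega>. \<phi> (Yv \<omega>, Zv \<omega>) * ennreal (uP P (Zv \<omega>)) \<partial>P)"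
  "AE \<omega> in P. 0 \<le> uP P (Zv \<omega>)"
proof -
  have ac: "absolutely_continuous lborel P" and ci: "cond_indep Xv Yv"
    using P0 unfolding P0_def E0_def by (auto intro: cond_indep_XY)
  have mom: "(\<integral>\<^sup>+\<omega>. ennreal (\<bar>(Xv \<omega> - fP P (Zv \<omega>)) * (Yv \<omega> - gP P (Zv \<omega>))\<bar> powr (2 + \<eta>)) \<partial>P) < \<infinity>"
    using moment unfolding epsP_def xiP_def by (simp add: order_le_less_trans)
  then have mom': "(\<integral>\<^sup>+\<omega>. ennreal (\<bar>(Yv \<omega> - gP P (Zv \<omega>)) * (Xv \<omega> - fP P (Zv \<omega>))\<bar> powr (2 + \<eta>)) \<partial>P) < \<infinity>"
    by (simp add: mult.commute)
  have p: "2 \<le> 2 + \<eta>" using \<eta> by simp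
  have g: "AE \<omega> in P. gP P (Zv \<omega>) = real_cond_exp P (sigmaZ P) Yv \<omega>"
    and f: "AE \<omega> in P. fP P (Zv \<omega>) = real_cond_exp P (sigmaZ P) Xv \<omega>"
    unfolding gP_def fP_def by (rule cond_exp_fun(2))+
  have v: "AE \<omega> in P. vP P (Zv \<omega>) = real_cond_exp P (sigmaZ P) (\<lambda>\<omega>. (Yv \<omega> - gP P (Zv \<omega>))\<^sup>2) \<omega>"
    and u: "AE \<omega> in P. uP P (Zv \<omega>) = real_cond_exp P (sigmaZ P) (\<lambda>\<omega>. (Xv \<omega> - fP P (Zv \<omega>))\<^sup>2) \<omega>"
    unfolding vP_def uP_def xiP_def epsP_def by (rule cond_exp_fun(2))+
  note nz = AE_not_on_graph[OF ac regression_functions_measurable(1) sets_P]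
    AE_not_on_graph[OF ac regression_functions_measurable(2) sets_P]
  note x = cond_indep_residual[OF ci measurable_coordinates(1,2) regression_functions_measurable(1,2,4) g v p mom nz(1)]
  note y = cond_indep_residual[OF cond_indep_sym[OF ci] measurable_coordinates(2,1) regression_functions_measurable(2,1,3) f u p mom' nz(4)]
  show "(\<integral>\<omega>. h (Xv \<omega>, Zv \<omega>) * xiP P \<omega> \<partial>P) = 0"
    if "h \<in> borel_measurable borel" "integrable P (\<lambda>\<omega>. h (Xv \<omega>, Zv \<omega>) * xiP P \<omega>)" for h
    using x(1)[OF that(1)] that(2) unfolding xiP_def by simp
  show "(\<integral>\<omega>. h (Yv \<omega>, Zv \<omega>) * epsP P \<omega> \<partial>P) = 0"
    if "h \<in> borel_measurable borel" "integrable P (\<lambda>\<omega>. h (Yv \<omega>, Zv \<omega>) * epsP P \<omega>)" for h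
    using y(1)[OF that(1)] that(2) unfolding epsP_def by simp
  show "(\<integral>\<^sup>+\<omega>. \<phi> (Xv \<omega>, Zv \<omega>) * ennreal ((xiP P \<omega>)\<^sup>2) \<partial>P) = (\<integral>\<^sup>+\<omega>. \<phi> (Xv \<omega>, Zv \<omega>) * ennreal (vP P (Zv \<omega>)) \<partial>P)"
    if "\<phi> \<in> borel_measurable borel" for \<phi>
    using x(2)[OF that] unfolding xiP_def .
  show "(\<integral>\<^sup>+\<omega>. \<phi> (Yv \<omega>, Zv \<omega>) * ennreal ((epsP P \<omega>)\<^sup>2) \<partial>P) = (\<integral>\<^sup>+\<omega>. \<phi> (Yv \<omega>, Zv \<omega>) * ennreal (uP P (Zv \<omega>)) \<partial>P)"
    if "\<phi> \<in> borel_measurable borel" for \<phi>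
    using y(2)[OF that] unfolding epsP_def .
  show "AE \<omega> in P. 0 \<le> vP P (Zv \<omega>)" by (rule x(3))
  show "AE \<omega> in P. 0 \<le> uP P (Zv \<omega>)" by (rule y(3))
qed

definition sd :: "('z \<Rightarrow> real) \<Rightarrow> real" where
  "sd w = sqrt (\<integral>\<omega>. (epsP P \<omega>)\<^sup>2 * (xiP P \<omega>)\<^sup>2 * (w (Zv \<omega>))\<^sup>2 \<partial>P)"

definition std_product :: "('z \<Rightarrow> real) \<Rightarrow> real \<times> real \<times> 'z \<Rightarrow> real" where
  "std_product w \<omega> = epsP P \<omega> * xiP P \<omega> * (w (Zv \<omega>) / sd w)"

text \<open>Centring holds because the factor beside \<open>xiP P\<close> is a function of (X, Z).
  The moment bound has the same constant for all admissible laws and weights: \<open>sd w\<close> is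
  at least \<open>sqrt c\<close>, so the normalised weight is at most
  \<open>C / sqrt c\<close>.\<close>

lemma std_product:
  fixes w :: "'z \<Rightarrow> real" and C c \<eta>' :: real
  assumes w: "w \<in> Wset P C c" and C: "0 < C" and c: "0 < c" and \<eta>': "0 < \<eta>'" "\<eta>' \<le> \<eta>"
  shows "sqrt c \<le> sd w" and "std_product w \<in> borel_measurable P"
    and "integrable P (\<lambda>\<omega>. (std_product w \<omega>)\<^sup>2)" and "(\<integral>\<omega>. (std_product w \<omega>)\<^sup>2 \<partial>P) = 1"
    and "(\<integral>\<omega>. std_product w \<omega> \<partial>P) = 0"
    and "integrable P (\<lambda>\<omega>. \<bar>std_product w \<omega>\<bar> powr (2 + \<eta>'))"
    and "(\<integral>\<omega>. \<bar>std_product w \<omega>\<bar> powr (2 + \<eta>') \<partial>P) \<le> (C / sqrt c) powr (2 + \<eta>') * (1 + max 0 K)"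
proof -
  have [measurable]: "w \<in> borel_measurable borel" and wC: "\<And>z. \<bar>w z\<bar> \<le> C"
    and s2: "c \<le> (\<integral>\<omega>. (epsP P \<omega>)\<^sup>2 * (xiP P \<omega>)\<^sup>2 * (w (Zv \<omega>))\<^sup>2 \<partial>P)"
    using w unfolding Wset_def by auto
  show sd: "sqrt c \<le> sd w" unfolding sd_def using s2 by simp
  then have sd0: "0 < sd w" using c by (meson less_le_trans real_sqrt_gt_zero)
  have sd2: "(sd w)\<^sup>2 = (\<integral>\<omega>. (epsP P \<omega>)\<^sup>2 * (xiP P \<omega>)\<^sup>2 * (w (Zv \<omega>))\<^sup>2 \<partial>P)"
    unfolding sd_def using s2 c by simp
  \<comment> \<open>A non-integrable function would have integral 0 by convention, against the
    positive lower bound \<open>c\<close>.\<close>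
  have int: "integrable P (\<lambda>\<omega>. (epsP P \<omega>)\<^sup>2 * (xiP P \<omega>)\<^sup>2 * (w (Zv \<omega>))\<^sup>2)"
    using s2 c not_integrable_integral_eq by fastforce
  show m [measurable]: "std_product w \<in> borel_measurable P" unfolding std_product_def[abs_def] by measurable
  have sq: "(\<lambda>\<omega>. (std_product w \<omega>)\<^sup>2) = (\<lambda>\<omega>. ((epsP P \<omega>)\<^sup>2 * (xiP P \<omega>)\<^sup>2 * (w (Zv \<omega>))\<^sup>2) / (sd w)\<^sup>2)"
    by (simp add: std_product_def power_mult_distrib power_divide)
  show int2: "integrable P (\<lambda>\<omega>. (std_product w \<omega>)\<^sup>2)" unfolding sq using int by simp
  show "(\<integral>\<omega>. (std_product w \<omega>)\<^sup>2 \<partial>P) = 1" unfolding sq using sd0 by (simp add: sd2[symmetric])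
  have int1: "integrable P (std_product w)" by (rule square_integrable_imp_integrable[OF m int2])
  have hm: "(\<lambda>q. (fst q - fP P (snd q)) * (w (snd q) / sd w)) \<in> borel_measurable borel"
    unfolding borel_prod[symmetric] by measurable
  have heq: "(\<lambda>\<omega>. (fst (Xv \<omega>, Zv \<omega>) - fP P (snd (Xv \<omega>, Zv \<omega>))) * (w (snd (Xv \<omega>, Zv \<omega>)) / sd w) * xiP P \<omega>) = std_product w"
    by (simp add: std_product_def[abs_def] epsP_def mult_ac)
  show "(\<integral>\<omega>. std_product w \<omega> \<partial>P) = 0"
    using residuals(1)[OF hm] int1 unfolding heq by simp
  let ?L = "C / sqrt c"
  have L: "0 \<le> ?L" using C c by simp
  have wL: "\<bar>w z / sd w\<bar> \<le> ?L" for z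
    using wC[of z] sd sd0 C c by (simp add: frac_le)
  \<comment> \<open>Lowering the exponent from \<eta> to \<eta>' costs the summand 1, which covers
    residual products of modulus at most 1.\<close>
  have bound: "\<bar>std_product w \<omega>\<bar> powr (2 + \<eta>') \<le> ?L powr (2 + \<eta>') * (1 + \<bar>epsP P \<omega> * xiP P \<omega>\<bar> powr (2 + \<eta>))" for \<omega>
  proof -
    let ?y = "\<bar>epsP P \<omega> * xiP P \<omega>\<bar>"
    have "\<bar>std_product w \<omega>\<bar> = \<bar>w (Zv \<omega>) / sd w\<bar> * ?y" by (simp add: std_product_def abs_mult mult_ac)
    also have "\<dots> \<le> ?L * ?y" using wL by (intro mult_right_mono) auto
    finally have "\<bar>std_product w \<omega>\<bar> powr (2 + \<eta>') \<le> (?L * ?y) powr (2 + \<eta>')"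
      using \<eta>' by (intro powr_mono2) auto
    also have "\<dots> = ?L powr (2 + \<eta>') * ?y powr (2 + \<eta>')" by (rule powr_mult; use L in simp)
    also have "?y powr (2 + \<eta>') \<le> 1 + ?y powr (2 + \<eta>)"
    proof (cases "?y \<le> 1")
      case True
      then have "?y powr (2 + \<eta>') \<le> 1 powr (2 + \<eta>')" using \<eta>' by (intro powr_mono2) auto
      then show ?thesis by (smt (verit) powr_ge_zero powr_one_eq_one)
    next
      case False
      then have "?y powr (2 + \<eta>') \<le> ?y powr (2 + \<eta>)" using \<eta>' by (intro powr_mono) auto
      then show ?thesis by simp
    qed
    finally show ?thesis by (simp add: mult_left_mono)
  qed
  have imom: "integrable P (\<lambda>\<omega>. \<bar>epsP P \<omega> * xiP P \<omega>\<bar> powr (2 + \<eta>))"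
    by (rule integrableI_bounded) (use moment in \<open>auto intro: order_le_less_trans\<close>)
  have "ennreal (\<integral>\<omega>. \<bar>epsP P \<omega> * xiP P \<omega>\<bar> powr (2 + \<eta>) \<partial>P) \<le> ennreal K"
    using moment nn_integral_eq_integral[OF imom] by simp
  \<comment> \<open>\<open>ennreal\<close> sends negative reals to 0, so a negative \<open>K\<close>
    acts as the bound 0.\<close>
  also have "\<dots> \<le> ennreal (max 0 K)" by (intro ennreal_leI) simp
  finally have mK: "(\<integral>\<omega>. \<bar>epsP P \<omega> * xiP P \<omega>\<bar> powr (2 + \<eta>) \<partial>P) \<le> max 0 K"
    by (rule ennreal_le_iff[THEN iffD1, rotated]) simp
  have ib: "integrable P (\<lambda>\<omega>. ?L powr (2 + \<eta>') * (1 + \<bar>epsP P \<omega> * xiP P \<omega>\<bar> powr (2 + \<eta>)))"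
    using imom by (intro integrable_mult_right Bochner_Integration.integrable_add) simp_all
  show i2: "integrable P (\<lambda>\<omega>. \<bar>std_product w \<omega>\<bar> powr (2 + \<eta>'))"
  proof (rule Bochner_Integration.integrable_bound[OF ib])
    show "AE \<omega> in P. norm (\<bar>std_product w \<omega>\<bar> powr (2 + \<eta>')) \<le> norm (?L powr (2 + \<eta>') * (1 + \<bar>epsP P \<omega> * xiP P \<omega>\<bar> powr (2 + \<eta>)))"
      using bound by (intro AE_I2) (smt (verit) powr_ge_zero real_norm_def)
  qed measurable
  have "(\<integral>\<omega>. \<bar>std_product w \<omega>\<bar> powr (2 + \<eta>') \<partial>P) \<le> (\<integral>\<omega>. ?L powr (2 + \<eta>') * (1 + \<bar>epsP P \<omega> * xiP P \<omega>\<bar> powr (2 + \<eta>)) \<partial>P)"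
    by (rule integral_mono[OF i2 ib bound])
  also have "\<dots> = ?L powr (2 + \<eta>') * (1 + (\<integral>\<omega>. \<bar>epsP P \<omega> * xiP P \<omega>\<bar> powr (2 + \<eta>) \<partial>P))"
    using imom prob_space by simp
  also have "\<dots> \<le> ?L powr (2 + \<eta>') * (1 + max 0 K)"
    using mK by (intro mult_left_mono) auto
  finally show "(\<integral>\<omega>. \<bar>std_product w \<omega>\<bar> powr (2 + \<eta>') \<partial>P) \<le> ?L powr (2 + \<eta>') * (1 + max 0 K)" .
qed

end

lemma gcm_lawI:
  assumes "P \<in> P0" "0 < \<eta>" "(\<integral>\<^sup>+\<omega>. ennreal (\<bar>epsP P \<omega> * xiP P \<omega>\<bar> powr (2 + \<eta>)) \<partial>P) \<le> ennreal K"
  shows "gcm_law P \<eta> K"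
  using assms by (auto simp: gcm_law_def gcm_law_axioms_def law_def law_axioms_def P0_def E0_def)

section \<open>The generalised covariance measure\<close>

context law
begin

lemma fhat_ghat_measurable:
  assumes reg: "regression_method reg" and f [measurable]: "f \<in> borel_measurable borel" and i: "i < n"
  shows "(\<lambda>\<omega>. f (Zv (\<omega> i)) - fhat reg n \<omega> (Zv (\<omega> i))) \<in> borel_measurable (sampleP P n)"
    and "(\<lambda>\<omega>. f (Zv (\<omega> i)) - ghat reg n \<omega> (Zv (\<omega> i))) \<in> borel_measurable (sampleP P n)"
  using measurable_compose[OF data_measurable[OF measurable_coordinates(1)] reg_error_measurable[OF reg f i]]
    measurable_compose[OF data_measurable[OF measurable_coordinates(2)] reg_error_measurable[OF reg f i]]
  by (simp_all add: reg_error_data[OF i])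

end

text \<open>The law and the weight may be chosen afresh at each sample size. Since the sequence is
  arbitrary, this is strong enough to contradict a failure of uniformity over the class.\<close>

theorem gcm_sequence:
  fixes P :: "nat \<Rightarrow> (real \<times> real \<times> 'z::euclidean_space) measure" and w :: "nat \<Rightarrow> 'z \<Rightarrow> real"
    and regX regY :: "nat \<Rightarrow> (nat \<Rightarrow> real) \<Rightarrow> (nat \<Rightarrow> 'z) \<Rightarrow> 'z \<Rightarrow> real"
  assumes law: "\<And>n. gcm_law (P n) \<eta> K" and C: "0 < C" and c: "0 < c"
    and regX: "regression_method regX" and regY: "regression_method regY"
    and w: "\<And>n. w n \<in> Wset (P n) C c"
  defines "S \<equiv> \<lambda>n. sampleP (P n) n"
  assumes AA: "tends_in_prob S (\<lambda>n \<omega>. A_f (P n) regX n \<omega> * A_g (P n) regY n \<omega> / (1 / real n)) 0"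
    and Bf: "tends_in_prob S (\<lambda>n \<omega>. B_f (P n) regX n \<omega>) 0"
    and Bg: "tends_in_prob S (\<lambda>n \<omega>. B_g (P n) regY n \<omega>) 0"
    and \<epsilon>: "0 < \<epsilon>"
  shows "\<exists>N. \<forall>n\<ge>N. \<forall>t. \<bar>\<P>(\<omega> in S n. T_w regX regY (w n) n \<omega> \<le> t) - Phi t\<bar> \<le> \<epsilon>"
proof -
  interpret G: gcm_law "P n" \<eta> K for n by (rule law)
  have ps: "prob_space (S n)" for n unfolding S_def by (rule G.sampleP_prob)
  have SE: "sampleP (P n) n = S n" for n by (simp add: S_def)
  interpret S: prob_space "S n" for n by (rule ps)
  have lawP: "law (P n)" for n by unfold_locales
  have eta: "0 < \<eta>" by (rule G.\<eta>)
  define L where "L = C / sqrt c"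
  have L: "0 < L" using C c by (simp add: L_def)
  \<comment> \<open>The remainder estimate behind the central limit theorem is for exponents at most
    1; lowering the exponent preserves a uniform moment bound.\<close>
  define \<eta>' where "\<eta>' = min \<eta> 1"
  have \<eta>': "0 < \<eta>'" "\<eta>' \<le> 1" "\<eta>' \<le> \<eta>" using eta by (auto simp: \<eta>'_def)
  define s where "s n = G.sd n (w n)" for n
  define W where "W n z = w n z / s n" for n z
  define a where "a n = G.std_product n (w n)" for n
  note sp = G.std_product[OF w C c \<eta>'(1,3), folded s_def a_def]
  have [measurable]: "a n \<in> borel_measurable (P n)" for n by (rule sp(2))
  have [measurable]: "w n \<in> borel_measurable borel" for n using w unfolding Wset_def by auto
  have wC: "\<bar>w n z\<bar> \<le> C" for n z using w unfolding Wset_def by auto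
  have s0: "0 < s n" for n using sp(1)[of n] c by (meson less_le_trans real_sqrt_gt_zero)
  have [measurable]: "W n \<in> borel_measurable borel" for n unfolding W_def[abs_def] by measurable
  have WL: "\<bar>W n z\<bar> \<le> L" for n z
    using wC[of n z] sp(1)[of n] s0[of n] C c unfolding W_def L_def by (simp add: frac_le)
  have comp [measurable]: "(\<lambda>\<omega>. h (\<omega> i)) \<in> borel_measurable (S n)" if "i < n" "h \<in> borel_measurable (P n)" for h :: "real \<times> real \<times> 'z \<Rightarrow> real" and i n
    unfolding S_def by (rule measurable_compose[OF G.component_sampleP[OF that(1)] that(2)])

  define \<Delta>f where "\<Delta>f n \<omega> i = fP (P n) (Zv (\<omega> i)) - fhat regX n \<omega> (Zv (\<omega> i))" for n \<omega> i
  define \<Delta>g where "\<Delta>g n \<omega> i = gP (P n) (Zv (\<omega> i)) - ghat regY n \<omega> (Zv (\<omega> i))" for n \<omega> i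
  have \<Delta>m [measurable]: "(\<lambda>\<omega>. \<Delta>f n \<omega> i) \<in> borel_measurable (S n)" "(\<lambda>\<omega>. \<Delta>g n \<omega> i) \<in> borel_measurable (S n)" if "i < n" for n i
    unfolding \<Delta>f_def \<Delta>g_def S_def
    by (rule law.fhat_ghat_measurable(1)[OF lawP regX G.regression_functions_measurable(1) that])
       (rule law.fhat_ghat_measurable(2)[OF lawP regY G.regression_functions_measurable(2) that])
  define b where "b n \<omega> i = \<Delta>f n \<omega> i * W n (Zv (\<omega> i)) * xiP (P n) (\<omega> i)" for n \<omega> i
  define e where "e n \<omega> i = \<Delta>g n \<omega> i * W n (Zv (\<omega> i)) * epsP (P n) (\<omega> i)" for n \<omega> i
  define d where "d n \<omega> i = \<Delta>f n \<omega> i * \<Delta>g n \<omega> i * W n (Zv (\<omega> i))" for n \<omega> i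
  have Zm: "(\<lambda>\<omega>. W n (Zv (\<omega> i))) \<in> borel_measurable (S n)" if "i < n" for n i
    by (rule comp[OF that]) measurable
  have bm [measurable]: "(\<lambda>\<omega>. b n \<omega> i) \<in> borel_measurable (S n)" "(\<lambda>\<omega>. e n \<omega> i) \<in> borel_measurable (S n)"
    "(\<lambda>\<omega>. d n \<omega> i) \<in> borel_measurable (S n)" if "i < n" for n i
    unfolding b_def e_def d_def using that Zm[OF that] by measurable
  \<comment> \<open>Each estimated residual is the true residual plus a regression error,
    \<open>\<Delta>f\<close> or \<open>\<Delta>g\<close>; multiplying out gives the four
    terms.\<close>
  have R: "R_w regX regY (W n) n \<omega> i = a n (\<omega> i) + b n \<omega> i + e n \<omega> i + d n \<omega> i" for n \<omega> i
  proof -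
    have alg: "(x - f') * (y - g') * v = (x - f) * (y - g) * v + (f - f') * v * (y - g) + (g - g') * v * (x - f) + (f - f') * (g - g') * v"
      for x y f g f' g' v :: real by (simp add: algebra_simps)
    have a: "a n (\<omega> i) = epsP (P n) (\<omega> i) * xiP (P n) (\<omega> i) * W n (Zv (\<omega> i))"
      unfolding a_def G.std_product_def W_def s_def ..
    show ?thesis
      unfolding R_w_def a b_def e_def d_def \<Delta>f_def \<Delta>g_def epsP_def xiP_def by (rule alg)
  qed

  have D1: "reg_error regX (fP (P n)) n i (data n Xv \<omega>) = \<Delta>f n \<omega> i" if "i < n" for n i \<omega>
    unfolding \<Delta>f_def by (rule reg_error_data(1)[OF that])
  have D2: "reg_error regY (gP (P n)) n i (data n Yv \<omega>) = \<Delta>g n \<omega> i" if "i < n" for n i \<omega>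
    unfolding \<Delta>g_def by (rule reg_error_data(2)[OF that])
  have Bf': "tends_in_prob S (\<lambda>n \<omega>. 1 / n * (\<Sum>i<n. (reg_error regX (fP (P n)) n i (data n Xv \<omega>))\<^sup>2 * vP (P n) (Zv (\<omega> i)))) 0"
    using Bf unfolding B_f_def by (simp add: D1 \<Delta>f_def)
  have Bg': "tends_in_prob S (\<lambda>n \<omega>. 1 / n * (\<Sum>i<n. (reg_error regY (gP (P n)) n i (data n Yv \<omega>))\<^sup>2 * uP (P n) (Zv (\<omega> i)))) 0"
    using Bg unfolding B_g_def by (simp add: D2 \<Delta>g_def)
  note tb = weighted_residual_tends[where P=P and U=Xv and r="\<lambda>n. xiP (P n)" and v="\<lambda>n. vP (P n)" and W=W and L=L
      and D="\<lambda>n i. reg_error regX (fP (P n)) n i",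
      OF lawP G.measurable_coordinates(1) G.residuals_measurable(2) G.regression_functions_measurable(4) _
        reg_error_measurable[OF regX G.regression_functions_measurable(1)] G.residuals(1) G.residuals(2) G.residuals(3) WL
        Bf'[unfolded S_def], folded S_def]
  note te = weighted_residual_tends[where P=P and U=Yv and r="\<lambda>n. epsP (P n)" and v="\<lambda>n. uP (P n)" and W=W and L=L
      and D="\<lambda>n i. reg_error regY (gP (P n)) n i",
      OF lawP G.measurable_coordinates(2) G.residuals_measurable(1) G.regression_functions_measurable(3) _
        reg_error_measurable[OF regY G.regression_functions_measurable(2)] G.residuals(4) G.residuals(5) G.residuals(6) WL
        Bg'[unfolded S_def], folded S_def]
  have b1: "tends_in_prob S (\<lambda>n \<omega>. (\<Sum>i<n. b n \<omega> i) / sqrt n) 0" and b2: "tends_in_prob S (\<lambda>n \<omega>. (\<Sum>i<n. (b n \<omega> i)\<^sup>2) / n) 0"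
    using tb by (simp_all add: D1 b_def)
  have e1: "tends_in_prob S (\<lambda>n \<omega>. (\<Sum>i<n. e n \<omega> i) / sqrt n) 0" and e2: "tends_in_prob S (\<lambda>n \<omega>. (\<Sum>i<n. (e n \<omega> i)\<^sup>2) / n) 0"
    using te by (simp_all add: D2 e_def)

  define q where "q n \<omega> = (1 / n * (\<Sum>i<n. (\<Delta>f n \<omega> i)\<^sup>2)) * (1 / n * (\<Sum>i<n. (\<Delta>g n \<omega> i)\<^sup>2)) / (1 / real n)" for n \<omega>
  have "tends_in_prob S q 0"
    using AA unfolding A_f_def A_g_def q_def[abs_def] \<Delta>f_def \<Delta>g_def .
  then have "tends_in_prob S (\<lambda>n \<omega>. L * sqrt (q n \<omega>)) (L * sqrt 0)"
    by (rule tends_in_prob_isCont) (intro continuous_intros)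
  then have q: "tends_in_prob S (\<lambda>n \<omega>. L * sqrt (q n \<omega>)) 0" by simp
  have q0: "0 \<le> q n \<omega>" for n \<omega> unfolding q_def by (simp add: sum_nonneg)
  have d1: "tends_in_prob S (\<lambda>n \<omega>. (\<Sum>i<n. d n \<omega> i) / sqrt n) 0"
  proof (rule tends_in_prob_bound[OF q])
    show "\<bar>(\<Sum>i<n. d n \<omega> i) / sqrt n - 0\<bar> \<le> L * sqrt (q n \<omega>)" for n \<omega>
      using weighted_product_bounds(1)[of "\<lambda>i. W n (Zv (\<omega> i))" L n "\<Delta>f n \<omega>" "\<Delta>g n \<omega>"] WL L
      by (cases "n = 0") (simp_all add: d_def q_def)
  qed
  have d2: "tends_in_prob S (\<lambda>n \<omega>. sqrt ((\<Sum>i<n. (d n \<omega> i)\<^sup>2) / n)) 0"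
  proof (rule tends_in_prob_bound[OF q])
    show "\<bar>sqrt ((\<Sum>i<n. (d n \<omega> i)\<^sup>2) / n) - 0\<bar> \<le> L * sqrt (q n \<omega>)" for n \<omega>
      using weighted_product_bounds(2)[of "\<lambda>i. W n (Zv (\<omega> i))" L n "\<Delta>f n \<omega>" "\<Delta>g n \<omega>"] WL L
      by (cases "n = 0") (simp_all add: d_def q_def sum_nonneg)
  qed
  have sqrt0: "tends_in_prob S (\<lambda>n \<omega>. sqrt (V n \<omega>)) (sqrt v)" if "tends_in_prob S V v" for V v
    using that by (rule tends_in_prob_isCont) (intro continuous_intros)

  define X where "X n \<omega> = (\<Sum>i<n. a n (\<omega> i)) / sqrt n" for n \<omega>
  define r where "r n \<omega> = (\<Sum>i<n. b n \<omega> i) / sqrt n + (\<Sum>i<n. e n \<omega> i) / sqrt n + (\<Sum>i<n. d n \<omega> i) / sqrt n" for n \<omega>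
  define \<rho> where "\<rho> n \<omega> = sqrt (1 / n * (\<Sum>i<n. (R_w regX regY (W n) n \<omega> i)\<^sup>2) - (1 / n * (\<Sum>i<n. R_w regX regY (W n) n \<omega> i))\<^sup>2)" for n \<omega>
  have r: "tends_in_prob S r 0"
    using tends_in_prob_add[OF ps tends_in_prob_add[OF ps b1 e1] d1] unfolding r_def[abs_def] by simp
  have SR: "(\<Sum>i<n. R_w regX regY (W n) n \<omega> i) / sqrt n = X n \<omega> + r n \<omega>" for n \<omega>
    unfolding R X_def r_def by (simp add: sum.distrib add_divide_distrib)
  have T: "T_w regX regY (w n) n \<omega> = (X n \<omega> + r n \<omega>) / \<rho> n \<omega>" for n \<omega>
  proof -
    have "T_w regX regY (w n) n \<omega> = T_w regX regY (W n) n \<omega>"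
      unfolding W_def[abs_def] by (rule T_w_scale[symmetric, OF s0])
    then show ?thesis unfolding T_w_def \<rho>_def SR[symmetric] by simp
  qed

  have wlln: "tends_in_prob S (\<lambda>n \<omega>. (\<Sum>i<n. (a n (\<omega> i))\<^sup>2) / n) 1"
  proof (rule tends_in_probI)
    fix \<delta> \<epsilon>' :: real assume p: "0 < \<delta>" "0 < \<epsilon>'"
    \<comment> \<open>The weak law is applied to the square of \<open>a n\<close>, whose moment of
      order 1 + \<eta>' / 2 is the moment of \<open>a n\<close> of order 2 + \<eta>'.\<close>
    then have p': "0 < \<delta> / 2" "0 < \<eta>' / 2" using \<eta>' by auto
    obtain N where N: "\<forall>n\<ge>N. \<forall>(M :: (real \<times> real \<times> 'z) measure) z. prob_space M \<longrightarrow> z \<in> borel_measurable M \<longrightarrow> (\<forall>y. 0 \<le> z y) \<longrightarrow>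
      integrable M z \<longrightarrow> integral\<^sup>L M z = 1 \<longrightarrow> integrable M (\<lambda>y. z y powr (1 + \<eta>' / 2)) \<longrightarrow>
      (\<integral>y. z y powr (1 + \<eta>' / 2) \<partial>M) \<le> (C / sqrt c) powr (2 + \<eta>') * (1 + max 0 K) \<longrightarrow>
      \<P>(\<omega> in PiM {..<n::nat} (\<lambda>_. M). \<delta> / 2 < \<bar>(\<Sum>i<n. z (\<omega> i)) / n - 1\<bar>) \<le> \<epsilon>'"
      using uniform_wlln[OF p'(1) p(2) p'(2), of "(C / sqrt c) powr (2 + \<eta>') * (1 + max 0 K)"] ..
    have pw: "(x\<^sup>2) powr (1 + \<eta>' / 2) = \<bar>x\<bar> powr (2 + \<eta>')" for x :: real
    proof -
      have "x\<^sup>2 = \<bar>x\<bar> powr 2" by simp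
      then have "(x\<^sup>2) powr (1 + \<eta>' / 2) = \<bar>x\<bar> powr (2 * (1 + \<eta>' / 2))" by (simp only: powr_powr)
      also have "2 * (1 + \<eta>' / 2) = 2 + \<eta>'" by simp
      finally show ?thesis .
    qed
    have t: "\<P>(\<omega> in S n. \<delta> / 2 < \<bar>(\<Sum>i<n. (a n (\<omega> i))\<^sup>2) / n - 1\<bar>) \<le> \<epsilon>'" if "n \<ge> N" for n
      unfolding S_def sampleP_def
      by (rule N[rule_format, OF that, where z="\<lambda>y. (a n y)\<^sup>2"]) (use sp[of n] G.prob_space_axioms in \<open>auto simp: pw\<close>)
    show "\<exists>N. \<forall>n\<ge>N. \<exists>A\<in>sets (S n). measure (S n) A \<le> \<epsilon>' \<and>
      (\<forall>\<omega>\<in>space (S n) - A. dist ((\<Sum>i<n. (a n (\<omega> i))\<^sup>2) / n) 1 < \<delta>)"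
    proof (intro exI[of _ N] allI impI)
      fix n assume n: "N \<le> n"
      let ?A = "{\<omega> \<in> space (S n). \<delta> / 2 < \<bar>(\<Sum>i<n. (a n (\<omega> i))\<^sup>2) / n - 1\<bar>}"
      have A: "?A \<in> sets (S n)" by measurable
      moreover have "dist ((\<Sum>i<n. (a n (\<omega> i))\<^sup>2) / n) 1 < \<delta>" if "\<omega> \<in> space (S n) - ?A" for \<omega>
        using that p by (auto simp: dist_real_def)
      ultimately show "\<exists>A\<in>sets (S n). measure (S n) A \<le> \<epsilon>' \<and>
        (\<forall>\<omega>\<in>space (S n) - A. dist ((\<Sum>i<n. (a n (\<omega> i))\<^sup>2) / n) 1 < \<delta>)"
        using t[OF n] by (intro bexI[OF _ A] conjI ballI) auto
    qed
  qed
  have mean: "tends_in_prob S (\<lambda>n \<omega>. X n \<omega> / sqrt n) 0"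
  proof (rule tends_in_probI)
    fix \<delta> \<epsilon>' :: real assume p: "0 < \<delta>" "0 < \<epsilon>'"
    \<comment> \<open>The second moment of the sum of the \<open>a n (\<omega> i)\<close> is at most
      n, so Chebyshev at level \<open>n * \<delta>\<close> gives the probability bound
      \<open>1 / (n * \<delta>\<^sup>2)\<close>.\<close>
    obtain N :: nat where N: "1 / (\<epsilon>' * \<delta>\<^sup>2) < N" using reals_Archimedean2 by blast
    show "\<exists>N. \<forall>n\<ge>N. \<exists>A\<in>sets (S n). measure (S n) A \<le> \<epsilon>' \<and> (\<forall>\<omega>\<in>space (S n) - A. dist (X n \<omega> / sqrt n) 0 < \<delta>)"
    proof (intro exI[of _ "max 1 N"] allI impI)
      fix n assume n: "max 1 N \<le> n"
      then have n0: "0 < n" "1 / (\<epsilon>' * \<delta>\<^sup>2) \<le> n" using N by auto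
      let ?A = "{\<omega> \<in> space (S n). n * \<delta> \<le> \<bar>\<Sum>i<n. a n (\<omega> i)\<bar>}"
      have A: "?A \<in> sets (S n)" by measurable
      note sm = G.PiM_iid_second_moment[OF finite_lessThan sp(2,3,5), of n n, folded sampleP_def, unfolded SE]
      have "measure (S n) ?A \<le> (\<integral>\<omega>. (\<Sum>i<n. a n (\<omega> i))\<^sup>2 \<partial>S n) / (n * \<delta>)\<^sup>2"
        by (rule S.second_moment_method) (use sm(1) n0 p in auto)
      also have "\<dots> \<le> n * 1 / (n * \<delta>)\<^sup>2"
        using sm(2) sp(4)[of n] by (intro divide_right_mono) auto
      also have "\<dots> = 1 / (n * \<delta>\<^sup>2)" using n0 by (simp add: power2_eq_square)
      also have "\<dots> \<le> \<epsilon>'" using n0 p by (simp add: field_simps)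
      finally have m: "measure (S n) ?A \<le> \<epsilon>'" .
      have "dist (X n \<omega> / sqrt n) 0 < \<delta>" if "\<omega> \<in> space (S n) - ?A" for \<omega>
      proof -
        have "\<bar>\<Sum>i<n. a n (\<omega> i)\<bar> < n * \<delta>" using that by auto
        then have "\<bar>\<Sum>i<n. a n (\<omega> i)\<bar> / n < \<delta>" using n0 by (simp add: field_simps)
        moreover have "X n \<omega> / sqrt n = (\<Sum>i<n. a n (\<omega> i)) / n" using n0 by (simp add: X_def)
        ultimately show ?thesis by (simp only: dist_real_def diff_0_right abs_divide abs_of_nat)
      qed
      with m show "\<exists>A\<in>sets (S n). measure (S n) A \<le> \<epsilon>' \<and> (\<forall>\<omega>\<in>space (S n) - A. dist (X n \<omega> / sqrt n) 0 < \<delta>)"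
        by (intro bexI[OF _ A] conjI ballI)
    qed
  qed

  have abs0: "tends_in_prob S (\<lambda>n \<omega>. \<bar>V n \<omega>\<bar>) \<bar>v\<bar>" if "tends_in_prob S V v" for V and v :: real
    using that by (rule tends_in_prob_isCont) (intro continuous_intros)
  have mR: "tends_in_prob S (\<lambda>n \<omega>. 1 / n * (\<Sum>i<n. R_w regX regY (W n) n \<omega> i)) 0"
  proof (rule tends_in_prob_bound)
    show "tends_in_prob S (\<lambda>n \<omega>. \<bar>X n \<omega> / sqrt n\<bar> + \<bar>r n \<omega>\<bar>) 0"
      using tends_in_prob_add[OF ps abs0[OF mean] abs0[OF r]] by simp
    show "\<bar>1 / n * (\<Sum>i<n. R_w regX regY (W n) n \<omega> i) - 0\<bar> \<le> \<bar>X n \<omega> / sqrt n\<bar> + \<bar>r n \<omega>\<bar>" for n \<omega>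
    proof (cases "n = 0")
      case False
      have "1 / n * (\<Sum>i<n. R_w regX regY (W n) n \<omega> i) = ((\<Sum>i<n. R_w regX regY (W n) n \<omega> i) / sqrt n) / sqrt n"
        by simp
      also have "\<dots> = X n \<omega> / sqrt n + r n \<omega> / sqrt n" unfolding SR by (simp add: add_divide_distrib)
      finally have eq: "1 / n * (\<Sum>i<n. R_w regX regY (W n) n \<omega> i) = X n \<omega> / sqrt n + r n \<omega> / sqrt n" .
      \<comment> \<open>The extra factor 1 / sqrt n of the sample mean is given away, since
        \<open>r\<close> already tends to 0.\<close>
      have "\<bar>r n \<omega> / sqrt n\<bar> \<le> \<bar>r n \<omega>\<bar>" using False by (simp add: divide_le_eq mult_le_cancel_left1)
      then show ?thesis unfolding eq by linarith
    qed simp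
  qed
  have rms: "tends_in_prob S (\<lambda>n \<omega>. sqrt ((\<Sum>i<n. (R_w regX regY (W n) n \<omega> i)\<^sup>2) / n)) 1"
  proof (rule tends_in_prob_bound)
    have "tends_in_prob S (\<lambda>n \<omega>. \<bar>sqrt ((\<Sum>i<n. (a n (\<omega> i))\<^sup>2) / n) + - 1\<bar>) \<bar>sqrt 1 + - 1\<bar>"
      by (intro abs0 tends_in_prob_add ps sqrt0 wlln tends_in_prob_const)
    then have "tends_in_prob S (\<lambda>n \<omega>. \<bar>sqrt ((\<Sum>i<n. (a n (\<omega> i))\<^sup>2) / n) + - 1\<bar> + (sqrt ((\<Sum>i<n. (b n \<omega> i)\<^sup>2) / n)
      + sqrt ((\<Sum>i<n. (e n \<omega> i)\<^sup>2) / n) + sqrt ((\<Sum>i<n. (d n \<omega> i)\<^sup>2) / n))) (\<bar>sqrt 1 + - 1\<bar> + (sqrt 0 + sqrt 0 + 0))"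
      by (intro tends_in_prob_add ps sqrt0 b2 e2 d2)
    then show "tends_in_prob S (\<lambda>n \<omega>. \<bar>sqrt ((\<Sum>i<n. (a n (\<omega> i))\<^sup>2) / n) + - 1\<bar> + (sqrt ((\<Sum>i<n. (b n \<omega> i)\<^sup>2) / n)
      + sqrt ((\<Sum>i<n. (e n \<omega> i)\<^sup>2) / n) + sqrt ((\<Sum>i<n. (d n \<omega> i)\<^sup>2) / n))) 0" by simp
    show "\<bar>sqrt ((\<Sum>i<n. (R_w regX regY (W n) n \<omega> i)\<^sup>2) / n) - 1\<bar> \<le> \<bar>sqrt ((\<Sum>i<n. (a n (\<omega> i))\<^sup>2) / n) + - 1\<bar> + (sqrt ((\<Sum>i<n. (b n \<omega> i)\<^sup>2) / n)
      + sqrt ((\<Sum>i<n. (e n \<omega> i)\<^sup>2) / n) + sqrt ((\<Sum>i<n. (d n \<omega> i)\<^sup>2) / n))" for n \<omega>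
      using rms_perturbation[of "\<lambda>i. a n (\<omega> i)" "b n \<omega>" "e n \<omega>" "d n \<omega>" n] unfolding R by linarith
  qed
  \<comment> \<open>The denominator is this function of the root mean square and the mean, whose
    limits are 1 and 0; continuity at that one point is enough.\<close>
  have "isCont (\<lambda>(x, y). sqrt (x\<^sup>2 - y\<^sup>2)) (1, 0 :: real)"
    by (auto simp: case_prod_unfold intro!: continuous_intros)
  from tends_in_prob_isCont2[OF ps rms mR this]
  have "tends_in_prob S (\<lambda>n \<omega>. sqrt ((sqrt ((\<Sum>i<n. (R_w regX regY (W n) n \<omega> i)\<^sup>2) / n))\<^sup>2 - (1 / n * (\<Sum>i<n. R_w regX regY (W n) n \<omega> i))\<^sup>2)) 1"
    by simp
  then have \<rho>: "tends_in_prob S \<rho> 1"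
    unfolding \<rho>_def[abs_def] by (simp add: sum_nonneg)

  have Xm [measurable]: "X n \<in> borel_measurable (S n)" for n unfolding X_def[abs_def] by measurable
  have Rm [measurable]: "(\<lambda>\<omega>. R_w regX regY (W n) n \<omega> i) \<in> borel_measurable (S n)" if "i < n" for n i
    unfolding R using that by measurable
  have Tm [measurable]: "T_w regX regY (w n) n \<in> borel_measurable (S n)" for n
  proof -
    have "(\<lambda>\<omega>. T_w regX regY (W n) n \<omega>) \<in> borel_measurable (S n)" unfolding T_w_def by measurable
    then show ?thesis unfolding W_def[abs_def] using T_w_scale[OF s0, of regX regY "w n" for n] by simp
  qed
  have clt: "(\<lambda>n. \<P>(\<omega> in S n. X n \<omega> \<le> x)) \<longlonglongrightarrow> Phi x" for x
  proof -
    have "weak_conv_m (\<lambda>n. distr (PiM {..<n} (\<lambda>_. P n)) borel (\<lambda>\<omega>. (\<Sum>i<n. a n (\<omega> i)) / sqrt n)) std_normal_distribution"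
      by (rule lyapunov_clt_array[OF G.prob_space_axioms sp(2) \<eta>'(1,2) sp(3) sp(5) sp(4) sp(6) sp(7)])
    then have "(\<lambda>n. cdf (distr (S n) borel (X n)) x) \<longlonglongrightarrow> Phi x"
      using Phi_props(1)[of x] unfolding weak_conv_m_def weak_conv_def Phi_def S_def sampleP_def X_def[abs_def] by blast
    moreover have "cdf (distr (S n) borel (X n)) x = \<P>(\<omega> in S n. X n \<omega> \<le> x)" for n
      unfolding cdf_def by (subst measure_distr) (auto simp: vimage_def Int_def conj_commute)
    ultimately show ?thesis by simp
  qed
  have lim: "(\<lambda>n. \<P>(\<omega> in S n. T_w regX regY (w n) n \<omega> \<le> t)) \<longlonglongrightarrow> Phi t" for t
    by (rule slutsky_studentized[OF ps Xm Tm r \<rho> T clt Phi_props(1)])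
  show ?thesis
    by (rule uniform_cdf_convergence[OF Phi_props _ _ _ lim \<epsilon>])
       (auto intro!: monoI S.finite_measure_mono S.prob_le_1)
qed

theorem theorem8:
  fixes \<P> :: "(real \<times> real \<times> 'z::euclidean_space) measure set"
    and C c :: real
    and regX regY :: "nat \<Rightarrow> (nat \<Rightarrow> real) \<Rightarrow> (nat \<Rightarrow> 'z) \<Rightarrow> 'z \<Rightarrow> real"
  assumes "\<P> \<subseteq> P0"
    and "C > 0" and "c > 0"
    and "regression_method regX" and "regression_method regY"
    and "o_unif \<P> (\<lambda>P n \<omega>. A_f P regX n \<omega> * A_g P regY n \<omega>) (\<lambda>n. 1 / real n)"
    and "o_unif \<P> (\<lambda>P n \<omega>. B_f P regX n \<omega>) (\<lambda>n. 1)"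
    and "o_unif \<P> (\<lambda>P n \<omega>. B_g P regY n \<omega>) (\<lambda>n. 1)"
    and "\<exists>\<eta>>0. \<exists>M::real. \<forall>P\<in>\<P>.
           (\<integral>\<^sup>+\<omega>. ennreal (\<bar>epsP P \<omega> * xiP P \<omega>\<bar> powr (2 + \<eta>)) \<partial>P) \<le> ennreal M"
    and "\<forall>P\<in>\<P>. Wset P C c \<noteq> {}"
  shows "\<forall>\<epsilon>>0. \<exists>N. \<forall>n\<ge>N. \<forall>P\<in>\<P>. \<forall>w\<in>Wset P C c. \<forall>t::real.
           \<bar>measure (sampleP P n) {\<omega> \<in> space (sampleP P n). T_w regX regY w n \<omega> \<le> t} - Phi t\<bar> \<le> \<epsilon>"
proof (intro allI impI, rule ccontr)
  fix \<epsilon> :: real assume \<epsilon>: "0 < \<epsilon>"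
  define far where "far n P w t \<longleftrightarrow> \<not> \<bar>measure (sampleP P n) {\<omega> \<in> space (sampleP P n). T_w regX regY w n \<omega> \<le> t} - Phi t\<bar> \<le> \<epsilon>" for n P w t
  define bad where "bad n Pw \<longleftrightarrow> (\<exists>t. far n (fst Pw) (snd Pw) t)"
    for n and Pw :: "(real \<times> real \<times> 'z) measure \<times> ('z \<Rightarrow> real)"
  define adm where "adm Pw \<longleftrightarrow> fst Pw \<in> \<P> \<and> snd Pw \<in> Wset (fst Pw) C c" for Pw :: "(real \<times> real \<times> 'z) measure \<times> ('z \<Rightarrow> real)"
  assume "\<not> (\<exists>N. \<forall>n\<ge>N. \<forall>P\<in>\<P>. \<forall>w\<in>Wset P C c. \<forall>t::real.
           \<bar>measure (sampleP P n) {\<omega> \<in> space (sampleP P n). T_w regX regY w n \<omega> \<le> t} - Phi t\<bar> \<le> \<epsilon>)"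
  then have "\<exists>n\<ge>N. \<exists>P\<in>\<P>. \<exists>w\<in>Wset P C c. \<exists>t. far n P w t" for N
    unfolding far_def by blast
  then have io: "\<exists>n\<ge>N. \<exists>Pw. adm Pw \<and> bad n Pw" for N
    unfolding adm_def bad_def split_paired_Ex fst_conv snd_conv by blast
  then obtain Pw0 where Pw0: "adm Pw0" by blast
  \<comment> \<open>A sequence must have a value at every n. Where an admissible bad pair exists, a
    bad one is taken; elsewhere the fixed pair \<open>Pw0\<close> fills the gap.\<close>
  have "\<exists>Pw. adm Pw \<and> ((\<exists>Pw. adm Pw \<and> bad n Pw) \<longrightarrow> bad n Pw)" for n
    using Pw0 by blast
  then obtain Pw where Pw: "\<And>n. adm (Pw n)" "\<And>n Pw'. adm Pw' \<Longrightarrow> bad n Pw' \<Longrightarrow> bad n (Pw n)"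
    by metis
  define P w where "P n = fst (Pw n)" and "w n = snd (Pw n)" for n
  have PP: "P n \<in> \<P>" and wP: "w n \<in> Wset (P n) C c" for n using Pw(1)[of n] by (auto simp: adm_def P_def w_def)
  obtain \<eta> K where \<eta>: "0 < \<eta>" and K: "\<And>Q. Q \<in> \<P> \<Longrightarrow> (\<integral>\<^sup>+\<omega>. ennreal (\<bar>epsP Q \<omega> * xiP Q \<omega>\<bar> powr (2 + \<eta>)) \<partial>Q) \<le> ennreal K"
    using assms(9) by blast
  have law: "gcm_law (P n) \<eta> K" for n
    using assms(1) PP \<eta> K by (intro gcm_lawI) auto
  interpret G: gcm_law "P n" \<eta> K for n by (rule law)
  have lawP: "law (P n)" for n by unfold_locales
  \<comment> \<open>\<open>tends_in_prob\<close> asks for measurable exceptional sets, so the events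
    in \<open>o_unif\<close> must be shown measurable; this rests on the joint measurability in
    \<open>regression_method\<close>.\<close>
  have m1 [measurable]: "(\<lambda>\<omega>. fP (P n) (Zv (\<omega> i)) - fhat regX n \<omega> (Zv (\<omega> i))) \<in> borel_measurable (sampleP (P n) n)"
       "(\<lambda>\<omega>. gP (P n) (Zv (\<omega> i)) - ghat regY n \<omega> (Zv (\<omega> i))) \<in> borel_measurable (sampleP (P n) n)" if "i < n" for n i
    by (rule law.fhat_ghat_measurable(1)[OF lawP assms(4) G.regression_functions_measurable(1) that])
       (rule law.fhat_ghat_measurable(2)[OF lawP assms(5) G.regression_functions_measurable(2) that])
  have m2 [measurable]: "(\<lambda>\<omega>. vP (P n) (Zv (\<omega> i))) \<in> borel_measurable (sampleP (P n) n)"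
       "(\<lambda>\<omega>. uP (P n) (Zv (\<omega> i))) \<in> borel_measurable (sampleP (P n) n)" if "i < n" for n i
    by (rule measurable_compose[OF G.component_sampleP[OF that] measurable_compose[OF G.measurable_coordinates(3) G.regression_functions_measurable(4)]])
       (rule measurable_compose[OF G.component_sampleP[OF that] measurable_compose[OF G.measurable_coordinates(3) G.regression_functions_measurable(3)]])
  have "(\<lambda>\<omega>. A_f (P n) regX n \<omega> * A_g (P n) regY n \<omega>) \<in> borel_measurable (sampleP (P n) n)" for n
    unfolding A_f_def A_g_def by measurable
  from o_unif_tends_in_prob[OF assms(6) PP this]
  have AA: "tends_in_prob (\<lambda>n. sampleP (P n) n) (\<lambda>n \<omega>. A_f (P n) regX n \<omega> * A_g (P n) regY n \<omega> / (1 / real n)) 0" .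
  have "B_f (P n) regX n \<in> borel_measurable (sampleP (P n) n)" for n
    unfolding B_f_def[abs_def] by measurable
  from o_unif_tends_in_prob[OF assms(7) PP this]
  have Bf: "tends_in_prob (\<lambda>n. sampleP (P n) n) (\<lambda>n \<omega>. B_f (P n) regX n \<omega>) 0" by simp
  have "B_g (P n) regY n \<in> borel_measurable (sampleP (P n) n)" for n
    unfolding B_g_def[abs_def] by measurable
  from o_unif_tends_in_prob[OF assms(8) PP this]
  have Bg: "tends_in_prob (\<lambda>n. sampleP (P n) n) (\<lambda>n \<omega>. B_g (P n) regY n \<omega>) 0" by simp
  obtain N where N: "\<And>n t. n \<ge> N \<Longrightarrow> \<bar>\<P>(\<omega> in sampleP (P n) n. T_w regX regY (w n) n \<omega> \<le> t) - Phi t\<bar> \<le> \<epsilon>"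
    using gcm_sequence[OF law assms(2-5) wP AA Bf Bg \<epsilon>] by blast
  \<comment> \<open>Bad pairs occur at arbitrarily late stages, so one occurs beyond
    \<open>N\<close>; there the chosen pair is bad too.\<close>
  obtain n Pw' where "n \<ge> N" "adm Pw'" "bad n Pw'" using io by blast
  with Pw(2) have "bad n (Pw n)" by blast
  then show False using N[OF \<open>n \<ge> N\<close>] by (auto simp: bad_def far_def P_def w_def)
qed

end
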